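(* Consider a distributed storage system (DSS) with $n$ noncolluding databases that uses an $[n,k]$ MDS-PIR capacity-achieving code $\mathscr{C}$ over $\mathbb{F}_q$ to store $f$ messages, and let the $\mu$ candidate functions be the linear functions given by the rows of a matrix $V\in\mathbb{F}_q^{\mu\times f}$ (all rows nonzero) of rank $r$. Then the private linear computation (PLC) capacity, i.e., the maximum achievable PLC rate over all possible PLC protocols, is $$\mathsf{C}_{\mathrm{PLC}}=\left(1-\frac{k}{n}\right)\left[1-\left(\frac{k}{n}\right)^{r}\right]^{-1},$$ (the right-hand side being read as $\bigl(\sum_{v=0}^{r-1}(k/n)^v\bigr)^{-1}$ when $k=n$).
   Context: Notation: $[a]=\{1,\ldots,a\}$; all entropies $H$ are in $q$-ary units (logarithm base $q$). MDS-PIR capacity-achieving code: for an $[n,k]$ linear code $\mathscr{C}$ with generator matrix $G$, an information set is a set $\mathcal{I}\subseteq[n]$ of size $k$ such that the columns of $G$ indexed by $\mathcal{I}$ form an invertible matrix. A PIR achievable rate matrix for $\mathscr{C}$ is a $\nu\times n$ binary matrix $\Lambda_{\kappa,\nu}$ such that every column has Hamming weight $\kappa$ and the support of every row contains an information set of $\mathscr{C}$. The code is MDS-PIR capacity-achieving if such a matrix exists with $\kappa/\nu=k/n$. Storage: there are $f$ independent messages $\mathbf{W}^{(1)},\ldots,\mathbf{W}^{(f)}$; each $\mathbf{W}^{(m)}$ is a random $\beta\times k$ matrix with entries i.i.d. uniform over $\mathbb{F}_q$, also written as a vector $(W^{(m)}_1,\ldots,W^{(m)}_{\mathsf{L}})$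 with $\mathsf{L}=\beta k$. Each row $\mathbf{W}^{(m)}_i$ is encoded as $(C^{(m)}_{i,1},\ldots,C^{(m)}_{i,n})=\mathbf{W}^{(m)}_iG$. Database $j\in[n]$ stores $\mathbf{C}_j=(C^{(m)}_{i,j})_{i\in[\beta],m\in[f]}$. The parameter $\beta$ may be chosen by the scheme. Candidate linear functions: for $l\in[\mathsf{L}]$, $(X^{(1)}_l,\ldots,X^{(\mu)}_l)^{\mathsf T}=V\,(W^{(1)}_l,\ldots,W^{(f)}_l)^{\mathsf T}$, and $\mathbf{X}^{(v)}=(X^{(v)}_1,\ldots,X^{(v)}_{\mathsf{L}})$, $\mathbf{X}^{[\mu]}=(\mathbf{X}^{(1)},\ldots,\mathbf{X}^{(\mu)})$. Since the rows of $V$ are nonzero, each $X^{(v)}_l$ is uniform on $\mathbb{F}_q$, so $\mathsf{H}_{\min}=\min_vH(X^{(v)}_l)=1$. PLC protocol: for each desired index $v\in[\mu]$ the user sends a (random) query $Q^{(v)}_j$ to each database $j\in[n]$. The queries are independent of the messages, so in particular $I(\mathbf{X}^{(1)},\ldots,\mathbf{X}^{(\mu)};Q^{(v)}_1,\ldots,Q^{(v)}_n)=0$. Database $j$ returns an answer $A^{(v)}_j$ that is a deterministic function of $Q^{(v)}_j$ and $\mathbf{C}_j$. The protocol must satisfy, for all $v\ne v'$ in $[\mu]$ and $j\in[n]$: (privacy) $(Q^{(v)}_j,A^{(v)}_j,\mathbf{X}^{[\mu]})$ and $(Q^{(v')}_j,A^{(v')}_j,\mathbf{X}^{[\mu]})$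 are identically distributed; (recovery) $H(\mathbf{X}^{(v)}\mid A^{(v)}_1,\ldots,A^{(v)}_n,Q^{(v)}_1,\ldots,Q^{(v)}_n)=0$. Rate: the rate of a protocol is $\mathsf{R}=\mathsf{L}\mathsf{H}_{\min}/\mathsf{D}$, where $\mathsf{D}=\sum_{j=1}^nH(A^{(v)}_j)$ is the total download cost (independent of $v$ by privacy). The capacity is the maximum of rates over all protocols (with arbitrary $\beta$) for the given storage code and $V$. *)

theory Defs
  imports
    "HOL-Probability.Probability"
    "Jordan_Normal_Form.DL_Rank"
    "Jordan_Normal_Form.DL_Submatrix"
begin

text \<open>
  All indices start at 0, so \<open>[a]\<close> becomes \<open>{..<a}\<close>.  The code is given by a generator matrix
  \<open>G\<close> (\<open>k = dim_row G\<close>, \<open>n = dim_col G\<close>), the candidate functions by \<open>V\<close>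
  (\<open>\<mu> = dim_row V\<close>, \<open>f = dim_col V\<close>), and \<open>q = CARD('q)\<close>.
\<close>

definition information_set :: "'q::field mat \<Rightarrow> nat set \<Rightarrow> bool" where
  "information_set G I \<longleftrightarrow>
     I \<subseteq> {..<dim_col G} \<and> card I = dim_row G \<and> invertible_mat (submatrix G UNIV I)"

definition pir_achievable_rate_matrix :: "'q::field mat \<Rightarrow> nat \<Rightarrow> nat \<Rightarrow> nat mat \<Rightarrow> bool" where
  "pir_achievable_rate_matrix G \<kappa> \<nu> \<Lambda> \<longleftrightarrow>
     \<Lambda> \<in> carrier_mat \<nu> (dim_col G) \<and>
     (\<forall>u<\<nu>. \<forall>j<dim_col G. \<Lambda> $$ (u, j) \<in> {0, 1}) \<and>
     (\<forall>j<dim_col G. card {u. u < \<nu> \<and> \<Lambda> $$ (u, j) \<noteq> 0} = \<kappa>) \<and>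
     (\<forall>u<\<nu>. \<exists>I. information_set G I \<and> I \<subseteq> {j. j < dim_col G \<and> \<Lambda> $$ (u, j) \<noteq> 0})"

definition MDS_PIR_capacity_achieving :: "'q::field mat \<Rightarrow> bool" where
  "MDS_PIR_capacity_achieving G \<longleftrightarrow>
     (\<exists>\<kappa> \<nu> \<Lambda>. 0 < \<nu> \<and> pir_achievable_rate_matrix G \<kappa> \<nu> \<Lambda> \<and>
       real \<kappa> / real \<nu> = real (dim_row G) / real (dim_col G))"

text \<open>
  The \<open>f\<close> messages are a function \<open>w\<close> on \<open>{..<f}\<close> with values in the \<open>\<beta> \<times> k\<close> matrices.  The uniform
  distribution on these functions makes all matrix entries i.i.d. uniform.
\<close>

definition message_pmf :: "nat \<Rightarrow> nat \<Rightarrow> nat \<Rightarrow> (nat \<Rightarrow> 'q::{field,finite} mat) pmf" where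
  "message_pmf f \<beta> k = pmf_of_set ({..<f} \<rightarrow>\<^sub>E carrier_mat \<beta> k)"

definition database_content :: "'q::field mat \<Rightarrow> nat \<Rightarrow> nat \<Rightarrow> (nat \<Rightarrow> 'q mat) \<Rightarrow> nat \<Rightarrow> 'q vec" where
  "database_content G f j w = (\<lambda>m\<in>{..<f}. col (w m * G) j)"

text \<open>Row \<open>m\<close> of this matrix is message \<open>m\<close>, read row by row, as a vector of length \<open>\<beta> * k\<close>.\<close>

definition message_matrix :: "nat \<Rightarrow> nat \<Rightarrow> nat \<Rightarrow> (nat \<Rightarrow> 'q mat) \<Rightarrow> 'q mat" where
  "message_matrix f \<beta> k w = mat f (\<beta> * k) (\<lambda>(m, l). w m $$ (l div k, l mod k))"

text \<open>Row \<open>v\<close> of this matrix is the candidate function value \<open>X\<^sup>(\<^sup>v\<^sup>)\<close>; the whole matrix is the tuple of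
  all of them.\<close>

definition candidate_matrix ::
    "'q::field mat \<Rightarrow> 'q mat \<Rightarrow> nat \<Rightarrow> (nat \<Rightarrow> 'q mat) \<Rightarrow> 'q mat" where
  "candidate_matrix G V \<beta> w = V * message_matrix (dim_col V) \<beta> (dim_row G) w"

text \<open>
  Queries and answers are discrete random variables, encoded as natural numbers.  In
  \<^term>\<open>query_dist P v\<close>, the joint law of the queries for the desired index \<open>v\<close>, the value at \<open>j\<close> is
  the query sent to database \<open>j\<close>; values at \<open>j \<ge> n\<close> are never used.  A database knows its
  query and its content but not \<open>v\<close>.
\<close>

record 'q plc_protocol =
  block :: nat
  query_dist :: "nat \<Rightarrow> (nat \<Rightarrow> nat) pmf"
  answer :: "nat \<Rightarrow> nat \<Rightarrow> (nat \<Rightarrow> 'q vec) \<Rightarrow> nat"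

text \<open>The product distribution expresses that the queries are independent of the messages.\<close>

definition plc_pmf :: "'q::{field,finite} mat \<Rightarrow> 'q mat \<Rightarrow> 'q plc_protocol \<Rightarrow> nat
    \<Rightarrow> ((nat \<Rightarrow> 'q mat) \<times> (nat \<Rightarrow> nat)) pmf" where
  "plc_pmf G V P v =
     pair_pmf (message_pmf (dim_col V) (block P) (dim_row G)) (query_dist P v)"

definition plc_answer :: "'q::field mat \<Rightarrow> 'q mat \<Rightarrow> 'q plc_protocol \<Rightarrow> nat
    \<Rightarrow> (nat \<Rightarrow> 'q mat) \<times> (nat \<Rightarrow> nat) \<Rightarrow> nat" where
  "plc_answer G V P j = (\<lambda>(w, Q). answer P j (Q j) (database_content G (dim_col V) j w))"

definition plc_private :: "'q::{field,finite} mat \<Rightarrow> 'q mat \<Rightarrow> 'q plc_protocol \<Rightarrow> bool" where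
  "plc_private G V P \<longleftrightarrow>
     (\<forall>v<dim_row V. \<forall>v'<dim_row V. v \<noteq> v' \<longrightarrow> (\<forall>j<dim_col G.
        map_pmf (\<lambda>(w, Q). (Q j, plc_answer G V P j (w, Q), candidate_matrix G V (block P) w))
          (plc_pmf G V P v) =
        map_pmf (\<lambda>(w, Q). (Q j, plc_answer G V P j (w, Q), candidate_matrix G V (block P) w))
          (plc_pmf G V P v')))"

definition plc_recoverable :: "'q::{field,finite} mat \<Rightarrow> 'q mat \<Rightarrow> 'q plc_protocol \<Rightarrow> bool" where
  "plc_recoverable G V P \<longleftrightarrow>
     (\<forall>v<dim_row V.
        prob_space.conditional_entropy (measure_pmf (plc_pmf G V P v)) (real CARD('q))
          (count_space (carrier_vec (block P * dim_row G))) (count_space UNIV)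
          (\<lambda>(w, Q). row (candidate_matrix G V (block P) w) v)
          (\<lambda>(w, Q). (map (\<lambda>j. plc_answer G V P j (w, Q)) [0..<dim_col G], map Q [0..<dim_col G]))
        = 0)"

text \<open>
  The library entropy is a real number and takes a junk value when the entropy is infinite.
  A protocol whose download cost is infinite has rate 0 and does not affect the capacity,
  so we exclude such protocols.
\<close>

definition finite_download :: "'q::{field,finite} mat \<Rightarrow> 'q mat \<Rightarrow> 'q plc_protocol \<Rightarrow> bool" where
  "finite_download G V P \<longleftrightarrow>
     (\<forall>v<dim_row V. \<forall>j<dim_col G.
        information_space.finite_entropy (measure_pmf (plc_pmf G V P v)) (real CARD('q))
          (count_space UNIV) (plc_answer G V P j)
          (pmf (map_pmf (plc_answer G V P j) (plc_pmf G V P v))))"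

definition plc_protocol_for :: "'q::{field,finite} mat \<Rightarrow> 'q mat \<Rightarrow> 'q plc_protocol \<Rightarrow> bool" where
  "plc_protocol_for G V P \<longleftrightarrow>
     0 < block P \<and> plc_private G V P \<and> plc_recoverable G V P \<and> finite_download G V P"

definition download_cost :: "'q::{field,finite} mat \<Rightarrow> 'q mat \<Rightarrow> 'q plc_protocol \<Rightarrow> nat \<Rightarrow> real" where
  "download_cost G V P v =
     (\<Sum>j<dim_col G. prob_space.entropy (measure_pmf (plc_pmf G V P v)) (real CARD('q))
        (count_space UNIV) (plc_answer G V P j))"

text \<open>For fixed \<open>v\<close> all components of the candidate function value have the same distribution;
  component 0 represents them.\<close>

definition H_min :: "'q::{field,finite} mat \<Rightarrow> 'q mat \<Rightarrow> nat \<Rightarrow> real" where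
  "H_min G V \<beta> =
     (MIN v\<in>{..<dim_row V}. prob_space.entropy
        (measure_pmf (message_pmf (dim_col V) \<beta> (dim_row G))) (real CARD('q))
        (count_space UNIV) (\<lambda>w. candidate_matrix G V \<beta> w $$ (v, 0)))"

text \<open>By privacy the download cost does not depend on the desired index \<open>v\<close>.\<close>

definition achievable_rate :: "'q::{field,finite} mat \<Rightarrow> 'q mat \<Rightarrow> real \<Rightarrow> bool" where
  "achievable_rate G V R \<longleftrightarrow>
     (\<exists>P. plc_protocol_for G V P \<and>
        (\<forall>v<dim_row V.
           R = real (block P * dim_row G) * H_min G V (block P) / download_cost G V P v))"

definition is_plc_capacity :: "'q::{field,finite} mat \<Rightarrow> 'q mat \<Rightarrow> real \<Rightarrow> bool" where
  "is_plc_capacity G V C \<longleftrightarrow> achievable_rate G V C \<and> (\<forall>R. achievable_rate G V R \<longrightarrow> R \<le> C)"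

end

theory Submission
  imports Defs
begin

text \<open>
  \<^emph>\<open>Converse.\<close>  Condition on the candidate functions decoded so far.  The databases of an information
  set store independent contents, so their answers have additive conditional entropy.  As the
  \<open>\<nu>\<close> information sets cover every database \<open>\<kappa>\<close> times and \<open>\<kappa> / \<nu> = k / n\<close>, the joint conditional entropy of
  all answers is at least \<open>k / n\<close> times the sum of the individual ones, and decoding one more independent
  function lowers it by \<open>L\<close>.  Privacy permits another desired function at every step.

  \<^emph>\<open>Achievability.\<close>  The requested sums are organised as the wedge multiplication
  \<open>E \<otimes> \<Lambda>\<^sup>p E \<rightarrow> \<Lambda>\<^sup>p\<^sup>+\<^sup>1 E\<close>, where \<open>E\<close> has one basis vector for each of \<open>r\<close> basis functions.  This map
  commutes with \<open>GL(E)\<close>, so a change of basis that makes the desired function the first basis vector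
  only transforms the query by an invertible linear map.  As the stored rows are mixed by a uniformly random
  invertible matrix, every database sees a uniformly random query.  In the new basis, the sums not
  involving the desired function are decoded from one information set and serve as side information
  at the databases outside of it.
\<close>

section \<open>Exterior powers\<close>

text \<open>Privacy constrains one database at a time, so the converse can use it only on sums of
  entropies of single answers; this is why every step returns from the joint entropy to such a sum.
  All these entropies are taken for a fixed query and averaged over the queries afterwards. The
  capacity is a maximum, so the scheme has to meet the bound exactly, for every finite field and
  every \<open>V\<close>. The word \<open>x\<close> uses \<kappa> letters because \<kappa>
  information sets contain a given database, and \<open>y\<close> uses \<delta> = \<nu> - \<kappa>
  letters for the others. A set of size p thus has \<kappa>^(r-p) \<delta>^p copies, and the
  binomial theorem gives \<nu>^r labels in all. This is also the number of stored rows, so the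
  mixing matrix is square. The answers in degree p+1 contribute binom(r, p+1) \<kappa>^(r-p)
  \<delta>^p symbols, in total \<kappa> times the sum of \<nu>^(r-1-v) \<kappa>^v over v < r; with
  \<kappa> n = \<nu> k, all n databases together send exactly L times the sum of (k/n)^v. The
  entropy of an answer is never computed: the number of its symbols is an upper bound, and the
  converse forces equality.\<close>

definition ssgn :: "nat \<Rightarrow> nat set \<Rightarrow> 'a::comm_ring_1" where
  "ssgn t T = (- 1) ^ card {s \<in> T. s < t}"

text \<open>Left multiplication by the vector \<open>e\<close> in the exterior algebra, in
  coordinates: \<open>y\<close> lists the coefficients of a multivector on sorted products of basis
  vectors, and \<open>ssgn t T\<close> is the sign of moving \<open>t\<close> to the front of
  \<open>T\<close>. On infinite \<open>T\<close> the sum defaults to 0.\<close>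

definition wedge :: "(nat \<Rightarrow> 'a::comm_ring_1) \<Rightarrow> (nat set \<Rightarrow> 'a) \<Rightarrow> nat set \<Rightarrow> 'a" where
  "wedge e y T = (\<Sum>t\<in>T. ssgn t T * e t * y (T - {t}))"

text \<open>Removing \<open>s < t\<close> first lowers the position of \<open>t\<close> by one,
  whereas removing \<open>t\<close> first leaves the position of \<open>s\<close> unchanged.\<close>

lemma ssgn_swap:
  assumes "finite T" "s \<in> T" "t \<in> T" "s < t"
  shows "ssgn t T * ssgn s (T - {t}) = - (ssgn s T * ssgn t (T - {s}) :: 'a::comm_ring_1)"
proof -
  have 1: "{u \<in> T - {t}. u < s} = {u \<in> T. u < s}" using assms by auto
  have 2: "{u \<in> T. u < t} = insert s {u \<in> T - {s}. u < t}" using assms by auto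
  have 3: "card {u \<in> T. u < t} = Suc (card {u \<in> T - {s}. u < t})"
    unfolding 2 using assms by (subst card_insert_disjoint) auto
  show ?thesis unfolding ssgn_def 1 3 by simp
qed

lemma wedge_add_left: "wedge (\<lambda>t. e t + e' t) y = (\<lambda>T. wedge e y T + wedge e' y T)"
  by (auto simp: wedge_def fun_eq_iff algebra_simps sum.distrib)

lemma wedge_add_right: "wedge e (\<lambda>S. y S + y' S) = (\<lambda>T. wedge e y T + wedge e y' T)"
  by (auto simp: wedge_def fun_eq_iff algebra_simps sum.distrib)

lemma wedge_sum_left: "wedge (\<lambda>t. \<Sum>i\<in>A. a i * e i t) y = (\<lambda>T. \<Sum>i\<in>A. a i * wedge (e i) y T)"
proof
  fix T
  have "wedge (\<lambda>t. \<Sum>i\<in>A. a i * e i t) y T = (\<Sum>t\<in>T. \<Sum>i\<in>A. a i * (ssgn t T * e i t * y (T - {t})))"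
    by (simp add: wedge_def sum_distrib_left sum_distrib_right mult_ac)
  also have "\<dots> = (\<Sum>i\<in>A. a i * wedge (e i) y T)"
    by (subst sum.swap) (simp add: wedge_def sum_distrib_left)
  finally show "wedge (\<lambda>t. \<Sum>i\<in>A. a i * e i t) y T = (\<Sum>i\<in>A. a i * wedge (e i) y T)" .
qed

lemma wedge_sum_right: "wedge e (\<lambda>S. \<Sum>i\<in>A. a i * y i S) = (\<lambda>T. \<Sum>i\<in>A. a i * wedge e (y i) T)"
proof
  fix T
  have "wedge e (\<lambda>S. \<Sum>i\<in>A. a i * y i S) T = (\<Sum>t\<in>T. \<Sum>i\<in>A. a i * (ssgn t T * e t * y i (T - {t})))"
    by (simp add: wedge_def sum_distrib_left mult_ac)
  also have "\<dots> = (\<Sum>i\<in>A. a i * wedge e (y i) T)"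
    by (subst sum.swap) (simp add: wedge_def sum_distrib_left)
  finally show "wedge e (\<lambda>S. \<Sum>i\<in>A. a i * y i S) T = (\<Sum>i\<in>A. a i * wedge e (y i) T)" .
qed

lemma wedge_infinite: "infinite T \<Longrightarrow> wedge e y T = 0"
  by (simp add: wedge_def)

text \<open>In characteristic 2 this does not follow from anticommutativity; the terms for the pairs
  \<open>(s, t)\<close> and \<open>(t, s)\<close> cancel.\<close>

lemma wedge_self: "wedge e (wedge e y) = (\<lambda>_. 0)"
proof
  fix T show "wedge e (wedge e y) T = 0"
  proof (cases "finite T")
    case True
    define F where "F = (\<lambda>t s. ssgn t T * e t * (ssgn s (T - {t}) * e s * y (T - {t} - {s})))"
    have anti: "F t s = - F s t" if "s \<in> T" "t \<in> T" "s < t" for s t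
    proof -
      have "F t s = (ssgn t T * ssgn s (T - {t})) * (e t * e s * y (T - {t} - {s}))"
        by (simp add: F_def mult_ac)
      also have "\<dots> = - ((ssgn s T * ssgn t (T - {s})) * (e t * e s * y (T - {s} - {t})))"
        unfolding ssgn_swap[OF True that] by (simp add: Diff_insert2[symmetric] insert_commute)
      also have "\<dots> = - F s t" by (simp add: F_def mult_ac)
      finally show ?thesis .
    qed
    have "wedge e (wedge e y) T = (\<Sum>t\<in>T. \<Sum>s\<in>T - {t}. F t s)"
      by (simp add: wedge_def F_def sum_distrib_left)
    also have "\<dots> = (\<Sum>t\<in>T. (\<Sum>s\<in>{s \<in> T. s < t}. F t s) + (\<Sum>s\<in>{s \<in> T. t < s}. F t s))"
    proof (rule sum.cong[OF refl])
      fix t assume "t \<in> T"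
      have un: "T - {t} = {s \<in> T. s < t} \<union> {s \<in> T. t < s}" by auto
      show "(\<Sum>s\<in>T - {t}. F t s) = (\<Sum>s\<in>{s \<in> T. s < t}. F t s) + (\<Sum>s\<in>{s \<in> T. t < s}. F t s)"
        unfolding un by (rule sum.union_disjoint) (use True in auto)
    qed
    also have "\<dots> = (\<Sum>t\<in>T. \<Sum>s\<in>{s \<in> T. s < t}. F t s) + (\<Sum>t\<in>T. \<Sum>s\<in>{s \<in> T. t < s}. F t s)"
      by (rule sum.distrib)
    also have "(\<Sum>t\<in>T. \<Sum>s\<in>{s \<in> T. t < s}. F t s) = (\<Sum>s\<in>T. \<Sum>t\<in>{t \<in> T. t < s}. F t s)"
      by (rule sum.swap_restrict[OF True True])
    also have "\<dots> = (\<Sum>s\<in>T. \<Sum>t\<in>{t \<in> T. t < s}. - F s t)"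
    proof (rule sum.cong[OF refl], rule sum.cong[OF refl])
      fix s t assume "s \<in> T" "t \<in> {t \<in> T. t < s}"
      then have "F s t = - F t s" by (intro anti) auto
      then show "F t s = - F s t" by simp
    qed
    finally show ?thesis by (simp add: sum_negf)
  qed (simp add: wedge_infinite)
qed

lemma wedge_anticommute: "wedge e (wedge e' y) T = - wedge e' (wedge e y) T"
proof -
  \<comment> \<open>Polarisation: the square of the sum vanishes, and so do the squares of both
    summands.\<close>
  have "wedge (\<lambda>t. e t + e' t) (wedge (\<lambda>t. e t + e' t) y) T = 0" by (simp add: wedge_self)
  then have "wedge e (wedge e' y) T + wedge e' (wedge e y) T = 0"
    by (simp add: wedge_add_left wedge_add_right wedge_self)
  then show ?thesis by (rule add_eq_0_iff2[THEN iffD1, rule_format])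
qed

section \<open>Exterior powers of a linear map\<close>

definition bvec :: "nat \<Rightarrow> nat \<Rightarrow> 'a::comm_ring_1" where
  "bvec t s = (if s = t then 1 else 0)"

definition bset :: "nat set \<Rightarrow> nat set \<Rightarrow> 'a::comm_ring_1" where
  "bset S S' = (if S' = S then 1 else 0)"

fun wedges :: "(nat \<Rightarrow> nat \<Rightarrow> 'a::comm_ring_1) \<Rightarrow> nat list \<Rightarrow> nat set \<Rightarrow> 'a" where
  "wedges h [] = bset {}"
| "wedges h (s # ss) = wedge (h s) (wedges h ss)"

text \<open>Column \<open>S\<close> of the exterior power of the linear map \<open>h\<close>; \<open>h s\<close> is the image of basis vector \<open>s\<close>.\<close>

definition ext_col :: "(nat \<Rightarrow> nat \<Rightarrow> 'a::comm_ring_1) \<Rightarrow> nat set \<Rightarrow> nat set \<Rightarrow> 'a" where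
  "ext_col h S = wedges h (sorted_list_of_set S)"

definition ext_map :: "(nat \<Rightarrow> nat \<Rightarrow> 'a::comm_ring_1) \<Rightarrow> nat \<Rightarrow> (nat set \<Rightarrow> 'a) \<Rightarrow> nat set \<Rightarrow> 'a" where
  "ext_map h r y = (\<lambda>S'. \<Sum>S\<in>Pow {..<r}. y S * ext_col h S S')"

text \<open>Every factor adds exactly one element, and this element lies below \<open>r\<close>
  because the vectors \<open>h s\<close> have no other coordinates.\<close>

lemma wedges_support:
  assumes "\<And>s t. s \<in> set ss \<Longrightarrow> h s t \<noteq> 0 \<Longrightarrow> t < r" "wedges h ss S \<noteq> 0"
  shows "S \<subseteq> {..<r} \<and> card S = length ss"
  using assms
proof (induction ss arbitrary: S)
  case Nil
  then show ?case by (auto simp: bset_def split: if_splits)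
next
  case (Cons s ss)
  from Cons.prems(2) have "wedge (h s) (wedges h ss) S \<noteq> 0" by simp
  then obtain t where "t \<in> S" "ssgn t S * h s t * wedges h ss (S - {t}) \<noteq> 0"
    unfolding wedge_def by (rule sum.not_neutral_contains_not_neutral)
  then have t: "t \<in> S" "h s t \<noteq> 0" "wedges h ss (S - {t}) \<noteq> 0" by auto
  have "finite S" using Cons.prems(2) wedge_infinite by force
  have IH: "S - {t} \<subseteq> {..<r} \<and> card (S - {t}) = length ss"
    by (rule Cons.IH) (use Cons.prems(1) t in auto)
  have "t < r" using Cons.prems(1) t by auto
  then show ?case using IH t card_Suc_Diff1[OF \<open>finite S\<close> t(1)] by auto
qed

lemma ext_col_support:
  assumes "\<forall>s<r. \<forall>t. h s t \<noteq> 0 \<longrightarrow> t < r" "S \<subseteq> {..<r}" "ext_col h S S' \<noteq> 0"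
  shows "S' \<subseteq> {..<r} \<and> card S' = card S"
proof -
  have "finite S" using assms(2) finite_subset by blast
  then show ?thesis using wedges_support[of "sorted_list_of_set S" h r S'] assms by (auto simp: ext_col_def)
qed

lemma ssgn_insert:
  assumes "finite T" "s \<notin> T" "s < t"
  shows "ssgn t (insert s T) = - ssgn t T"
proof -
  have "{u \<in> insert s T. u < t} = insert s {u \<in> T. u < t}" using assms by auto
  then show ?thesis using assms by (simp add: ssgn_def)
qed

text \<open>Moving the factor \<open>h t\<close> to its sorted place costs one sign for each smaller
  index, which is what \<open>ssgn\<close> counts; if it meets an equal factor, the product vanishes
  by \<open>wedge_self\<close>.\<close>

lemma wedge_wedges:
  assumes "sorted ss" "distinct ss"
  shows "wedge (h t) (wedges h ss) =
    (\<lambda>T. if t \<in> set ss then 0 else ssgn t (set ss) * wedges h (insort t ss) T)"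
  using assms
proof (induction ss)
  case Nil
  then show ?case by (simp add: ssgn_def)
next
  case (Cons s ss)
  show ?case
  proof (cases "t = s")
    case True
    then show ?thesis by (simp add: wedge_self)
  next
    case ne: False
    show ?thesis
    proof (cases "t < s")
      case True
      then have "{u \<in> insert s (set ss). u < t} = {}" "t \<notin> set ss" using Cons.prems by auto
      moreover from this have "(ssgn t (insert s (set ss)) :: 'a) = 1" by (simp only: ssgn_def) simp
      ultimately show ?thesis using True ne by (simp add: less_imp_le)
    next
      case False
      then have lt: "s < t" using ne by simp
      have IH: "wedge (h t) (wedges h ss) =
        (\<lambda>T. if t \<in> set ss then 0 else ssgn t (set ss) * wedges h (insort t ss) T)"
        using Cons by simp
      have "wedge (h t) (wedges h (s # ss)) = (\<lambda>T. - wedge (h s) (wedge (h t) (wedges h ss)) T)"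
        by (rule ext) (simp add: wedge_anticommute[of "h t" "h s"])
      also have "\<dots> = (\<lambda>T. if t \<in> set (s # ss) then 0
          else ssgn t (set (s # ss)) * wedges h (insort t (s # ss)) T)"
      proof (cases "t \<in> set ss")
        case True
        then show ?thesis unfolding IH by (simp add: wedge_def)
      next
        case False
        have "s \<notin> set ss" using Cons.prems by simp
        then have sg: "(ssgn t (insert s (set ss)) :: 'a) = - ssgn t (set ss)"
          using lt by (intro ssgn_insert) auto
        have "wedge (h s) (\<lambda>T. ssgn t (set ss) * wedges h (insort t ss) T)
            = (\<lambda>T. ssgn t (set ss) * wedge (h s) (wedges h (insort t ss)) T)"
          using wedge_sum_right[where A = "{()}" and a = "\<lambda>_. ssgn t (set ss)"] by simp
        then show ?thesis unfolding IH using False ne lt sg by simp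
      qed
      finally show ?thesis .
    qed
  qed
qed

lemma ext_map_bset:
  assumes "S \<subseteq> {..<r}"
  shows "ext_map h r (bset S) = ext_col h S"
proof
  fix S'
  have "ext_map h r (bset S) S' = (\<Sum>R\<in>Pow {..<r}. if R = S then ext_col h S S' else 0)"
    unfolding ext_map_def by (intro sum.cong) (auto simp: bset_def)
  also have "\<dots> = ext_col h S S'" using assms by (simp add: sum.delta)
  finally show "ext_map h r (bset S) S' = ext_col h S S'" .
qed

lemma ext_map_sum: "ext_map h r (\<lambda>S. \<Sum>i\<in>A. a i * y i S) = (\<lambda>S. \<Sum>i\<in>A. a i * ext_map h r (y i) S)"
proof
  fix S'
  have "ext_map h r (\<lambda>S. \<Sum>i\<in>A. a i * y i S) S'
      = (\<Sum>S\<in>Pow {..<r}. \<Sum>i\<in>A. a i * (y i S * ext_col h S S'))"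
    by (simp only: ext_map_def sum_distrib_right mult.assoc)
  also have "\<dots> = (\<Sum>i\<in>A. a i * ext_map h r (y i) S')"
    by (subst sum.swap) (simp add: ext_map_def sum_distrib_left)
  finally show "ext_map h r (\<lambda>S. \<Sum>i\<in>A. a i * y i S) S' = (\<Sum>i\<in>A. a i * ext_map h r (y i) S')" .
qed

lemma ext_map_cong:
  assumes "\<And>S. S \<subseteq> {..<r} \<Longrightarrow> y S = y' S"
  shows "ext_map h r y = ext_map h r y'"
  unfolding ext_map_def using assms by (auto intro!: sum.cong)

lemma ext_map_scale: "ext_map h r (\<lambda>S. a * y S) = (\<lambda>S. a * ext_map h r y S)"
  using ext_map_sum[where A = "{()}" and a = "\<lambda>_. a"] by simp

lemma wedge_bvec_bset:
  assumes "finite S"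
  shows "wedge (bvec t) (bset S) = (\<lambda>T. if t \<in> S then 0 else ssgn t S * bset (insert t S) T :: 'a::comm_ring_1)"
proof
  fix T
  have sg: "ssgn t (insert t S) = (ssgn t S :: 'a)"
    unfolding ssgn_def by (rule arg_cong[where f = "\<lambda>A. (-1) ^ card A"]) auto
  have "(wedge (bvec t) (bset S) T :: 'a) = (\<Sum>u\<in>T. if u = t then ssgn t T * bset S (T - {t}) else (0::'a))"
    unfolding wedge_def by (intro sum.cong) (auto simp: bvec_def)
  also have "\<dots> = (if t \<in> S then 0 else ssgn t S * bset (insert t S) T)"
  proof (cases "finite T")
    case True
    then show ?thesis using sg by (auto simp: sum.delta bset_def)
  next
    case False
    then show ?thesis using assms by (auto simp: bset_def)
  qed
  finally show "wedge (bvec t) (bset S) T = (if t \<in> S then 0 else ssgn t S * bset (insert t S) T :: 'a)" .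
qed

text \<open>Inserting \<open>t\<close> into \<open>S\<close> produces the same sign and the same
  sorted product whether it is done before or after \<open>h\<close> is applied.\<close>

lemma ext_map_wedge_basis:
  assumes "t < r" "S \<subseteq> {..<r}"
  shows "ext_map h r (wedge (bvec t) (bset S)) = wedge (h t) (ext_col h S)"
proof -
  have fin: "finite S" using assms(2) finite_subset by blast
  show ?thesis
  proof (cases "t \<in> S")
    case True
    then show ?thesis using fin
      by (simp add: wedge_bvec_bset ext_col_def wedge_wedges ext_map_def)
  next
    case False
    have "ext_map h r (wedge (bvec t) (bset S)) = (\<lambda>T. ssgn t S * ext_map h r (bset (insert t S)) T)"
      using False fin by (simp add: wedge_bvec_bset ext_map_scale)
    also have "\<dots> = (\<lambda>T. ssgn t S * ext_col h (insert t S) T)"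
      using assms by (subst ext_map_bset) auto
    also have "\<dots> = wedge (h t) (ext_col h S)"
      using False fin by (simp add: ext_col_def wedge_wedges sorted_list_of_set_insert)
    finally show ?thesis .
  qed
qed

lemma bset_expansion:
  assumes "S \<subseteq> {..<r}"
  shows "y S = (\<Sum>R\<in>Pow {..<r}. y R * bset R S)"
proof -
  have "(\<Sum>R\<in>Pow {..<r}. y R * bset R S) = (\<Sum>R\<in>Pow {..<r}. if R = S then y S else 0)"
    by (intro sum.cong) (auto simp: bset_def)
  then show ?thesis using assms by (simp add: sum.delta)
qed

text \<open>The equivariance behind the whole scheme: exterior powers respect products. Both sides
  are linear in \<open>y\<close>, which leaves only the basis vectors.\<close>

lemma ext_map_wedge:
  assumes "t < r"
  shows "ext_map h r (wedge (bvec t) y) = wedge (h t) (ext_map h r y)"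
proof -
  have "ext_map h r (wedge (bvec t) y)
      = ext_map h r (wedge (bvec t) (\<lambda>S. \<Sum>R\<in>Pow {..<r}. y R * bset R S))"
  proof (rule ext_map_cong)
    fix S :: "nat set" assume S: "S \<subseteq> {..<r}"
    show "wedge (bvec t) y S = wedge (bvec t) (\<lambda>S. \<Sum>R\<in>Pow {..<r}. y R * bset R S) S"
      unfolding wedge_def
      by (intro sum.cong refl arg_cong2[where f = "(*)"] bset_expansion) (use S in auto)
  qed
  also have "\<dots> = (\<lambda>T. \<Sum>R\<in>Pow {..<r}. y R * wedge (h t) (ext_col h R) T)"
    unfolding wedge_sum_right ext_map_sum
    by (intro ext sum.cong refl) (simp add: ext_map_wedge_basis assms)
  also have "\<dots> = wedge (h t) (ext_map h r y)"
    unfolding ext_map_def wedge_sum_right ..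
  finally show ?thesis .
qed

text \<open>Multiplication by \<open>h' s\<close> is a combination of multiplications by basis
  vectors, so \<open>ext_map h r\<close> turns it into multiplication by the image of
  \<open>h' s\<close>, which is basis vector \<open>s\<close>. Repeating this for each factor undoes
  \<open>h'\<close>.\<close>

lemma ext_map_ext_col:
  assumes h': "\<forall>s<r. \<forall>t. h' s t \<noteq> 0 \<longrightarrow> t < r"
    and inv: "\<forall>s<r. \<forall>t. (\<Sum>u<r. h' s u * h u t) = bvec s t"
    and S: "S \<subseteq> {..<r}"
  shows "ext_map h r (ext_col h' S) = bset S"
proof -
  have wed: "ext_map h r (wedge (h' s) y) = wedge (bvec s) (ext_map h r y)" if "s < r" for s y
  proof -
    have e: "h' s = (\<lambda>t. \<Sum>u<r. h' s u * bvec u t)"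
    proof
      fix t
      have "(\<Sum>u<r. h' s u * bvec u t) = (\<Sum>u<r. if u = t then h' s t else 0)"
        by (intro sum.cong) (auto simp: bvec_def)
      then show "h' s t = (\<Sum>u<r. h' s u * bvec u t)"
        using h' that by (cases "h' s t = 0") auto
    qed
    have "ext_map h r (wedge (h' s) y) = ext_map h r (wedge (\<lambda>t. \<Sum>u<r. h' s u * bvec u t) y)"
      by (rule arg_cong[where f = "\<lambda>x. ext_map h r (wedge x y)", OF e])
    also have "\<dots> = (\<lambda>T. \<Sum>u<r. h' s u * wedge (h u) (ext_map h r y) T)"
      unfolding wedge_sum_left ext_map_sum
      by (rule ext, rule sum.cong[OF refl]) (simp add: ext_map_wedge)
    also have "\<dots> = wedge (\<lambda>t. \<Sum>u<r. h' s u * h u t) (ext_map h r y)"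
      by (rule wedge_sum_left[symmetric])
    also have "(\<lambda>t. \<Sum>u<r. h' s u * h u t) = bvec s"
      using inv that by auto
    finally show ?thesis .
  qed
  have "ext_map h r (wedges h' ss) = wedges bvec ss" if "set ss \<subseteq> {..<r}" for ss
    using that
  proof (induction ss)
    case Nil
    then show ?case by (simp add: ext_map_bset ext_col_def)
  next
    case (Cons s ss)
    then show ?case by (simp add: wed)
  qed
  then have "ext_map h r (ext_col h' S) = wedges bvec (sorted_list_of_set S)"
    unfolding ext_col_def using S finite_subset by (metis finite_lessThan set_sorted_list_of_set)
  also have "\<dots> = bset S"
  proof -
    have "wedges bvec ss = bset (set ss)" if "sorted ss" "distinct ss" for ss
      using that
    proof (induction ss)
      case (Cons s ss)
      then have "{u \<in> set ss. u < s} = {}" by auto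
      then have "ssgn s (set ss) = (1::'b)" by (simp only: ssgn_def) simp
      then show ?case using Cons by (simp add: wedge_bvec_bset)
    qed simp
    from this[of "sorted_list_of_set S"] show ?thesis
      using S finite_subset by (simp add: finite_subset[OF S])
  qed
  finally show ?thesis .
qed

lemma ext_map_inverse:
  assumes "\<forall>s<r. \<forall>t. h' s t \<noteq> 0 \<longrightarrow> t < r"
    and "\<forall>s<r. \<forall>t. (\<Sum>u<r. h' s u * h u t) = bvec s t"
    and "S \<subseteq> {..<r}"
  shows "ext_map h r (ext_map h' r y) S = y S"
proof -
  have "ext_map h r (ext_map h' r y) S = (\<Sum>R\<in>Pow {..<r}. y R * bset R S)"
    unfolding ext_map_def[of h'] ext_map_sum
    by (intro sum.cong refl) (use ext_map_ext_col[OF assms(1,2)] in auto)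
  then show ?thesis using bset_expansion[OF assms(3), of y] by simp
qed

section \<open>Labels and coefficient matrices\<close>

text \<open>The second condition says that the \<beta> rows are linearly independent; for
  \<open>card A = \<beta>\<close> these are the invertible matrices with columns indexed by
  \<open>A\<close>. Prescribing 0 elsewhere makes equal matrices equal functions and keeps the set
  finite.\<close>

definition inj_coeffs :: "nat \<Rightarrow> 'l set \<Rightarrow> (nat \<Rightarrow> 'l \<Rightarrow> 'a::field) set" where
  "inj_coeffs \<beta> A = {M. (\<forall>i l. \<not> (i < \<beta> \<and> l \<in> A) \<longrightarrow> M i l = 0) \<and>
     (\<forall>x. (\<forall>l\<in>A. (\<Sum>i<\<beta>. x i * M i l) = 0) \<longrightarrow> (\<forall>i<\<beta>. x i = 0))}"

lemma inj_coeffs_eq_0: "M \<in> inj_coeffs \<beta> A \<Longrightarrow> \<not> (i < \<beta> \<and> l \<in> A) \<Longrightarrow> M i l = 0"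
  unfolding inj_coeffs_def by blast

lemma inj_coeffs_inj:
  "M \<in> inj_coeffs \<beta> A \<Longrightarrow> (\<And>l. l \<in> A \<Longrightarrow> (\<Sum>i<\<beta>. c i * M i l) = 0) \<Longrightarrow> i < \<beta> \<Longrightarrow> c i = 0"
  unfolding inj_coeffs_def by blast

lemma finite_inj_coeffs:
  fixes A :: "'l set"
  assumes "finite A"
  shows "finite (inj_coeffs \<beta> A :: (nat \<Rightarrow> 'l \<Rightarrow> 'a::{field,finite}) set)"
proof -
  let ?F = "{f :: nat \<times> 'l \<Rightarrow> 'a. \<forall>p. (p \<in> {..<\<beta>} \<times> A \<longrightarrow> f p \<in> UNIV) \<and> (p \<notin> {..<\<beta>} \<times> A \<longrightarrow> f p = 0)}"
  have "finite ?F" using assms by (intro finite_set_of_finite_funs) auto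
  moreover have "inj_coeffs \<beta> A \<subseteq> curry ` ?F"
  proof
    fix M :: "nat \<Rightarrow> 'l \<Rightarrow> 'a" assume "M \<in> inj_coeffs \<beta> A"
    then have "\<not> (i < \<beta> \<and> l \<in> A) \<Longrightarrow> M i l = 0" for i l by (rule inj_coeffs_eq_0)
    then have "case_prod M \<in> ?F" by fastforce
    then have "curry (case_prod M) \<in> curry ` ?F" by (rule imageI)
    then show "M \<in> curry ` ?F" by simp
  qed
  ultimately show ?thesis by (meson finite_imageI finite_subset)
qed

lemma inj_coeffs_nonempty:
  assumes "finite A" "\<beta> \<le> card A"
  shows "(inj_coeffs \<beta> A :: (nat \<Rightarrow> 'l \<Rightarrow> 'a::field) set) \<noteq> {}"
proof -
  obtain \<phi> where \<phi>: "\<phi> ` {..<\<beta>} \<subseteq> A" "inj_on \<phi> {..<\<beta>}"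
    using card_le_inj[of "{..<\<beta>}" A] assms by auto
  define M :: "nat \<Rightarrow> 'l \<Rightarrow> 'a" where "M = (\<lambda>i l. if i < \<beta> \<and> l = \<phi> i then 1 else 0)"
  have "M \<in> inj_coeffs \<beta> A"
    unfolding inj_coeffs_def mem_Collect_eq
  proof (intro conjI allI impI)
    fix i l assume "\<not> (i < \<beta> \<and> l \<in> A)"
    then show "M i l = 0" using \<phi>(1) by (auto simp: M_def)
  next
    fix x i assume x: "\<forall>l\<in>A. (\<Sum>i<\<beta>. x i * M i l) = 0" and i: "i < \<beta>"
    have "(\<Sum>i'<\<beta>. x i' * M i' (\<phi> i)) = (\<Sum>i'<\<beta>. if i' = i then x i else 0)"
      using i \<phi>(2) by (intro sum.cong) (auto simp: M_def inj_on_def)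
    moreover have "\<phi> i \<in> A" using \<phi>(1) i by auto
    ultimately show "x i = 0" using x i by simp
  qed
  then show ?thesis by auto
qed

definition relabel :: "nat \<Rightarrow> 'l set \<Rightarrow> ('l \<Rightarrow> 'm) \<Rightarrow> (nat \<Rightarrow> 'm \<Rightarrow> 'a::zero) \<Rightarrow> nat \<Rightarrow> 'l \<Rightarrow> 'a" where
  "relabel \<beta> A P M i l = (if i < \<beta> \<and> l \<in> A then M i (P l) else 0)"

lemma relabel_inj_coeffs:
  fixes M :: "nat \<Rightarrow> 'm \<Rightarrow> 'a::field"
  assumes P: "P ` A = B" and M: "M \<in> inj_coeffs \<beta> B"
  shows "relabel \<beta> A P M \<in> inj_coeffs \<beta> A"
  unfolding inj_coeffs_def mem_Collect_eq
proof (intro conjI allI impI)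
  fix c i assume c: "\<forall>l\<in>A. (\<Sum>i<\<beta>. c i * relabel \<beta> A P M i l) = 0" and i: "i < \<beta>"
  have "(\<Sum>i<\<beta>. c i * M i l) = 0" if "l \<in> B" for l
  proof -
    obtain l' where l': "l' \<in> A" "l = P l'" using P \<open>l \<in> B\<close> by auto
    have "(\<Sum>i<\<beta>. c i * M i l) = (\<Sum>i<\<beta>. c i * relabel \<beta> A P M i l')"
      by (rule sum.cong) (simp_all add: relabel_def l')
    then show ?thesis using c l'(1) by simp
  qed
  then show "c i = 0" using inj_coeffs_inj[OF M] i by blast
qed (auto simp: relabel_def)

lemma bij_betw_relabel:
  assumes P: "bij_betw P A B"
  shows "bij_betw (relabel \<beta> A P) (inj_coeffs \<beta> B) (inj_coeffs \<beta> A :: (nat \<Rightarrow> 'l \<Rightarrow> 'a::field) set)"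
proof (rule bij_betw_byWitness[where f' = "relabel \<beta> B (inv_into A P)"])
  have PA: "P l \<in> B" "inv_into A P (P l) = l" if "l \<in> A" for l
    using P that by (auto simp: bij_betw_def)
  have PB: "inv_into A P l \<in> A" "P (inv_into A P l) = l" if "l \<in> B" for l
    using P that by (auto simp: bij_betw_def inv_into_into f_inv_into_f)
  show "\<forall>M\<in>inj_coeffs \<beta> B. relabel \<beta> B (inv_into A P) (relabel \<beta> A P M) = M"
    using PB by (auto simp: relabel_def fun_eq_iff inj_coeffs_eq_0)
  show "\<forall>M\<in>inj_coeffs \<beta> A. relabel \<beta> A P (relabel \<beta> B (inv_into A P) M) = M"
    using PA by (auto simp: relabel_def fun_eq_iff inj_coeffs_eq_0)
  show "relabel \<beta> A P ` inj_coeffs \<beta> B \<subseteq> inj_coeffs \<beta> A"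
    using P by (intro image_subsetI relabel_inj_coeffs) (auto simp: bij_betw_def)
  show "relabel \<beta> B (inv_into A P) ` inj_coeffs \<beta> A \<subseteq> inj_coeffs \<beta> B"
    using bij_betw_inv_into[OF P]
    by (intro image_subsetI relabel_inj_coeffs) (auto simp: bij_betw_def)
qed

text \<open>A label \<open>(S, x, y)\<close> stands for the basis vector \<open>S\<close> of one copy of an exterior power; the words
  \<open>x\<close> and \<open>y\<close> number the copies.\<close>

type_synonym label = "nat set \<times> nat list \<times> nat list"

definition labels :: "nat \<Rightarrow> nat \<Rightarrow> nat \<Rightarrow> label set" where
  "labels r \<kappa> \<delta> = {(S, x, y). S \<subseteq> {..<r} \<and> length y = card S \<and> length x + card S = r \<and>
     set x \<subseteq> {..<\<kappa>} \<and> set y \<subseteq> {..<\<delta>}}"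

text \<open>Names of the mixed rows that do not depend on the database: \<open>u\<close> is the
  information set assigned to the row, and \<open>S\<close> omits the index 0, which is reserved for
  the desired function.\<close>

definition row_labels :: "nat \<Rightarrow> nat \<Rightarrow> nat \<Rightarrow> (nat \<times> label) set" where
  "row_labels r \<kappa> \<delta> = {(u, S, x, y). u < \<kappa> + \<delta> \<and> S \<subseteq> {1..<r} \<and> length y = card S \<and>
     Suc (length x + card S) = r \<and> set x \<subseteq> {..<\<kappa>} \<and> set y \<subseteq> {..<\<delta>}}"

text \<open>Wedge multiplication raises the degree by one, so \<open>T\<close> has one element more
  than the word \<open>y\<close>, whose length is the degree of the coefficients.\<close>

definition answer_labels :: "nat \<Rightarrow> nat \<Rightarrow> nat \<Rightarrow> label set" where
  "answer_labels r \<kappa> \<delta> = {(T, x, y). T \<subseteq> {..<r} \<and> Suc (length y) = card T \<and> length x + length y = r \<and>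
     set x \<subseteq> {..<\<kappa>} \<and> set y \<subseteq> {..<\<delta>}}"

text \<open>The letter removed from a word selects the information set: one that contains the
  database, through \<sigma>, if \<open>0 \<notin> S\<close>, and one that avoids it, through
  \<tau>, if \<open>0 \<in> S\<close>. At a database outside its information set, a mixed row thus
  appears only together with the basis vector 0; there its product with the desired function is
  zero, and it contributes interference only.\<close>

definition row_of :: "(nat \<Rightarrow> nat) \<Rightarrow> (nat \<Rightarrow> nat) \<Rightarrow> label \<Rightarrow> nat \<times> label" where
  "row_of \<sigma> \<tau> = (\<lambda>(S, x, y). if 0 \<in> S then (\<tau> (hd y), S - {0}, x, tl y) else (\<sigma> (hd x), S, tl x, y))"

definition ext_coeffs :: "(nat \<Rightarrow> nat \<Rightarrow> 'a::field) \<Rightarrow> nat \<Rightarrow> (nat \<Rightarrow> label \<Rightarrow> 'a) \<Rightarrow> nat \<Rightarrow> label \<Rightarrow> 'a" where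
  "ext_coeffs h r N i = (\<lambda>(S, x, y). ext_map h r (\<lambda>S'. N i (S', x, y)) S)"

text \<open>Basis function \<open>t\<close> enters as the basis vector \<open>bvec t\<close>,
  weighted by its stored symbols \<open>\<xi> t i\<close>.\<close>

definition wedge_answer :: "nat \<Rightarrow> nat \<Rightarrow> (nat \<Rightarrow> label \<Rightarrow> 'a::field) \<Rightarrow> (nat \<Rightarrow> nat \<Rightarrow> 'a) \<Rightarrow> label \<Rightarrow> 'a" where
  "wedge_answer r \<beta> N \<xi> = (\<lambda>(T, x, y). \<Sum>t<r. wedge (bvec t) (\<lambda>S. \<Sum>i<\<beta>. \<xi> t i * N i (S, x, y)) T)"

lemma ext_map_support:
  assumes "\<forall>s<r. \<forall>t. h s t \<noteq> 0 \<longrightarrow> t < r" and "ext_map h r y S \<noteq> 0"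
  shows "\<exists>S'. S' \<subseteq> {..<r} \<and> S \<subseteq> {..<r} \<and> card S' = card S \<and> y S' \<noteq> 0"
proof -
  obtain S' where S': "S' \<in> Pow {..<r}" "y S' * ext_col h S' S \<noteq> 0"
    using assms(2) unfolding ext_map_def by (rule sum.not_neutral_contains_not_neutral)
  then have "S \<subseteq> {..<r} \<and> card S = card S'"
    by (intro ext_col_support[of r h]) (use assms(1) in auto)
  then show ?thesis using S' by (intro exI[of _ S']) auto
qed

lemma ext_map_zero: "ext_map h r (\<lambda>_. 0) = (\<lambda>_. 0)"
  by (simp add: ext_map_def)

lemma ext_coeffs_inverse:
  assumes h': "\<forall>s<r. \<forall>t. h' s t \<noteq> 0 \<longrightarrow> t < r"
    and inv: "\<forall>s<r. \<forall>t. (\<Sum>u<r. h' s u * h u t) = bvec s t"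
    and l: "(S, x, y) \<in> labels r \<kappa> \<delta>"
  shows "ext_coeffs h r (ext_coeffs h' r N) i (S, x, y) = N i (S, x, y)"
  using ext_map_inverse[OF h' inv, where y = "\<lambda>S. N i (S, x, y)"] l
  by (simp add: ext_coeffs_def labels_def)

lemma finite_labels: "finite (labels r \<kappa> \<delta>)"
proof (rule finite_subset)
  show "labels r \<kappa> \<delta> \<subseteq> Pow {..<r} \<times> {x. set x \<subseteq> {..<\<kappa>} \<and> length x \<le> r} \<times> {y. set y \<subseteq> {..<\<delta>} \<and> length y \<le> r}"
    by (auto simp: labels_def)
qed (auto intro!: finite_cartesian_product finite_lists_length_le)

text \<open>The one-sided inverse gives injectivity, and an injective map of a finite set into
  itself is onto. Independence of the rows survives because the same inverse carries a relation
  between the new rows back to the old ones.\<close>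

lemma bij_betw_ext_coeffs:
  fixes h h' :: "nat \<Rightarrow> nat \<Rightarrow> 'a::{field,finite}"
  assumes h': "\<forall>s<r. \<forall>t. h' s t \<noteq> 0 \<longrightarrow> t < r"
    and inv: "\<forall>s<r. \<forall>t. (\<Sum>u<r. h' s u * h u t) = bvec s t"
  shows "bij_betw (ext_coeffs h' r) (inj_coeffs \<beta> (labels r \<kappa> \<delta>)) (inj_coeffs \<beta> (labels r \<kappa> \<delta>))"
proof -
  let ?L = "labels r \<kappa> \<delta>"
  have inj: "inj_on (ext_coeffs h' r) (inj_coeffs \<beta> ?L)"
  proof (rule inj_onI)
    fix M N :: "nat \<Rightarrow> label \<Rightarrow> 'a"
    assume MN: "M \<in> inj_coeffs \<beta> ?L" "N \<in> inj_coeffs \<beta> ?L" and eq: "ext_coeffs h' r M = ext_coeffs h' r N"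
    show "M = N"
    proof (intro ext)
      fix i l
      show "M i l = N i l"
      proof (cases "l \<in> ?L")
        case True
        obtain S x y where l: "l = (S, x, y)" by (cases l)
        note inverse = ext_coeffs_inverse[OF h' inv True[unfolded l], where i = i]
        show ?thesis using inverse[where N = M] inverse[where N = N] unfolding eq l by simp
      next
        case False
        then show ?thesis using MN inj_coeffs_eq_0[of M \<beta> ?L i l] inj_coeffs_eq_0[of N \<beta> ?L i l] by simp
      qed
    qed
  qed
  have maps: "ext_coeffs h' r N \<in> inj_coeffs \<beta> ?L" if N: "N \<in> inj_coeffs \<beta> ?L" for N
    unfolding inj_coeffs_def mem_Collect_eq
  proof (intro conjI allI impI)
    fix i and l :: label assume il: "\<not> (i < \<beta> \<and> l \<in> ?L)"
    obtain S x y where l: "l = (S, x, y)" by (cases l)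
    show "ext_coeffs h' r N i l = 0"
    proof (rule ccontr)
      assume "ext_coeffs h' r N i l \<noteq> 0"
      then have "ext_map h' r (\<lambda>S'. N i (S', x, y)) S \<noteq> 0" by (simp add: ext_coeffs_def l)
      then obtain S' where S': "S' \<subseteq> {..<r}" "S \<subseteq> {..<r}" "card S' = card S" "N i (S', x, y) \<noteq> 0"
        using ext_map_support[OF h'] by blast
      then have "i < \<beta>" "(S', x, y) \<in> ?L" using inj_coeffs_eq_0[OF N, of i "(S', x, y)"] by auto
      then show False using il S' by (auto simp: labels_def l)
    qed
  next
    fix c i assume c: "\<forall>l\<in>?L. (\<Sum>i<\<beta>. c i * ext_coeffs h' r N i l) = 0" and i: "i < \<beta>"
    have "(\<Sum>i<\<beta>. c i * N i l) = 0" if "l \<in> ?L" for l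
    proof -
      obtain S x y where l: "l = (S, x, y)" by (cases l)
      define z where "z = (\<lambda>S. \<Sum>i<\<beta>. c i * N i (S, x, y))"
      have z0: "z S' = 0" if "(S', x, y) \<notin> ?L" for S'
        using inj_coeffs_eq_0[OF N] that unfolding z_def by (intro sum.neutral) simp
      have "ext_map h' r z S' = 0" for S'
      proof (rule ccontr)
        assume nz: "ext_map h' r z S' \<noteq> 0"
        from ext_map_support[OF h' nz]
        obtain S'' where S'': "S'' \<subseteq> {..<r}" "S' \<subseteq> {..<r}" "card S'' = card S'" "z S'' \<noteq> 0"
          by (elim exE conjE)
        have "(S'', x, y) \<in> ?L" using z0[of S''] S''(4) by argo
        then have "(S', x, y) \<in> ?L" using S''(2,3) by (simp add: labels_def)
        moreover have "ext_map h' r z S' = (\<Sum>i<\<beta>. c i * ext_coeffs h' r N i (S', x, y))"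
          by (simp add: z_def ext_map_sum ext_coeffs_def)
        ultimately show False using c nz by simp
      qed
      then have "ext_map h' r z = (\<lambda>_. 0)" by auto
      then have "z S = 0"
        using ext_map_inverse[OF h' inv, of S z] that by (auto simp: l labels_def ext_map_zero)
      then show ?thesis by (simp add: z_def l)
    qed
    then show "c i = 0" using inj_coeffs_inj[OF N] i by blast
  qed
  have "ext_coeffs h' r ` inj_coeffs \<beta> ?L = inj_coeffs \<beta> ?L"
    by (rule endo_inj_surj) (use inj maps in \<open>auto intro!: finite_inj_coeffs finite_labels\<close>)
  then show ?thesis using inj by (simp add: bij_betw_def)
qed

lemma sum_wedge_bvec:
  assumes "T \<subseteq> {..<r}"
  shows "(\<Sum>t<r. wedge (h t) (y t) T) = (\<Sum>s\<in>T. ssgn s T * (\<Sum>t<r. h t s * y t (T - {s})))"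
  unfolding wedge_def by (subst sum.swap) (simp add: sum_distrib_left mult.assoc)

section \<open>Decoding\<close>

text \<open>Whether \<open>u\<close> lies in \<open>U\<close> tells which word has lost its first
  letter, and as \<sigma> and \<tau> are bijections this letter can be restored from
  \<open>u\<close>.\<close>

lemma bij_betw_row_of:
  assumes r: "0 < r" and \<sigma>: "bij_betw \<sigma> {..<\<kappa>} U" and \<tau>: "bij_betw \<tau> {..<\<delta>} ({..<\<kappa> + \<delta>} - U)"
    and U: "U \<subseteq> {..<\<kappa> + \<delta>}"
  shows "bij_betw (row_of \<sigma> \<tau>) (labels r \<kappa> \<delta>) (row_labels r \<kappa> \<delta>)"
proof (rule bij_betw_byWitness[where f' = "\<lambda>(u, S, x, y). if u \<in> U then (S, inv_into {..<\<kappa>} \<sigma> u # x, y)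
      else (insert 0 S, x, inv_into {..<\<delta>} \<tau> u # y)"])
  have s1: "\<sigma> a \<in> U" "\<sigma> a < \<kappa> + \<delta>" "inv_into {..<\<kappa>} \<sigma> (\<sigma> a) = a" if "a < \<kappa>" for a
    using \<sigma> that U by (auto simp: bij_betw_def)
  have s2: "inv_into {..<\<kappa>} \<sigma> u < \<kappa>" "\<sigma> (inv_into {..<\<kappa>} \<sigma> u) = u" if "u \<in> U" for u
  proof -
    have "u \<in> \<sigma> ` {..<\<kappa>}" using \<sigma> that by (simp add: bij_betw_def)
    then show "inv_into {..<\<kappa>} \<sigma> u < \<kappa>" "\<sigma> (inv_into {..<\<kappa>} \<sigma> u) = u"
      by (metis inv_into_into lessThan_iff) (rule f_inv_into_f, fact)
  qed
  have t1: "\<tau> a \<notin> U" "\<tau> a < \<kappa> + \<delta>" "inv_into {..<\<delta>} \<tau> (\<tau> a) = a" if "a < \<delta>" for a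
    using \<tau> that by (auto simp: bij_betw_def)
  have t2: "inv_into {..<\<delta>} \<tau> u < \<delta>" "\<tau> (inv_into {..<\<delta>} \<tau> u) = u" if "u \<notin> U" "u < \<kappa> + \<delta>" for u
  proof -
    have "u \<in> \<tau> ` {..<\<delta>}" using \<tau> that by (simp add: bij_betw_def)
    then show "inv_into {..<\<delta>} \<tau> u < \<delta>" "\<tau> (inv_into {..<\<delta>} \<tau> u) = u"
      by (metis inv_into_into lessThan_iff) (rule f_inv_into_f, fact)
  qed
  have sub: "S - {0} \<subseteq> {1..<r}" if "S \<subseteq> {..<r}" for S :: "nat set"
  proof
    fix s assume s: "s \<in> S - {0}"
    then have "s < r" using that by blast
    then show "s \<in> {1..<r}" using s by auto
  qed
  have out: "row_of \<sigma> \<tau> l \<in> row_labels r \<kappa> \<delta> \<and> (case row_of \<sigma> \<tau> l of (u, S, x, y) \<Rightarrow>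
      if u \<in> U then (S, inv_into {..<\<kappa>} \<sigma> u # x, y) else (insert 0 S, x, inv_into {..<\<delta>} \<tau> u # y)) = l"
    if "l \<in> labels r \<kappa> \<delta>" for l
  proof -
    obtain S x y where l: "l = (S, x, y)" by (cases l)
    have S: "S \<subseteq> {..<r}" "length y = card S" "length x + card S = r"
      "set x \<subseteq> {..<\<kappa>}" "set y \<subseteq> {..<\<delta>}"
      using that by (auto simp: labels_def l)
    have fin: "finite S" using S(1) finite_subset by blast
    show ?thesis
    proof (cases "0 \<in> S")
      case True
      then have "card S = Suc (card (S - {0}))" using card_Suc_Diff1[OF fin True] by simp
      moreover from this S(2) obtain b y' where "y = b # y'" by (cases y) auto
      ultimately show ?thesis using S True sub[OF S(1)] t1[of b]
        by (simp add: row_of_def row_labels_def l insert_absorb)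
    next
      case False
      then have "S \<subseteq> {1..<r}" using sub[OF S(1)] by simp
      \<comment> \<open>Without 0 the set has at most \<open>r - 1\<close> elements, so
        \<open>x\<close> is nonempty and \<open>hd x\<close> is a proper letter.\<close>
      moreover from this have "card S \<le> card {1..<r}" by (intro card_mono) auto
      moreover from this r S(3) obtain a x' where "x = a # x'" by (cases x) auto
      ultimately show ?thesis using S False s1[of a] U
        by (simp add: row_of_def row_labels_def l)
    qed
  qed
  then show "\<forall>l\<in>labels r \<kappa> \<delta>. (case row_of \<sigma> \<tau> l of (u, S, x, y) \<Rightarrow>
      if u \<in> U then (S, inv_into {..<\<kappa>} \<sigma> u # x, y) else (insert 0 S, x, inv_into {..<\<delta>} \<tau> u # y)) = l"
    by blast
  show "row_of \<sigma> \<tau> ` labels r \<kappa> \<delta> \<subseteq> row_labels r \<kappa> \<delta>" using out by blast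
  have inv_in: "(if u \<in> U then (S, inv_into {..<\<kappa>} \<sigma> u # x, y) else (insert 0 S, x, inv_into {..<\<delta>} \<tau> u # y))
      \<in> labels r \<kappa> \<delta> \<and>
    row_of \<sigma> \<tau> (if u \<in> U then (S, inv_into {..<\<kappa>} \<sigma> u # x, y) else (insert 0 S, x, inv_into {..<\<delta>} \<tau> u # y))
      = (u, S, x, y)"
    if "(u, S, x, y) \<in> row_labels r \<kappa> \<delta>" for u S x y
  proof -
    have S: "u < \<kappa> + \<delta>" "S \<subseteq> {1..<r}" "length y = card S" "Suc (length x + card S) = r"
      "set x \<subseteq> {..<\<kappa>}" "set y \<subseteq> {..<\<delta>}"
      using that by (auto simp: row_labels_def)
    have fin: "finite S" "0 \<notin> S" "S \<subseteq> {..<r}" using S(2) finite_subset by auto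
    show ?thesis
      using S fin s2[of u] t2[of u] r by (auto simp: labels_def row_of_def)
  qed
  then show "\<forall>l\<in>row_labels r \<kappa> \<delta>. row_of \<sigma> \<tau> (case l of (u, S, x, y) \<Rightarrow>
      if u \<in> U then (S, inv_into {..<\<kappa>} \<sigma> u # x, y) else (insert 0 S, x, inv_into {..<\<delta>} \<tau> u # y)) = l"
    by auto
  show "(\<lambda>(u, S, x, y). if u \<in> U then (S, inv_into {..<\<kappa>} \<sigma> u # x, y)
      else (insert 0 S, x, inv_into {..<\<delta>} \<tau> u # y)) ` row_labels r \<kappa> \<delta> \<subseteq> labels r \<kappa> \<delta>"
    using inv_in by auto
qed

text \<open>The sum \<kappa> + \<delta> is the number of information sets and \<open>g\<close> the
  generator matrix; \<open>info_inj\<close> says that only the zero message has a codeword vanishing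
  on an information set.\<close>

locale information_cover =
  fixes n k \<kappa> \<delta> :: nat and g :: "nat \<Rightarrow> nat \<Rightarrow> 'a::field" and I :: "nat \<Rightarrow> nat set"
  assumes info_subset: "u < \<kappa> + \<delta> \<Longrightarrow> I u \<subseteq> {..<n}"
    and info_inj: "u < \<kappa> + \<delta> \<Longrightarrow> (\<And>j. j \<in> I u \<Longrightarrow> (\<Sum>a<k. x a * g a j) = 0) \<Longrightarrow> a < k \<Longrightarrow> x a = 0"
    and cover: "j < n \<Longrightarrow> card {u. u < \<kappa> + \<delta> \<and> j \<in> I u} = \<kappa>"
begin

definition "contains j = {u. u < \<kappa> + \<delta> \<and> j \<in> I u}"

definition "\<sigma> j = (SOME f. bij_betw f {..<\<kappa>} (contains j))"

definition "\<tau> j = (SOME f. bij_betw f {..<\<delta>} ({..<\<kappa> + \<delta>} - contains j))"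

lemma bij_betw_sigma:
  assumes "j < n"
  shows "bij_betw (\<sigma> j) {..<\<kappa>} (contains j)"
proof -
  have "finite (contains j)" "card (contains j) = \<kappa>" using cover[OF assms] by (auto simp: contains_def)
  then show ?thesis unfolding \<sigma>_def by (intro someI_ex[of "\<lambda>f. bij_betw f _ _"] finite_same_card_bij) auto
qed

lemma bij_betw_tau:
  assumes "j < n"
  shows "bij_betw (\<tau> j) {..<\<delta>} ({..<\<kappa> + \<delta>} - contains j)"
proof -
  have "contains j \<subseteq> {..<\<kappa> + \<delta>}" "finite (contains j)" "card (contains j) = \<kappa>"
    using cover[OF assms] by (auto simp: contains_def)
  then have "card ({..<\<kappa> + \<delta>} - contains j) = \<delta>" by (simp add: card_Diff_subset)
  then show ?thesis unfolding \<tau>_def by (intro someI_ex[of "\<lambda>f. bij_betw f _ _"] finite_same_card_bij) auto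
qed

lemma bij_betw_row:
  assumes "j < n" "0 < r"
  shows "bij_betw (row_of (\<sigma> j) (\<tau> j)) (labels r \<kappa> \<delta>) (row_labels r \<kappa> \<delta>)"
  by (rule bij_betw_row_of[OF assms(2) bij_betw_sigma[OF assms(1)] bij_betw_tau[OF assms(1)]])
    (auto simp: contains_def)

text \<open>All databases share the random \<open>M\<close>. The desired function enters only
  through \<open>h'\<close>, after a renaming of columns that depends on \<open>j\<close>; both
  operations are bijections, so that a single query is uniform for every desired function.\<close>

definition query :: "nat \<Rightarrow> nat \<Rightarrow> (nat \<Rightarrow> nat \<Rightarrow> 'a) \<Rightarrow> (nat \<Rightarrow> nat \<times> label \<Rightarrow> 'a) \<Rightarrow> nat \<Rightarrow> nat \<Rightarrow> label \<Rightarrow> 'a" where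
  "query r \<beta> h' M j = ext_coeffs h' r (relabel \<beta> (labels r \<kappa> \<delta>) (row_of (\<sigma> j) (\<tau> j)) M)"

text \<open>The terms of \<open>\<beta>\<close> rows and \<open>r\<close> basis functions are \<open>\<xi> t i a\<close>; database \<open>j\<close> sees their
  coded versions.\<close>

definition coded :: "(nat \<Rightarrow> nat \<Rightarrow> nat \<Rightarrow> 'a) \<Rightarrow> nat \<Rightarrow> nat \<Rightarrow> nat \<Rightarrow> 'a" where
  "coded \<xi> j t i = (\<Sum>a<k. \<xi> t i a * g a j)"

definition mixed :: "nat \<Rightarrow> nat \<Rightarrow> (nat \<Rightarrow> nat \<Rightarrow> 'a) \<Rightarrow> (nat \<Rightarrow> nat \<times> label \<Rightarrow> 'a) \<Rightarrow> (nat \<Rightarrow> nat \<Rightarrow> nat \<Rightarrow> 'a)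
    \<Rightarrow> nat \<Rightarrow> nat \<times> label \<Rightarrow> nat \<Rightarrow> 'a" where
  "mixed r \<beta> h M \<xi> s l a = (\<Sum>t<r. h t s * (\<Sum>i<\<beta>. M i l * \<xi> t i a))"

text \<open>The answers for fixed words \<open>x\<close>, \<open>y\<close> are the coordinates of
  one multivector in the old basis. Applying \<open>ext_map h r\<close> to it undoes
  \<open>h'\<close> in the query and replaces \<open>bvec t\<close> by \<open>h t\<close>.\<close>

lemma answer_in_new_basis:
  assumes h': "\<forall>s<r. \<forall>t. h' s t \<noteq> 0 \<longrightarrow> t < r"
    and inv: "\<forall>s<r. \<forall>t. (\<Sum>u<r. h' s u * h u t) = bvec s t"
    and ans: "\<And>l. l \<in> answer_labels r \<kappa> \<delta> \<Longrightarrow> wedge_answer r \<beta> (query r \<beta> h' M j) (coded \<xi> j) l = 0"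
    and T: "(T, x, y) \<in> answer_labels r \<kappa> \<delta>"
  shows "(\<Sum>s\<in>T. ssgn s T * (\<Sum>a<k. mixed r \<beta> h M \<xi> s (row_of (\<sigma> j) (\<tau> j) (T - {s}, x, y)) a * g a j)) = 0"
proof -
  let ?L = "labels r \<kappa> \<delta>"
  define N where "N = relabel \<beta> ?L (row_of (\<sigma> j) (\<tau> j)) M"
  define z where "z = (\<lambda>t S. \<Sum>i<\<beta>. coded \<xi> j t i * N i (S, x, y))"
  have z0: "z t S = 0" if "(S, x, y) \<notin> ?L" for t S
    using that unfolding z_def by (intro sum.neutral) (simp add: N_def relabel_def)
  have q: "(\<lambda>S. \<Sum>i<\<beta>. coded \<xi> j t i * query r \<beta> h' M j i (S, x, y)) = ext_map h' r (z t)" for t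
    unfolding z_def ext_map_sum by (simp add: query_def N_def ext_coeffs_def)
  \<comment> \<open>The coordinates outside \<open>answer_labels\<close> vanish because the degree
    is wrong, so the multivector is zero on every subset, as \<open>ext_map\<close> requires. The
    factor 1 only fits the form of \<open>ext_map_sum\<close>.\<close>
  have all0: "(\<Sum>t<r. 1 * wedge (bvec t) (ext_map h' r (z t)) R) = 0" if R: "R \<subseteq> {..<r}" for R
  proof (cases "(R, x, y) \<in> answer_labels r \<kappa> \<delta>")
    case True
    then show ?thesis using ans[OF True] by (simp add: wedge_answer_def q)
  next
    case False
    have "ext_map h' r (z t) (R - {s}) = 0" if s: "s \<in> R" for t s
    proof (rule ccontr)
      assume "ext_map h' r (z t) (R - {s}) \<noteq> 0"
      from ext_map_support[OF h' this] obtain S' where S': "card S' = card (R - {s})" "z t S' \<noteq> 0"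
        by (elim exE conjE)
      then have "(S', x, y) \<in> ?L" using z0[of S' t] by argo
      moreover have "card R = Suc (card (R - {s}))"
        using card_Suc_Diff1[OF finite_subset[OF R] s] by simp
      ultimately show False using False R S'(1) by (auto simp: labels_def answer_labels_def)
    qed
    then show ?thesis by (simp add: wedge_def)
  qed
  have TR: "T \<subseteq> {..<r}" using T by (simp add: answer_labels_def)
  have fin: "finite T" using TR finite_subset by blast
  have "0 = ext_map h r (\<lambda>_. 0) T" by (simp add: ext_map_zero)
  also have "\<dots> = ext_map h r (\<lambda>R. \<Sum>t<r. 1 * wedge (bvec t) (ext_map h' r (z t)) R) T"
    using all0 by (intro fun_cong[OF ext_map_cong]) auto
  also have "\<dots> = (\<Sum>t<r. wedge (h t) (ext_map h r (ext_map h' r (z t))) T)"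
    unfolding ext_map_sum by (intro sum.cong) (auto simp: ext_map_wedge)
  also have "\<dots> = (\<Sum>t<r. wedge (h t) (z t) T)"
    unfolding wedge_def using TR
    by (intro sum.cong refl arg_cong2[where f = "(*)"] ext_map_inverse[OF h' inv]) auto
  also have "\<dots> = (\<Sum>s\<in>T. ssgn s T * (\<Sum>t<r. h t s * z t (T - {s})))"
    by (rule sum_wedge_bvec[OF TR])
  also have "\<dots> = (\<Sum>s\<in>T. ssgn s T * (\<Sum>a<k. mixed r \<beta> h M \<xi> s (row_of (\<sigma> j) (\<tau> j) (T - {s}, x, y)) a * g a j))"
  proof (rule sum.cong[OF refl], rule arg_cong2[where f = "(*)", OF refl])
    fix s assume s: "s \<in> T"
    let ?l = "(T - {s}, x, y)"
    have lL: "?l \<in> ?L" using T s fin by (auto simp: labels_def answer_labels_def card_Diff_singleton)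
    define Y where "Y = (\<lambda>t a. \<Sum>i<\<beta>. M i (row_of (\<sigma> j) (\<tau> j) ?l) * \<xi> t i a)"
    have "z t (T - {s}) = (\<Sum>a<k. Y t a * g a j)" for t
      using lL unfolding z_def N_def relabel_def coded_def Y_def sum_distrib_right
      by (subst sum.swap) (auto intro!: sum.cong)
    then have "(\<Sum>t<r. h t s * z t (T - {s})) = (\<Sum>t<r. \<Sum>a<k. h t s * Y t a * g a j)"
      by (simp add: sum_distrib_left mult.assoc)
    also have "\<dots> = (\<Sum>a<k. mixed r \<beta> h M \<xi> s (row_of (\<sigma> j) (\<tau> j) ?l) a * g a j)"
      by (subst sum.swap) (simp add: mixed_def sum_distrib_right Y_def)
    finally show "(\<Sum>t<r. h t s * z t (T - {s}))
        = (\<Sum>a<k. mixed r \<beta> h M \<xi> s (row_of (\<sigma> j) (\<tau> j) ?l) a * g a j)" .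
  qed
  finally show ?thesis by simp
qed

text \<open>The answers with \<open>0 \<notin> T\<close> determine the interference, which the answers with \<open>0 \<in> T\<close> add to
  the desired symbols.\<close>

lemma desired_function_determined:
  assumes h': "\<forall>s<r. \<forall>t. h' s t \<noteq> 0 \<longrightarrow> t < r"
    and inv: "\<forall>s<r. \<forall>t. (\<Sum>u<r. h' s u * h u t) = bvec s t"
    and M: "M \<in> inj_coeffs \<beta> (row_labels r \<kappa> \<delta>)"
    and ans: "\<And>j l. j < n \<Longrightarrow> l \<in> answer_labels r \<kappa> \<delta> \<Longrightarrow>
        wedge_answer r \<beta> (query r \<beta> h' M j) (coded \<xi> j) l = 0"
    and i: "i < \<beta>" and a: "a < k"
  shows "(\<Sum>t<r. h t 0 * \<xi> t i a) = 0"
proof -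
  let ?m = "mixed r \<beta> h M \<xi>"
  have row: "(\<Sum>s\<in>T. ssgn s T * (\<Sum>a<k. ?m s (row_of (\<sigma> j) (\<tau> j) (T - {s}, x, y)) a * g a j)) = 0"
    if "j < n" "(T, x, y) \<in> answer_labels r \<kappa> \<delta>" for j T x y
    by (rule answer_in_new_basis[OF h' inv ans that(2)]) (use that in auto)
  have pre: "\<exists>b<\<kappa>. \<sigma> j b = u" if "u < \<kappa> + \<delta>" "j \<in> I u" for u j
  proof -
    have "j < n" using info_subset[OF that(1)] that(2) by auto
    then have "u \<in> \<sigma> j ` {..<\<kappa>}" using bij_betw_sigma[of j] that by (auto simp: bij_betw_def contains_def)
    then show ?thesis by auto
  qed
  \<comment> \<open>Every database in \<open>I u\<close> has some letter \<open>b\<close> with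
    \<open>\<sigma> j b = u\<close>, so all of them return coded versions of this same interference,
    and the code recovers it from them.\<close>
  have Z: "(\<Sum>s\<in>T. ssgn s T * ?m s (u, T - {s}, x, y) a) = 0"
    if u: "u < \<kappa> + \<delta>" and T: "T \<subseteq> {1..<r}" "Suc (length y) = card T" "Suc (length x + length y) = r"
      "set x \<subseteq> {..<\<kappa>}" "set y \<subseteq> {..<\<delta>}" and a: "a < k" for u T x y a
  proof (rule info_inj[OF u _ a, where x = "\<lambda>a. \<Sum>s\<in>T. ssgn s T * ?m s (u, T - {s}, x, y) a"])
    fix j assume j: "j \<in> I u"
    obtain b where b: "b < \<kappa>" "\<sigma> j b = u" using pre[OF u j] by auto
    have jn: "j < n" using info_subset[OF u] j by auto
    have T0: "0 \<notin> T" "T \<subseteq> {..<r}" using T(1) by auto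
    have "(T, b # x, y) \<in> answer_labels r \<kappa> \<delta>"
      using T T0 b by (auto simp: answer_labels_def)
    from row[OF jn this]
    have "(\<Sum>s\<in>T. ssgn s T * (\<Sum>a<k. ?m s (u, T - {s}, x, y) a * g a j)) = 0"
      using T0(1) b(2) by (simp add: row_of_def)
    then show "(\<Sum>a<k. (\<Sum>s\<in>T. ssgn s T * ?m s (u, T - {s}, x, y) a) * g a j) = 0"
      unfolding sum_distrib_right sum_distrib_left
      by (subst sum.swap) (simp add: mult.assoc)
  qed
  \<comment> \<open>In the answer for \<open>insert 0 S\<close>, the summand of index 0 is the
    desired symbol of a row assigned to \<open>I u\<close>. The other summands belong to an
    information set that avoids \<open>j\<close>, and their sum is interference treated by
    \<open>Z\<close>.\<close>
  have D: "?m 0 l a = 0" if l: "l \<in> row_labels r \<kappa> \<delta>" and a: "a < k" for l a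
  proof -
    obtain u S x y where l': "l = (u, S, x, y)" by (cases l)
    have u: "u < \<kappa> + \<delta>" and S: "S \<subseteq> {1..<r}" "length y = card S" "Suc (length x + card S) = r"
      "set x \<subseteq> {..<\<kappa>}" "set y \<subseteq> {..<\<delta>}" using l by (auto simp: l' row_labels_def)
    have S0: "0 \<notin> S" "S \<subseteq> {..<r}" "finite S" using S(1) finite_subset by auto
    show ?thesis unfolding l'
    proof (rule info_inj[OF u _ a, where x = "\<lambda>a. ?m 0 (u, S, x, y) a"])
      fix j assume j: "j \<in> I u"
      obtain b where b: "b < \<kappa>" "\<sigma> j b = u" using pre[OF u j] by auto
      have jn: "j < n" using info_subset[OF u] j by auto
      let ?T = "insert 0 S"
      let ?w = "(\<tau> j (hd y))"
      have T: "(?T, b # x, y) \<in> answer_labels r \<kappa> \<delta>"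
        using S S0 b by (auto simp: answer_labels_def)
      have s0: "(ssgn 0 ?T :: 'a) = 1" by (simp add: ssgn_def)
      have sS: "(ssgn s ?T :: 'a) = - ssgn s S" if "s \<in> S" for s
        using that S0 ssgn_insert[of S 0 s] by (metis gr_zeroI)
      have "0 = (\<Sum>s\<in>?T. ssgn s ?T * (\<Sum>a<k. ?m s (row_of (\<sigma> j) (\<tau> j) (?T - {s}, b # x, y)) a * g a j))"
        using row[OF jn T] by simp
      also have "\<dots> = (\<Sum>a<k. ?m 0 (u, S, x, y) a * g a j)
          + (\<Sum>s\<in>S. - ssgn s S * (\<Sum>a<k. ?m s (?w, S - {s}, b # x, tl y) a * g a j))"
      proof -
        have e: "row_of (\<sigma> j) (\<tau> j) (?T - {s}, b # x, y) = (?w, S - {s}, b # x, tl y)" if "s \<in> S" for s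
        proof -
          have "?T - {s} - {0} = S - {s}" "0 \<in> ?T - {s}" using S0 that gr_zeroI[of s] by auto
          then show ?thesis by (simp add: row_of_def)
        qed
        have "(\<Sum>s\<in>S. ssgn s ?T * (\<Sum>a<k. ?m s (row_of (\<sigma> j) (\<tau> j) (?T - {s}, b # x, y)) a * g a j))
          = (\<Sum>s\<in>S. - ssgn s S * (\<Sum>a<k. ?m s (?w, S - {s}, b # x, tl y) a * g a j))"
          by (rule sum.cong[OF refl]) (simp only: sS e)
        moreover have "?T - {0} = S" using S0 by auto
        ultimately show ?thesis using S0 b(2) by (simp add: s0 row_of_def)
      qed
      also have "(\<Sum>s\<in>S. - ssgn s S * (\<Sum>a<k. ?m s (?w, S - {s}, b # x, tl y) a * g a j))
          = - (\<Sum>a<k. (\<Sum>s\<in>S. ssgn s S * ?m s (?w, S - {s}, b # x, tl y) a) * g a j)"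
      proof -
        have "(\<Sum>a<k. (\<Sum>s\<in>S. ssgn s S * ?m s (?w, S - {s}, b # x, tl y) a) * g a j)
            = (\<Sum>s\<in>S. ssgn s S * (\<Sum>a<k. ?m s (?w, S - {s}, b # x, tl y) a * g a j))"
          unfolding sum_distrib_right by (subst sum.swap) (simp add: sum_distrib_left mult.assoc)
        then show ?thesis by (simp add: sum_negf)
      qed
      also have "(\<Sum>a<k. (\<Sum>s\<in>S. ssgn s S * ?m s (?w, S - {s}, b # x, tl y) a) * g a j) = 0"
      \<comment> \<open>For empty \<open>S\<close> the word \<open>y\<close> is empty and
        \<open>?w\<close> is meaningless, but then no interference is added either.\<close>
      proof (cases "S = {}")
        case False
        then obtain c y' where y: "y = c # y'" using S(2) S0 by (cases y) auto
        then have "c < \<delta>" using S by auto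
        then have "?w < \<kappa> + \<delta>" using bij_betw_tau[OF jn] y by (auto simp: bij_betw_def)
        then have "(\<Sum>s\<in>S. ssgn s S * ?m s (?w, S - {s}, b # x, tl y) a) = 0" if "a < k" for a
          using S b y that by (intro Z) auto
        then show ?thesis by simp
      qed simp
      finally show "(\<Sum>a<k. ?m 0 (u, S, x, y) a * g a j) = 0" by simp
    qed
  qed
  show ?thesis
  \<comment> \<open>All mixed desired symbols vanish, and the independent rows of \<open>M\<close>
    allow the mixing to be undone.\<close>
  proof (rule inj_coeffs_inj[OF M _ i, where c = "\<lambda>i. \<Sum>t<r. h t 0 * \<xi> t i a"])
    fix l assume "l \<in> row_labels r \<kappa> \<delta>"
    from D[OF this a] show "(\<Sum>i<\<beta>. (\<Sum>t<r. h t 0 * \<xi> t i a) * M i l) = 0"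
      unfolding mixed_def sum_distrib_left sum_distrib_right
      by (subst sum.swap) (simp add: mult_ac)
  qed
qed

end

section \<open>Cardinalities and bases\<close>

lemma sum_Pow_insert:
  fixes F :: "'b set \<Rightarrow> 'c::comm_monoid_add"
  assumes "finite A" "a \<notin> A"
  shows "(\<Sum>S\<in>Pow (insert a A). F S) = (\<Sum>S\<in>Pow A. F S) + (\<Sum>S\<in>Pow A. F (insert a S))"
proof -
  have "inj_on (insert a) (Pow A)" using assms(2) by (auto simp: inj_on_def)
  moreover have "Pow A \<inter> insert a ` Pow A = {}" using assms(2) by auto
  ultimately show ?thesis
    unfolding Pow_insert using assms(1)
    by (subst sum.union_disjoint) (auto simp: sum.reindex)
qed

text \<open>The binomial theorem in subset form: every element of \<open>A\<close> contributes a
  factor \<open>a\<close> or a factor \<open>b\<close>.\<close>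

lemma sum_Pow_power:
  fixes a b :: nat
  assumes "finite A"
  shows "(\<Sum>S\<in>Pow A. a ^ (card A - card S) * b ^ card S) = (a + b) ^ card A"
  using assms
proof (induction A)
  case (insert s A)
  have c: "card S \<le> card A" "card (Set.insert s S) = Suc (card S)" if "S \<in> Pow A" for S
  proof -
    have "finite S" using that insert.hyps finite_subset[of S A] by auto
    moreover have "s \<notin> S" using that insert.hyps by auto
    ultimately show "card (Set.insert s S) = Suc (card S)" by simp
    show "card S \<le> card A" using that insert.hyps by (auto intro: card_mono)
  qed
  let ?F = "\<lambda>A S. a ^ (card A - card S) * b ^ card S"
  have "(\<Sum>S\<in>Pow (Set.insert s A). ?F (Set.insert s A) S)
     = (\<Sum>S\<in>Pow A. ?F (Set.insert s A) S) + (\<Sum>S\<in>Pow A. ?F (Set.insert s A) (Set.insert s S))"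
    using insert.hyps by (subst sum_Pow_insert) auto
  also have "(\<Sum>S\<in>Pow A. ?F (Set.insert s A) S) = (\<Sum>S\<in>Pow A. a * ?F A S)"
    using insert.hyps c by (intro sum.cong) (auto simp: Suc_diff_le le_SucI)
  also have "(\<Sum>S\<in>Pow A. ?F (Set.insert s A) (Set.insert s S)) = (\<Sum>S\<in>Pow A. b * ?F A S)"
    using insert.hyps c by (intro sum.cong) (auto simp: Suc_diff_le le_SucI)
  finally have "(\<Sum>S\<in>Pow (Set.insert s A). ?F (Set.insert s A) S)
     = (\<Sum>S\<in>Pow A. a * ?F A S) + (\<Sum>S\<in>Pow A. b * ?F A S)" .
  then show ?case using insert by (simp add: sum_distrib_left[symmetric] algebra_simps)
qed simp

text \<open>For \<open>b > 0\<close> and \<open>m = card A\<close> this is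
  \<open>a * ((a + b) ^ m - a ^ m)\<close> divided by \<open>b\<close>. The geometric form stays
  valid for \<open>b = 0\<close>, the case in which every database lies in all information
  sets.\<close>

lemma sum_Pow_power_pred:
  fixes a b :: nat
  assumes "finite A"
  shows "(\<Sum>S\<in>Pow A. if S = {} then 0 else a ^ (Suc (card A) - card S) * b ^ (card S - 1))
    = a * (\<Sum>v<card A. (a + b) ^ (card A - 1 - v) * a ^ v)"
  using assms
proof (induction A)
  case (insert s A)
  let ?F = "\<lambda>A S. if S = {} then 0 else a ^ (Suc (card A) - card S) * b ^ (card S - 1)"
  have c: "card S \<le> card A" "card (Set.insert s S) = Suc (card S)" if "S \<in> Pow A" for S
  proof -
    have "finite S" using that insert.hyps finite_subset[of S A] by auto
    moreover have "s \<notin> S" using that insert.hyps by auto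
    ultimately show "card (Set.insert s S) = Suc (card S)" by simp
    show "card S \<le> card A" using that insert.hyps by (auto intro: card_mono)
  qed
  have "(\<Sum>S\<in>Pow (Set.insert s A). ?F (Set.insert s A) S)
     = (\<Sum>S\<in>Pow A. ?F (Set.insert s A) S) + (\<Sum>S\<in>Pow A. ?F (Set.insert s A) (Set.insert s S))"
    using insert.hyps by (subst sum_Pow_insert) auto
  also have "(\<Sum>S\<in>Pow A. ?F (Set.insert s A) S) = (\<Sum>S\<in>Pow A. a * ?F A S)"
    using insert.hyps c by (intro sum.cong) (auto simp: Suc_diff_le le_SucI)
  also have "\<dots> = a * (a * (\<Sum>v<card A. (a + b) ^ (card A - 1 - v) * a ^ v))"
    using insert.IH by (simp add: sum_distrib_left[symmetric])
  also have "(\<Sum>S\<in>Pow A. ?F (Set.insert s A) (Set.insert s S))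
      = (\<Sum>S\<in>Pow A. a * (a ^ (card A - card S) * b ^ card S))"
    using insert.hyps c by (intro sum.cong) (auto simp: Suc_diff_le le_SucI)
  also have "\<dots> = a * (a + b) ^ card A"
    using sum_Pow_power[OF insert.hyps(1), of a b] by (simp add: sum_distrib_left[symmetric])
  also have "a * (a * (\<Sum>v<card A. (a + b) ^ (card A - 1 - v) * a ^ v)) + a * (a + b) ^ card A
      = a * (\<Sum>v<Suc (card A). (a + b) ^ (card A - v) * a ^ v)"
  proof -
    have "(\<Sum>v<Suc (card A). (a + b) ^ (card A - v) * a ^ v)
        = (a + b) ^ card A + (\<Sum>v<card A. a * ((a + b) ^ (card A - 1 - v) * a ^ v))"
      by (subst sum.lessThan_Suc_shift) (simp add: mult_ac)
    then show ?thesis by (simp add: sum_distrib_left algebra_simps)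
  qed
  finally show ?case using insert.hyps by simp
qed simp

lemma card_words: "card {x. set x \<subseteq> {..<a::nat} \<and> length x = m} = a ^ m"
  by (subst card_lists_length_eq) auto

lemma finite_words: "finite {x. set x \<subseteq> {..<a::nat} \<and> length x = m}"
  by (rule finite_lists_length_eq) simp

lemma finite_row_labels: "finite (row_labels r \<kappa> \<delta>)"
  and card_row_labels: "0 < r \<Longrightarrow> card (row_labels r \<kappa> \<delta>) = (\<kappa> + \<delta>) ^ r"
proof -
  let ?X = "\<lambda>S. {x. set x \<subseteq> {..<\<kappa>} \<and> length x = r - 1 - card S} \<times> {y. set y \<subseteq> {..<\<delta>} \<and> length y = card S}"
  let ?B = "{..<\<kappa> + \<delta>} \<times> (SIGMA S:Pow {1..<r}. ?X S)"
  have c: "card S \<le> r - 1" if "S \<subseteq> {1..<r}" for S using card_mono[OF _ that] by simp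
  have fin: "finite ?B" by (auto intro!: finite_cartesian_product finite_words)
  have "row_labels r \<kappa> \<delta> \<subseteq> ?B" by (auto simp: row_labels_def)
  then show "finite (row_labels r \<kappa> \<delta>)" using fin finite_subset by blast
  assume r: "0 < r"
  have "Suc (length x + card S) = r \<longleftrightarrow> length x = r - 1 - card S" if "S \<subseteq> {1..<r}" for x :: "nat list" and S
    using c[OF that] r by auto
  then have eq: "row_labels r \<kappa> \<delta> = ?B" by (auto simp: row_labels_def)
  have "card ?B = (\<kappa> + \<delta>) * (\<Sum>S\<in>Pow {1..<r}. \<kappa> ^ (r - 1 - card S) * \<delta> ^ card S)"
    unfolding card_cartesian_product
    by (subst card_SigmaI) (auto simp: card_cartesian_product card_words finite_words)
  also have "\<dots> = (\<kappa> + \<delta>) * (\<kappa> + \<delta>) ^ (r - 1)"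
    using sum_Pow_power[of "{1..<r}" \<kappa> \<delta>] by simp
  finally show "card (row_labels r \<kappa> \<delta>) = (\<kappa> + \<delta>) ^ r"
    using r by (simp add: eq power_Suc[symmetric])
qed

lemma finite_answer_labels: "finite (answer_labels r \<kappa> \<delta>)"
  and card_answer_labels:
    "card (answer_labels r \<kappa> \<delta>) = \<kappa> * (\<Sum>v<r. (\<kappa> + \<delta>) ^ (r - 1 - v) * \<kappa> ^ v)"
proof -
  let ?X = "\<lambda>S. if S = {} then {} else
    {x. set x \<subseteq> {..<\<kappa>} \<and> length x = Suc r - card S} \<times> {y. set y \<subseteq> {..<\<delta>} \<and> length y = card S - 1}"
  have c: "card S \<le> r \<and> finite S" if "S \<subseteq> {..<r}" for S
    using card_mono[OF _ that] finite_subset[OF that] by simp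
  have iff: "Suc (length y) = card S \<and> length x + length y = r \<longleftrightarrow>
      S \<noteq> {} \<and> length x = Suc r - card S \<and> length y = card S - 1"
    if "S \<subseteq> {..<r}" for x y :: "nat list" and S
    using c[OF that] by (cases "card S") auto
  have "(S, x, y) \<in> answer_labels r \<kappa> \<delta> \<longleftrightarrow> (S, x, y) \<in> (SIGMA S:Pow {..<r}. ?X S)" for S x y
  proof (cases "S \<subseteq> {..<r}")
    case True
    then show ?thesis using iff[OF True, of y x] by (auto simp: answer_labels_def split: if_splits)
  qed (auto simp: answer_labels_def)
  then have eq: "answer_labels r \<kappa> \<delta> = (SIGMA S:Pow {..<r}. ?X S)" unfolding set_eq_iff split_paired_All by blast
  have fin: "finite (?X S)" for S by (simp add: finite_words)
  show "finite (answer_labels r \<kappa> \<delta>)" unfolding eq by (rule finite_SigmaI[OF finite_Pow_iff[THEN iffD2] fin]) simp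
  have "card (answer_labels r \<kappa> \<delta>) = (\<Sum>S\<in>Pow {..<r}. card (?X S))"
    unfolding eq by (rule card_SigmaI) (simp_all add: fin del: if_split_asm)
  also have "\<dots> = (\<Sum>S\<in>Pow {..<r}. if S = {} then 0 else \<kappa> ^ (Suc (card {..<r}) - card S) * \<delta> ^ (card S - 1))"
    by (intro sum.cong refl) (simp add: card_cartesian_product card_words)
  also have "\<dots> = \<kappa> * (\<Sum>v<r. (\<kappa> + \<delta>) ^ (r - 1 - v) * \<kappa> ^ v)"
    by (subst sum_Pow_power_pred) auto
  finally show "card (answer_labels r \<kappa> \<delta>) = \<kappa> * (\<Sum>v<r. (\<kappa> + \<delta>) ^ (r - 1 - v) * \<kappa> ^ v)" .
qed

text \<open>The columns of \<open>h\<close> are \<open>c\<close> and all unit vectors except that of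
  a pivot \<open>i\<close> with \<open>c i \<noteq> 0\<close>; the transposition \<open>p\<close> of
  0 and \<open>i\<close> assigns them to indices. \<open>h'\<close> results from elimination at the
  pivot. With \<open>c\<close> in column 0, index 0 of the new basis carries the function with
  coordinates \<open>c\<close>.\<close>

lemma completion_to_basis:
  fixes c :: "nat \<Rightarrow> 'a::field"
  assumes "\<exists>t<r. c t \<noteq> 0"
  obtains h h' :: "nat \<Rightarrow> nat \<Rightarrow> 'a" where
    "\<forall>s<r. \<forall>t. h' s t \<noteq> 0 \<longrightarrow> t < r" "\<forall>s<r. \<forall>t. (\<Sum>u<r. h' s u * h u t) = bvec s t" "\<forall>t. h t 0 = c t"
proof -
  obtain i where i: "i < r" "c i \<noteq> 0" using assms by auto
  define p where "p = (\<lambda>s. if s = 0 then i else if s = i then 0 else s)"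
  have pp: "p (p s) = s" and pr: "p s < r \<longleftrightarrow> s < r" and pi: "p s = i \<longleftrightarrow> s = 0" for s
    using i by (auto simp: p_def)
  define h where "h = (\<lambda>t s. if s = 0 then c t else bvec (p s) t)"
  define d where "d = (\<lambda>s. \<Sum>u\<in>{..<r} - {i}. bvec s (p u) * c u)"
  define h' where "h' = (\<lambda>s u. if u < r then if u = i then (bvec s 0 - d s) / c i else bvec s (p u) else 0)"
  have "(\<Sum>u<r. h' s u * h u t) = bvec s t" if s: "s < r" for s t
  proof (cases "t = 0")
    case True
    have "(\<Sum>u<r. h' s u * h u t) = h' s i * c i + (\<Sum>u\<in>{..<r} - {i}. h' s u * c u)"
      using i by (subst sum.remove[of _ i]) (auto simp: h_def True)
    also have "(\<Sum>u\<in>{..<r} - {i}. h' s u * c u) = d s"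
      unfolding d_def by (intro sum.cong) (auto simp: h'_def)
    finally show ?thesis using i by (simp add: h'_def True)
  next
    case False
    have "(\<Sum>u<r. h' s u * h u t) = (\<Sum>u<r. if u = p t then h' s (p t) else 0)"
      using False by (intro sum.cong) (auto simp: h_def bvec_def)
    also have "\<dots> = bvec s t"
      using False s pr pi by (auto simp: h'_def pp bvec_def)
    finally show ?thesis .
  qed
  then show thesis by (intro that[of h' h]) (auto simp: h'_def h_def)
qed

section \<open>Independent rows\<close>

lemma one_less_card_field: "1 < CARD('a::{field,finite})"
proof -
  have "card {0, 1 :: 'a} \<le> CARD('a)" by (rule card_mono) auto
  then show ?thesis by simp
qed

text \<open>Linear independence, expressed as solvability for every right-hand side. In this form it
  yields dual vectors and shows that candidate values are uniform.\<close>

definition indep_rows :: "(nat \<Rightarrow> nat \<Rightarrow> 'a::field) \<Rightarrow> nat \<Rightarrow> nat set \<Rightarrow> bool" where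
  "indep_rows \<rho> f T \<longleftrightarrow> (\<forall>c. \<exists>x. \<forall>v\<in>T. (\<Sum>m<f. \<rho> v m * x m) = c v)"

lemma indep_rows_subset:
  assumes "indep_rows \<rho> f T" "T' \<subseteq> T"
  shows "indep_rows \<rho> f T'"
  unfolding indep_rows_def
proof
  fix c
  obtain x where "\<forall>v\<in>T. (\<Sum>m<f. \<rho> v m * x m) = c v"
    using assms(1)[unfolded indep_rows_def, rule_format, of c] by (elim exE)
  then show "\<exists>x. \<forall>v\<in>T'. (\<Sum>m<f. \<rho> v m * x m) = c v"
    using assms(2) by (intro exI[of _ x]) auto
qed

lemma indep_rows_dual:
  assumes "indep_rows \<rho> f T"
  obtains x where "\<And>t v. t \<in> T \<Longrightarrow> v \<in> T \<Longrightarrow> (\<Sum>m<f. \<rho> v m * x t m) = (if v = t then 1 else 0)"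
proof -
  have "\<exists>x. \<forall>v\<in>T. (\<Sum>m<f. \<rho> v m * x m) = (if v = t then 1 else 0)" for t
    using assms[unfolded indep_rows_def, rule_format, of "\<lambda>v. if v = t then 1 else 0"] .
  then have "\<exists>x. \<forall>t. \<forall>v\<in>T. (\<Sum>m<f. \<rho> v m * x t m) = (if v = t then 1 else 0)"
    by (intro choice) simp
  then show thesis using that by fast
qed

text \<open>The coefficient \<open>u t\<close> pairs row \<open>v\<close> with the dual vector of
  \<open>t\<close>. If the combination failed in coordinate \<open>m\<close>, the unit vector of
  \<open>m\<close> minus its part seen by \<open>T\<close> would be annihilated by the rows of
  \<open>T\<close> but not by row \<open>v\<close>; adding a multiple of it would solve every system
  on \<open>insert v T\<close>.\<close>

lemma indep_rows_extend:
  assumes T: "indep_rows \<rho> f T" "finite T" and v: "v \<notin> T" "\<not> indep_rows \<rho> f (insert v T)"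
  shows "\<exists>u. \<forall>m<f. \<rho> v m = (\<Sum>t\<in>T. u t * \<rho> t m)"
proof -
  obtain x where x: "\<And>t s. t \<in> T \<Longrightarrow> s \<in> T \<Longrightarrow> (\<Sum>m<f. \<rho> s m * x t m) = (if s = t then 1 else 0)"
    using indep_rows_dual[OF T(1)] by blast
  define u where "u = (\<lambda>t. \<Sum>m<f. \<rho> v m * x t m)"
  have "\<rho> v m = (\<Sum>t\<in>T. u t * \<rho> t m)" if m: "m < f" for m
  proof (rule ccontr)
    assume ne: "\<rho> v m \<noteq> (\<Sum>t\<in>T. u t * \<rho> t m)"
    define e where "e = \<rho> v m - (\<Sum>t\<in>T. u t * \<rho> t m)"
    define w where "w = (\<lambda>m'. (if m' = m then 1 else 0) - (\<Sum>t\<in>T. \<rho> t m * x t m'))"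
    have lin: "(\<Sum>m'<f. \<rho> s m' * w m') = \<rho> s m - (\<Sum>t\<in>T. \<rho> t m * (\<Sum>m'<f. \<rho> s m' * x t m'))" for s
    proof -
      have "(\<Sum>m'<f. \<rho> s m' * w m') = (\<Sum>m'<f. if m' = m then \<rho> s m else 0)
          - (\<Sum>m'<f. \<Sum>t\<in>T. \<rho> t m * (\<rho> s m' * x t m'))"
        unfolding w_def sum_subtractf[symmetric]
        by (intro sum.cong refl) (simp add: algebra_simps sum_distrib_left)
      also have "(\<Sum>m'<f. \<Sum>t\<in>T. \<rho> t m * (\<rho> s m' * x t m')) = (\<Sum>t\<in>T. \<rho> t m * (\<Sum>m'<f. \<rho> s m' * x t m'))"
        by (subst sum.swap) (simp add: sum_distrib_left)
      finally show ?thesis using m by simp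
    qed
    have ws: "(\<Sum>m'<f. \<rho> s m' * w m') = 0" if s: "s \<in> T" for s
    proof -
      have "(\<Sum>t\<in>T. \<rho> t m * (\<Sum>m'<f. \<rho> s m' * x t m')) = (\<Sum>t\<in>T. if t = s then \<rho> s m else 0)"
        by (intro sum.cong refl) (use x s in auto)
      then show ?thesis unfolding lin using s T(2) by simp
    qed
    have wv: "(\<Sum>m'<f. \<rho> v m' * w m') = e"
      unfolding lin e_def u_def by (simp add: mult.commute)
    have "indep_rows \<rho> f (insert v T)"
      unfolding indep_rows_def
    proof
      fix c
      obtain y where y: "\<And>s. s \<in> T \<Longrightarrow> (\<Sum>m<f. \<rho> s m * y m) = c s"
        using T(1)[unfolded indep_rows_def, rule_format, of c] by (elim exE) blast
      define a where "a = (c v - (\<Sum>m<f. \<rho> v m * y m)) / e"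
      have z: "(\<Sum>m<f. \<rho> s m * (y m + a * w m)) = (\<Sum>m<f. \<rho> s m * y m) + a * (\<Sum>m<f. \<rho> s m * w m)" for s
        by (simp add: sum.distrib sum_distrib_left algebra_simps)
      have "e \<noteq> 0" using ne by (simp add: e_def)
      then have "\<forall>s\<in>insert v T. (\<Sum>m<f. \<rho> s m * (y m + a * w m)) = c s"
        unfolding z using y ws wv by (auto simp: a_def)
      then show "\<exists>x. \<forall>s\<in>insert v T. (\<Sum>m<f. \<rho> s m * x m) = c s"
        by (intro exI[of _ "\<lambda>m. y m + a * w m"])
    qed
    then show False using v by simp
  qed
  then show ?thesis by blast
qed

lemma maximal_indep_rows:
  obtains T where "T \<subseteq> {..<\<mu>}" "indep_rows \<rho> f T"
    "\<And>v. v < \<mu> \<Longrightarrow> \<exists>u. \<forall>m<f. \<rho> v m = (\<Sum>t\<in>T. u t * \<rho> t m)"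
proof -
  define P where "P = (\<lambda>T. T \<subseteq> {..<\<mu>} \<and> indep_rows \<rho> f T)"
  have "P {}" by (simp add: P_def indep_rows_def)
  moreover have "\<forall>T. P T \<longrightarrow> card T < Suc \<mu>"
    unfolding P_def using card_mono[of "{..<\<mu>}"] by (force simp: less_Suc_eq_le)
  ultimately have "\<exists>T. P T \<and> (\<forall>T'. P T' \<longrightarrow> card T' \<le> card T)"
    by (rule ex_has_greatest_nat)
  then obtain T where T: "P T" "\<And>T'. P T' \<Longrightarrow> card T' \<le> card T" by blast
  have fin: "finite T" using T(1) finite_subset by (auto simp: P_def)
  have "\<exists>u. \<forall>m<f. \<rho> v m = (\<Sum>t\<in>T. u t * \<rho> t m)" if v: "v < \<mu>" for v
  proof (cases "v \<in> T")
    case True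
    have "\<rho> v m = (\<Sum>t\<in>T. (if t = v then 1 else 0) * \<rho> t m)" for m
      using True fin by (simp add: if_distrib[where f = "\<lambda>a. a * _"] sum.delta cong: if_cong)
    then show ?thesis by (intro exI[of _ "\<lambda>t. if t = v then 1 else 0"]) simp
  next
    case False
    have "\<not> indep_rows \<rho> f (insert v T)"
    proof
      assume "indep_rows \<rho> f (insert v T)"
      then have "P (insert v T)" using T(1) v by (auto simp: P_def)
      then show False using T(2)[of "insert v T"] False fin by simp
    qed
    then show ?thesis using indep_rows_extend[of \<rho> f T v] T(1) fin False by (auto simp: P_def)
  qed
  then show thesis using that T(1) by (auto simp: P_def)
qed

text \<open>A maximal independent set of columns spans the range, and different coefficients give
  different combinations. This turns the rank into a count that can be compared with rows.\<close>

lemma card_range_rank: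
  fixes V :: "'a::{field,finite} mat"
  assumes V: "V \<in> carrier_mat \<mu> f"
  shows "card ((*\<^sub>v) V ` carrier_vec f) = CARD('a) ^ vec_space.rank \<mu> V"
proof -
  interpret vec_space "TYPE('a)" \<mu> .
  let ?C = "set (cols V)"
  have C: "?C \<subseteq> carrier_vec \<mu>" using V cols_dim by blast
  obtain S where S: "maximal S (\<lambda>T. T \<subseteq> ?C \<and> lin_indpt T)"
    using maximal_exists_superset[of ?C "\<lambda>T. T \<subseteq> ?C \<and> lin_indpt T" "{}"]
    by (metis List.finite_set empty_subsetI finite_lin_indpt2 finite.emptyI empty_iff)
  have rank: "rank V = card S" by (rule rank_card_indpt[OF V S])
  have SC: "S \<subseteq> ?C" "lin_indpt S" using S by (auto simp: maximal_def)
  have Sc: "S \<subseteq> carrier_vec \<mu>" and fin: "finite S" using SC C finite_subset by auto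
  have "?C \<subseteq> span S"
  proof
    fix c assume c: "c \<in> ?C"
    show "c \<in> span S"
    proof (cases "c \<in> S")
      case True
      then show ?thesis using span_mem[of S] Sc by auto
    next
      case False
      have "\<not> lin_indpt (S \<union> {c})"
      proof
        assume "lin_indpt (S \<union> {c})"
        then have "S \<union> {c} = S" using S SC c unfolding maximal_def by blast
        then show False using False by blast
      qed
      then show ?thesis using lin_dep_iff_in_span[of S c] Sc SC(2) c C False by auto
    qed
  qed
  then have span_eq: "span ?C = span S"
    using span_subsetI[OF Sc] span_is_monotone[OF SC(1)] by blast
  have "(*\<^sub>v) V ` carrier_vec f = span_list (cols V)"
  proof -
    have "\<forall>w\<in>?C. dim_vec w = \<mu>" using C by auto
    then have lc: "lincomb_list c (cols V) = V *\<^sub>v vec f c" for c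
      using lincomb_list_as_mat_mult[of "cols V" c] V mat_of_cols_cols[of V] by simp
    have "(*\<^sub>v) V ` carrier_vec f \<subseteq> span_list (cols V)"
    proof
      fix y assume "y \<in> (*\<^sub>v) V ` carrier_vec f"
      then obtain x where x: "x \<in> carrier_vec f" "y = V *\<^sub>v x" by auto
      have "vec f (\<lambda>i. x $ i) = x" using x by auto
      then have "y = lincomb_list (\<lambda>i. x $ i) (cols V)" using x(2) by (simp add: lc)
      then show "y \<in> span_list (cols V)"
        unfolding span_list_def by (auto simp: class_ring_simps)
    qed
    moreover have "span_list (cols V) \<subseteq> (*\<^sub>v) V ` carrier_vec f"
      unfolding span_list_def by (auto simp: lc)
    ultimately show ?thesis by blast
  qed
  also have "\<dots> = span S" using span_list_as_span[OF C] span_eq by simp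
  also have "\<dots> = (\<lambda>a. lincomb a S) ` (S \<rightarrow>\<^sub>E UNIV)"
  proof -
    have sp: "span S = {lincomb a S | a. a \<in> S \<rightarrow> UNIV}"
      using finite_span[OF fin] Sc by (simp add: class_ring_simps)
    have res: "lincomb a S = lincomb (restrict a S) S" for a
      by (rule eq_vecI) (use Sc in \<open>auto simp: lincomb_index lincomb_dim[OF fin Sc]\<close>)
    have "lincomb a S \<in> (\<lambda>a. lincomb a S) ` (S \<rightarrow>\<^sub>E UNIV)" for a
      by (rule image_eqI[where x = "restrict a S"], rule res) simp
    then show ?thesis unfolding sp by blast
  qed
  also have "card \<dots> = card (S \<rightarrow>\<^sub>E (UNIV :: 'a set))"
  proof (rule card_image, rule inj_onI, rule ccontr)
    fix a b :: "'a vec \<Rightarrow> 'a" assume ab: "a \<in> S \<rightarrow>\<^sub>E UNIV" "b \<in> S \<rightarrow>\<^sub>E UNIV" "lincomb a S = lincomb b S" "a \<noteq> b"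
    then obtain s where s: "s \<in> S" "a s \<noteq> b s" using PiE_ext[OF ab(1,2)] by blast
    have "lincomb (\<lambda>v. a v - b v) S = 0\<^sub>v \<mu>"
    proof (rule eq_vecI)
      fix i assume "i < dim_vec (0\<^sub>v \<mu> :: 'a vec)"
      then have i: "i < \<mu>" by simp
      have "lincomb (\<lambda>v. a v - b v) S $ i = lincomb a S $ i - lincomb b S $ i"
        unfolding lincomb_index[OF i Sc] by (simp add: algebra_simps sum_subtractf)
      then show "lincomb (\<lambda>v. a v - b v) S $ i = 0\<^sub>v \<mu> $ i" using ab(3) i by simp
    qed (simp add: lincomb_dim[OF fin Sc])
    then have "lin_dep S"
      by (intro lin_dep_crit[OF fin subset_refl _ s(1), of "\<lambda>v. a v - b v"])
        (use s in \<open>auto simp: class_ring_simps\<close>)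
    then show False using SC(2) by simp
  qed
  also have "\<dots> = CARD('a) ^ rank V" using fin by (simp add: card_PiE rank)
  finally show ?thesis .
qed

text \<open>Row rank equals column rank by counting: a vector of the range is determined by its
  coordinates in a maximal independent set \<open>T\<close> of rows, and these coordinates are
  arbitrary.\<close>

lemma rank_rows:
  fixes V :: "'a::{field,finite} mat"
  assumes V: "V \<in> carrier_mat \<mu> f"
  obtains T where "T \<subseteq> {..<\<mu>}" "card T = vec_space.rank \<mu> V" "indep_rows (\<lambda>v m. V $$ (v, m)) f T"
    "\<And>v. v < \<mu> \<Longrightarrow> \<exists>u. \<forall>m<f. V $$ (v, m) = (\<Sum>t\<in>T. u t * V $$ (t, m))"
proof -
  obtain T where T: "T \<subseteq> {..<\<mu>}" "indep_rows (\<lambda>v m. V $$ (v, m)) f T"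
    "\<And>v. v < \<mu> \<Longrightarrow> \<exists>u. \<forall>m<f. V $$ (v, m) = (\<Sum>t\<in>T. u t * V $$ (t, m))"
    using maximal_indep_rows[of \<mu> "\<lambda>v m. V $$ (v, m)" f] by blast
  have fin: "finite T" using T(1) finite_subset by blast
  let ?W = "(*\<^sub>v) V ` carrier_vec f"
  have idx: "(V *\<^sub>v x) $ v = (\<Sum>m<f. V $$ (v, m) * x $ m)" if "v < \<mu>" "x \<in> carrier_vec f" for x v
    using that V by (simp add: scalar_prod_def lessThan_atLeast0)
  have "inj_on (\<lambda>y. \<lambda>t\<in>T. y $ t) ?W"
  proof (rule inj_onI)
    fix y y' assume yy: "y \<in> ?W" "y' \<in> ?W" and eq: "(\<lambda>t\<in>T. y $ t) = (\<lambda>t\<in>T. y' $ t)"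
    have rec: "z $ v = (\<Sum>t\<in>T. u t * z $ t)"
      if z: "z \<in> ?W" and v: "v < \<mu>" and u: "\<forall>m<f. V $$ (v, m) = (\<Sum>t\<in>T. u t * V $$ (t, m))" for z v u
    proof -
      obtain x where x: "x \<in> carrier_vec f" "z = V *\<^sub>v x" using z by (elim imageE)
      have "z $ v = (\<Sum>m<f. (\<Sum>t\<in>T. u t * V $$ (t, m)) * x $ m)"
        unfolding x(2) idx[OF v x(1)] using u by simp
      also have "\<dots> = (\<Sum>t\<in>T. u t * (\<Sum>m<f. V $$ (t, m) * x $ m))"
        unfolding sum_distrib_right sum_distrib_left by (subst sum.swap) (simp add: mult.assoc)
      also have "\<dots> = (\<Sum>t\<in>T. u t * z $ t)"
        unfolding x(2) by (intro sum.cong refl) (use idx x(1) T(1) in auto)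
      finally show ?thesis .
    qed
    have dim: "dim_vec z = \<mu>" if z: "z \<in> ?W" for z
    proof -
      obtain x where "z = V *\<^sub>v x" using z by (elim imageE)
      then show ?thesis using V by simp
    qed
    show "y = y'"
    proof (rule eq_vecI)
      fix v assume "v < dim_vec y'"
      then have v: "v < \<mu>" using dim[OF yy(2)] by simp
      obtain u where u: "\<forall>m<f. V $$ (v, m) = (\<Sum>t\<in>T. u t * V $$ (t, m))" using T(3)[OF v] by blast
      have "y $ t = y' $ t" if "t \<in> T" for t using fun_cong[OF eq, of t] that by simp
      then show "y $ v = y' $ v" using rec[OF yy(1) v u] rec[OF yy(2) v u] by simp
    qed (simp add: dim[OF yy(1)] dim[OF yy(2)])
  qed
  moreover have "(\<lambda>y. \<lambda>t\<in>T. y $ t) ` ?W = T \<rightarrow>\<^sub>E UNIV"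
  proof
    show "T \<rightarrow>\<^sub>E UNIV \<subseteq> (\<lambda>y. \<lambda>t\<in>T. y $ t) ` ?W"
    proof
      fix c :: "nat \<Rightarrow> 'a" assume c: "c \<in> T \<rightarrow>\<^sub>E UNIV"
      obtain x where x: "\<forall>v\<in>T. (\<Sum>m<f. V $$ (v, m) * x m) = c v"
        using T(2)[unfolded indep_rows_def, rule_format, of c] by (elim exE)
      have "(V *\<^sub>v vec f x) $ t = c t" if "t \<in> T" for t
        using x that T(1) by (subst idx) auto
      then have "c = (\<lambda>t\<in>T. (V *\<^sub>v vec f x) $ t)"
        by (intro ext) (simp add: restrict_def PiE_arb[OF c])
      then show "c \<in> (\<lambda>y. \<lambda>t\<in>T. y $ t) ` ?W" by (rule image_eqI) simp
    qed
  qed auto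
  ultimately have "card ?W = card (T \<rightarrow>\<^sub>E (UNIV :: 'a set))" using card_image by metis
  then have "CARD('a) ^ vec_space.rank \<mu> V = CARD('a) ^ card T"
    using card_range_rank[OF V] fin by (simp add: card_PiE)
  moreover have "1 < CARD('a)" by (rule one_less_card_field)
  ultimately have "card T = vec_space.rank \<mu> V" by (simp add: power_inject_exp)
  then show thesis using that T by blast
qed

section \<open>Entropy of functions on a finite uniform space\<close>

text \<open>Shannon entropy of \<open>Y\<close> under the uniform distribution on \<Omega>, as the
  mean of the logarithm of the inverse fibre probability. Only the partition into fibres enters, so
  \<open>Y\<close> may have any type of values.\<close>

definition fent :: "real \<Rightarrow> 'a set \<Rightarrow> ('a \<Rightarrow> 'b) \<Rightarrow> real" where
  "fent b \<Omega> Y = (\<Sum>\<omega>\<in>\<Omega>. log b (real (card \<Omega>) / real (card {\<omega>' \<in> \<Omega>. Y \<omega>' = Y \<omega>}))) / real (card \<Omega>)"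

lemma card_fiber_pos: "finite \<Omega> \<Longrightarrow> \<omega> \<in> \<Omega> \<Longrightarrow> 0 < card {\<omega>' \<in> \<Omega>. Y \<omega>' = Y \<omega>}"
  by (auto simp: card_gt_0_iff)

lemma fent_cong:
  assumes "\<And>\<omega> \<omega>'. \<omega> \<in> \<Omega> \<Longrightarrow> \<omega>' \<in> \<Omega> \<Longrightarrow> Y \<omega>' = Y \<omega> \<longleftrightarrow> Y' \<omega>' = Y' \<omega>"
  shows "fent b \<Omega> Y = fent b \<Omega> Y'"
proof -
  have "{\<omega>' \<in> \<Omega>. Y \<omega>' = Y \<omega>} = {\<omega>' \<in> \<Omega>. Y' \<omega>' = Y' \<omega>}" if "\<omega> \<in> \<Omega>" for \<omega>
    using assms[OF that] by blast
  then show ?thesis by (simp add: fent_def cong: sum.cong)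
qed

lemma fent_mono:
  assumes fin: "finite \<Omega>" and b: "1 < b"
    and det: "\<And>\<omega> \<omega>'. \<omega> \<in> \<Omega> \<Longrightarrow> \<omega>' \<in> \<Omega> \<Longrightarrow> Y \<omega>' = Y \<omega> \<Longrightarrow> Y' \<omega>' = Y' \<omega>"
  shows "fent b \<Omega> Y' \<le> fent b \<Omega> Y"
  unfolding fent_def
proof (intro divide_right_mono sum_mono)
  fix \<omega> assume w: "\<omega> \<in> \<Omega>"
  have pos: "0 < card {\<omega>' \<in> \<Omega>. Y \<omega>' = Y \<omega>}" "0 < card {\<omega>' \<in> \<Omega>. Y' \<omega>' = Y' \<omega>}" "0 < card \<Omega>"
    using card_fiber_pos[OF fin w] fin w by (auto simp: card_gt_0_iff)
  have "card {\<omega>' \<in> \<Omega>. Y \<omega>' = Y \<omega>} \<le> card {\<omega>' \<in> \<Omega>. Y' \<omega>' = Y' \<omega>}"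
    using fin det[OF w] by (intro card_mono) auto
  then show "log b (real (card \<Omega>) / real (card {\<omega>' \<in> \<Omega>. Y' \<omega>' = Y' \<omega>}))
      \<le> log b (real (card \<Omega>) / real (card {\<omega>' \<in> \<Omega>. Y \<omega>' = Y \<omega>}))"
    using pos b by (simp add: divide_left_mono)
qed simp

lemma fent_const: "finite \<Omega> \<Longrightarrow> fent b \<Omega> (\<lambda>_. c) = 0"
  by (cases "\<Omega> = {}") (auto simp: fent_def)

lemma restrict_eq_iff: "(\<lambda>j\<in>K. f j) = (\<lambda>j\<in>K. g j) \<longleftrightarrow> (\<forall>j\<in>K. f j = g j)"
  by (metis restrict_apply' restrict_ext)

lemma fent_nonneg: "finite \<Omega> \<Longrightarrow> 1 < b \<Longrightarrow> 0 \<le> fent b \<Omega> Y"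
  using fent_mono[of \<Omega> b Y "\<lambda>_. ()"] by (simp add: fent_const)

lemma fent_le:
  assumes fin: "finite \<Omega>" and b: "1 < b"
    and ne: "\<Omega> \<noteq> {}"
  shows "fent b \<Omega> Y \<le> log b (real (card \<Omega>))"
proof -
  from ne have "0 < card \<Omega>" using fin by (simp add: card_gt_0_iff)
  have "fent b \<Omega> Y \<le> fent b \<Omega> (\<lambda>\<omega>. \<omega>)" by (rule fent_mono[OF fin b]) simp
  also have "\<dots> = log b (real (card \<Omega>))"
  proof -
    have "{\<omega>' \<in> \<Omega>. \<omega>' = \<omega>} = {\<omega>}" if "\<omega> \<in> \<Omega>" for \<omega> using that by auto
    then show ?thesis using \<open>0 < card \<Omega>\<close> by (simp add: fent_def cong: sum.cong)
  qed
  finally show ?thesis .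
qed

lemma fent_bij:
  assumes "bij_betw \<phi> \<Omega> \<Omega>'"
  shows "fent b \<Omega> (\<lambda>\<omega>. Y (\<phi> \<omega>)) = fent b \<Omega>' Y"
proof -
  have c: "card \<Omega> = card \<Omega>'" using assms by (rule bij_betw_same_card)
  have "card {\<omega>' \<in> \<Omega>. Y (\<phi> \<omega>') = y} = card {\<omega>' \<in> \<Omega>'. Y \<omega>' = y}" for y
  proof -
    have img: "\<phi> ` {\<omega>' \<in> \<Omega>. Y (\<phi> \<omega>') = y} = {\<omega>' \<in> \<Omega>'. Y \<omega>' = y}"
      using bij_betw_imp_surj_on[OF assms] by auto
    have "inj_on \<phi> {\<omega>' \<in> \<Omega>. Y (\<phi> \<omega>') = y}"
      using bij_betw_imp_inj_on[OF assms] by (rule inj_on_subset) auto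
    from card_image[OF this] show ?thesis unfolding img by (rule sym)
  qed
  then show ?thesis
    unfolding fent_def c
    using sum.reindex_bij_betw[OF assms, of "\<lambda>\<omega>. log b (real (card \<Omega>') / real (card {\<omega>' \<in> \<Omega>'. Y \<omega>' = Y \<omega>}))"]
    by simp
qed

lemma sum_by_fibers:
  fixes g :: "'b \<Rightarrow> real"
  assumes "finite \<Omega>"
  shows "(\<Sum>\<omega>\<in>\<Omega>. g (W \<omega>)) = (\<Sum>w\<in>W ` \<Omega>. real (card {\<omega> \<in> \<Omega>. W \<omega> = w}) * g w)"
proof -
  have "(\<Sum>\<omega>\<in>\<Omega>. g (W \<omega>)) = (\<Sum>w\<in>W ` \<Omega>. \<Sum>\<omega>\<in>{\<omega> \<in> \<Omega>. W \<omega> = w}. g (W \<omega>))"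
    by (rule sum.image_gen[OF assms])
  also have "\<dots> = (\<Sum>w\<in>W ` \<Omega>. real (card {\<omega> \<in> \<Omega>. W \<omega> = w}) * g w)"
    by (intro sum.cong refl) simp
  finally show ?thesis .
qed

lemma sum_card_fibers:
  assumes "finite \<Omega>"
  shows "(\<Sum>w\<in>W ` \<Omega>. real (card {\<omega> \<in> \<Omega>. W \<omega> = w})) = real (card \<Omega>)"
  using sum_by_fibers[OF assms, of "\<lambda>_. 1" W] by simp

text \<open>Conditional mutual information is nonnegative, by \<open>ln x \<le> x - 1\<close>. The
  ratio \<open>g w / NW w\<close> compares the law that makes \<open>Y\<close> and \<open>Y'\<close>
  independent given \<open>Z\<close> with the true one; its mean is at most 1 because
  \<open>g\<close>, summed over all triples and not only those that occur, gives
  \<open>card \<Omega>\<close>.\<close>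

lemma fent_submodular:
  assumes fin: "finite \<Omega>" and b: "1 < b"
  shows "fent b \<Omega> (\<lambda>\<omega>. (Y \<omega>, Y' \<omega>, Z \<omega>)) + fent b \<Omega> Z
    \<le> fent b \<Omega> (\<lambda>\<omega>. (Y \<omega>, Z \<omega>)) + fent b \<Omega> (\<lambda>\<omega>. (Y' \<omega>, Z \<omega>))"
proof -
  define W where "W = (\<lambda>\<omega>. (Y \<omega>, Y' \<omega>, Z \<omega>))"
  define N where "N = (\<lambda>y z. real (card {\<omega> \<in> \<Omega>. Y \<omega> = y \<and> Z \<omega> = z}))"
  define N' where "N' = (\<lambda>y z. real (card {\<omega> \<in> \<Omega>. Y' \<omega> = y \<and> Z \<omega> = z}))"
  define NW where "NW = (\<lambda>w. real (card {\<omega> \<in> \<Omega>. W \<omega> = w}))"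
  define NZ where "NZ = (\<lambda>z. real (card {\<omega> \<in> \<Omega>. Z \<omega> = z}))"
  define g where "g = (\<lambda>(y, y', z). N y z * N' y' z / NZ z)"
  define c where "c = real (card \<Omega>)"
  have pos: "0 < N (Y \<omega>) (Z \<omega>)" "0 < N' (Y' \<omega>) (Z \<omega>)" "0 < NW (W \<omega>)" "0 < NZ (Z \<omega>)" "0 < c"
    if "\<omega> \<in> \<Omega>" for \<omega>
    using that fin unfolding N_def N'_def NW_def NZ_def c_def by (auto simp: card_gt_0_iff)
  have split_Y: "(\<Sum>y\<in>Y ` \<Omega>. N y z) = NZ z" for z
  proof -
    have "{\<omega> \<in> \<Omega>. Z \<omega> = z} = (\<Union>y\<in>Y ` \<Omega>. {\<omega> \<in> \<Omega>. Y \<omega> = y \<and> Z \<omega> = z})" by auto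
    moreover have "card (\<Union>y\<in>Y ` \<Omega>. {\<omega> \<in> \<Omega>. Y \<omega> = y \<and> Z \<omega> = z})
        = (\<Sum>y\<in>Y ` \<Omega>. card {\<omega> \<in> \<Omega>. Y \<omega> = y \<and> Z \<omega> = z})"
      using fin by (intro card_UN_disjoint) auto
    ultimately show ?thesis by (simp add: N_def NZ_def)
  qed
  have split_Y': "(\<Sum>y\<in>Y' ` \<Omega>. N' y z) = NZ z" for z
  proof -
    have "{\<omega> \<in> \<Omega>. Z \<omega> = z} = (\<Union>y\<in>Y' ` \<Omega>. {\<omega> \<in> \<Omega>. Y' \<omega> = y \<and> Z \<omega> = z})" by auto
    moreover have "card (\<Union>y\<in>Y' ` \<Omega>. {\<omega> \<in> \<Omega>. Y' \<omega> = y \<and> Z \<omega> = z})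
        = (\<Sum>y\<in>Y' ` \<Omega>. card {\<omega> \<in> \<Omega>. Y' \<omega> = y \<and> Z \<omega> = z})"
      using fin by (intro card_UN_disjoint) auto
    ultimately show ?thesis by (simp add: N'_def NZ_def)
  qed
  have gnn: "0 \<le> g w" for w by (auto simp: g_def N_def N'_def NZ_def split: prod.split)
  have "(\<Sum>\<omega>\<in>\<Omega>. g (W \<omega>) / NW (W \<omega>)) = (\<Sum>w\<in>W ` \<Omega>. NW w * (g w / NW w))"
    unfolding NW_def by (rule sum_by_fibers[OF fin, of "\<lambda>w. g w / real (card {\<omega> \<in> \<Omega>. W \<omega> = w})"])
  also have "\<dots> = (\<Sum>w\<in>W ` \<Omega>. g w)"
    using pos(3) by (intro sum.cong refl) (auto simp: less_imp_neq[symmetric])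
  also have "\<dots> \<le> (\<Sum>w\<in>Y ` \<Omega> \<times> Y' ` \<Omega> \<times> Z ` \<Omega>. g w)"
    using fin gnn by (intro sum_mono2) (auto simp: W_def)
  also have "\<dots> = (\<Sum>y\<in>Y ` \<Omega>. \<Sum>y'\<in>Y' ` \<Omega>. \<Sum>z\<in>Z ` \<Omega>. N y z * N' y' z / NZ z)"
    by (simp add: sum.cartesian_product[symmetric] g_def)
  also have "\<dots> = (\<Sum>z\<in>Z ` \<Omega>. \<Sum>y\<in>Y ` \<Omega>. \<Sum>y'\<in>Y' ` \<Omega>. N y z * N' y' z / NZ z)"
    by (subst sum.swap[of _ _ "Z ` \<Omega>"], rule sum.cong[OF refl], subst sum.swap[of _ _ "Z ` \<Omega>"], rule refl)
  also have "\<dots> = (\<Sum>z\<in>Z ` \<Omega>. (\<Sum>y\<in>Y ` \<Omega>. N y z) * (\<Sum>y'\<in>Y' ` \<Omega>. N' y' z) / NZ z)"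
    by (simp add: sum_product sum_divide_distrib)
  also have "\<dots> = (\<Sum>z\<in>Z ` \<Omega>. NZ z)"
    unfolding split_Y split_Y' by (intro sum.cong refl) simp
  also have "\<dots> = c"
    unfolding NZ_def c_def by (rule sum_card_fibers[OF fin])
  finally have ratio: "(\<Sum>\<omega>\<in>\<Omega>. g (W \<omega>) / NW (W \<omega>)) \<le> c" .
  have pt: "log b (c / NW (W \<omega>)) + log b (c / NZ (Z \<omega>))
      - log b (c / N (Y \<omega>) (Z \<omega>)) - log b (c / N' (Y' \<omega>) (Z \<omega>)) \<le> (g (W \<omega>) / NW (W \<omega>) - 1) / ln b"
    if w: "\<omega> \<in> \<Omega>" for \<omega>
  proof -
    have "log b (c / NW (W \<omega>)) + log b (c / NZ (Z \<omega>))
      - log b (c / N (Y \<omega>) (Z \<omega>)) - log b (c / N' (Y' \<omega>) (Z \<omega>)) = log b (g (W \<omega>) / NW (W \<omega>))"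
      using pos[OF w] b by (simp add: log_divide log_mult g_def W_def)
    also have "\<dots> \<le> (g (W \<omega>) / NW (W \<omega>) - 1) / ln b"
      unfolding log_def using pos[OF w] b
      by (intro divide_right_mono ln_le_minus_one) (auto simp: g_def W_def)
    finally show ?thesis .
  qed
  have "(\<Sum>\<omega>\<in>\<Omega>. log b (c / NW (W \<omega>)) + log b (c / NZ (Z \<omega>))
      - log b (c / N (Y \<omega>) (Z \<omega>)) - log b (c / N' (Y' \<omega>) (Z \<omega>)))
     \<le> (\<Sum>\<omega>\<in>\<Omega>. (g (W \<omega>) / NW (W \<omega>) - 1) / ln b)"
    by (rule sum_mono) (rule pt)
  also have "\<dots> = ((\<Sum>\<omega>\<in>\<Omega>. g (W \<omega>) / NW (W \<omega>)) - c) / ln b"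
    by (simp add: sum_divide_distrib[symmetric] sum_subtractf c_def)
  also have "\<dots> \<le> 0" using ratio b by (simp add: divide_nonpos_pos)
  finally have "(\<Sum>\<omega>\<in>\<Omega>. log b (c / NW (W \<omega>)) + log b (c / NZ (Z \<omega>))
      - log b (c / N (Y \<omega>) (Z \<omega>)) - log b (c / N' (Y' \<omega>) (Z \<omega>))) / c \<le> 0"
    by (simp add: c_def divide_nonpos_nonneg)
  moreover have "fent b \<Omega> W = (\<Sum>\<omega>\<in>\<Omega>. log b (c / NW (W \<omega>))) / c"
    "fent b \<Omega> Z = (\<Sum>\<omega>\<in>\<Omega>. log b (c / NZ (Z \<omega>))) / c"
    "fent b \<Omega> (\<lambda>\<omega>. (Y \<omega>, Z \<omega>)) = (\<Sum>\<omega>\<in>\<Omega>. log b (c / N (Y \<omega>) (Z \<omega>))) / c"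
    "fent b \<Omega> (\<lambda>\<omega>. (Y' \<omega>, Z \<omega>)) = (\<Sum>\<omega>\<in>\<Omega>. log b (c / N' (Y' \<omega>) (Z \<omega>))) / c"
    by (simp_all add: fent_def NW_def NZ_def N_def N'_def c_def)
  ultimately show ?thesis
    unfolding W_def by (simp add: sum.distrib sum_subtractf diff_divide_distrib add_divide_distrib)
qed

lemma fent_subadditive:
  assumes fin: "finite \<Omega>" and b: "1 < b" and J: "finite J"
  shows "fent b \<Omega> (\<lambda>\<omega>. (\<lambda>j\<in>J. A j \<omega>, Z \<omega>)) - fent b \<Omega> Z
    \<le> (\<Sum>j\<in>J. fent b \<Omega> (\<lambda>\<omega>. (A j \<omega>, Z \<omega>)) - fent b \<Omega> Z)"
  using J
proof (induction J)
  case empty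
  have "fent b \<Omega> (\<lambda>\<omega>. (\<lambda>j\<in>{}. A j \<omega>, Z \<omega>)) = fent b \<Omega> Z" by (rule fent_cong) (simp add: restrict_eq_iff)
  then show ?case by (simp only: sum.empty diff_self order_refl)
next
  case (insert j J)
  have "fent b \<Omega> (\<lambda>\<omega>. (\<lambda>j\<in>insert j J. A j \<omega>, Z \<omega>)) = fent b \<Omega> (\<lambda>\<omega>. (A j \<omega>, (\<lambda>j\<in>J. A j \<omega>), Z \<omega>))"
    by (rule fent_cong) (auto simp: restrict_eq_iff)
  note eq = this
  note sub = fent_submodular[OF fin b, of "A j" "\<lambda>\<omega>. \<lambda>j\<in>J. A j \<omega>" Z]
  show ?case
    unfolding sum.insert[OF insert.hyps] eq using sub insert.IH by linarith
qed

lemma card_PiE_const: "finite J \<Longrightarrow> card (PiE J (\<lambda>_. \<Omega>)) = card \<Omega> ^ card J"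
  by (simp add: card_PiE)

lemma sum_PiE_component:
  fixes g :: "'b \<Rightarrow> real"
  assumes fin: "finite \<Omega>" and J: "finite J" "j \<in> J"
  shows "(\<Sum>\<omega>\<in>PiE J (\<lambda>_. \<Omega>). g (\<omega> j)) = real (card \<Omega> ^ (card J - 1)) * (\<Sum>x\<in>\<Omega>. g x)"
proof -
  have finP: "finite (PiE J (\<lambda>_. \<Omega>))" using fin J by (intro finite_PiE) auto
  have c: "card {\<omega> \<in> PiE J (\<lambda>_. \<Omega>). \<omega> j = x} = card \<Omega> ^ (card J - 1)" if x: "x \<in> \<Omega>" for x
  proof -
    have "{\<omega> \<in> PiE J (\<lambda>_. \<Omega>). \<omega> j = x} = PiE J (\<lambda>i. if i = j then {x} else \<Omega>)"
      using J x by (auto simp: PiE_iff extensional_def split: if_splits)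
    then have "card {\<omega> \<in> PiE J (\<lambda>_. \<Omega>). \<omega> j = x} = (\<Prod>i\<in>J. if i = j then 1 else card \<Omega>)"
      using J by (simp add: card_PiE if_distrib cong: if_cong prod.cong)
    also have "\<dots> = (\<Prod>i\<in>J - {j}. card \<Omega>)"
      using J by (subst prod.remove[of _ j]) auto
    finally show ?thesis using J by simp
  qed
  have "(\<Sum>\<omega>\<in>PiE J (\<lambda>_. \<Omega>). g (\<omega> j)) = (\<Sum>x\<in>\<Omega>. \<Sum>\<omega>\<in>{\<omega> \<in> PiE J (\<lambda>_. \<Omega>). \<omega> j = x}. g (\<omega> j))"
    using J by (intro sum.group[symmetric] finP fin) auto
  also have "\<dots> = (\<Sum>x\<in>\<Omega>. real (card \<Omega> ^ (card J - 1)) * g x)"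
    by (intro sum.cong refl) (simp add: c)
  finally show ?thesis by (simp add: sum_distrib_left)
qed

text \<open>The fibres of a product map are products of fibres, so probabilities multiply and their
  logarithms add.\<close>

lemma fent_product:
  assumes fin: "finite \<Omega>" and ne: "\<Omega> \<noteq> {}" and J: "finite J"
  shows "fent b (PiE J (\<lambda>_. \<Omega>)) (\<lambda>\<omega>. \<lambda>j\<in>J. Y j (\<omega> j)) = (\<Sum>j\<in>J. fent b \<Omega> (Y j))"
proof -
  let ?P = "PiE J (\<lambda>_. \<Omega>)"
  let ?g = "\<lambda>j x. log b (real (card \<Omega>) / real (card {x' \<in> \<Omega>. Y j x' = Y j x}))"
  have c0: "0 < card \<Omega>" using fin ne by (simp add: card_gt_0_iff)
  have pt: "log b (real (card ?P) / real (card {\<omega>' \<in> ?P. (\<lambda>j\<in>J. Y j (\<omega>' j)) = (\<lambda>j\<in>J. Y j (\<omega> j))}))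
      = (\<Sum>j\<in>J. ?g j (\<omega> j))" if w: "\<omega> \<in> ?P" for \<omega>
  proof -
    have wj: "\<omega> j \<in> \<Omega>" if "j \<in> J" for j using w that by auto
    have "{\<omega>' \<in> ?P. (\<lambda>j\<in>J. Y j (\<omega>' j)) = (\<lambda>j\<in>J. Y j (\<omega> j))} = PiE J (\<lambda>j. {x \<in> \<Omega>. Y j x = Y j (\<omega> j)})"
      unfolding restrict_eq_iff by (auto simp: PiE_iff extensional_def)
    then have "real (card ?P) / real (card {\<omega>' \<in> ?P. (\<lambda>j\<in>J. Y j (\<omega>' j)) = (\<lambda>j\<in>J. Y j (\<omega> j))})
        = (\<Prod>j\<in>J. real (card \<Omega>) / real (card {x \<in> \<Omega>. Y j x = Y j (\<omega> j)}))"
      using J by (simp add: card_PiE prod_dividef)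
    moreover have "ln (\<Prod>j\<in>J. real (card \<Omega>) / real (card {x \<in> \<Omega>. Y j x = Y j (\<omega> j)}))
        = (\<Sum>j\<in>J. ln (real (card \<Omega>) / real (card {x \<in> \<Omega>. Y j x = Y j (\<omega> j)})))"
      by (rule ln_prod) (use card_fiber_pos[OF fin wj] c0 J in auto)
    ultimately show ?thesis
      unfolding log_def by (simp only: sum_divide_distrib)
  qed
  have "fent b ?P (\<lambda>\<omega>. \<lambda>j\<in>J. Y j (\<omega> j)) = (\<Sum>\<omega>\<in>?P. \<Sum>j\<in>J. ?g j (\<omega> j)) / real (card ?P)"
    unfolding fent_def by (rule arg_cong[where f = "\<lambda>s. s / _"], rule sum.cong[OF refl], rule pt)
  also have "(\<Sum>\<omega>\<in>?P. \<Sum>j\<in>J. ?g j (\<omega> j)) = (\<Sum>j\<in>J. real (card \<Omega> ^ (card J - 1)) * (\<Sum>x\<in>\<Omega>. ?g j x))"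
    by (subst sum.swap) (intro sum.cong refl sum_PiE_component fin J)
  also have "\<dots> / real (card ?P) = (\<Sum>j\<in>J. (\<Sum>x\<in>\<Omega>. ?g j x) / real (card \<Omega>))"
    unfolding sum_divide_distrib[of _ J]
  proof (rule sum.cong[OF refl])
    fix j assume "j \<in> J"
    then have "card J = Suc (card J - 1)" using J by (metis Suc_pred card_gt_0_iff empty_iff diff_Suc_1)
    then have "real (card ?P) = real (card \<Omega> ^ (card J - 1)) * real (card \<Omega>)"
      unfolding card_PiE_const[OF J] by (metis mult.commute of_nat_mult power_Suc)
    then show "real (card \<Omega> ^ (card J - 1)) * (\<Sum>x\<in>\<Omega>. ?g j x) / real (card ?P)
        = (\<Sum>x\<in>\<Omega>. ?g j x) / real (card \<Omega>)"
      using c0 by simp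
  qed
  finally show ?thesis unfolding fent_def .
qed

lemma fent_equal_fibers:
  assumes fin: "finite \<Omega>" and ne: "\<Omega> \<noteq> {}"
    and fib: "\<And>\<omega>. \<omega> \<in> \<Omega> \<Longrightarrow> card {\<omega>' \<in> \<Omega>. Y \<omega>' = Y \<omega>} = N"
  shows "fent b \<Omega> Y = log b (real (card (Y ` \<Omega>)))"
proof -
  have c0: "0 < card \<Omega>" using fin ne by (simp add: card_gt_0_iff)
  obtain \<omega> where "\<omega> \<in> \<Omega>" using ne by auto
  then have N: "0 < N" using card_fiber_pos[OF fin, of \<omega> Y] fib by simp
  have "real (card \<Omega>) = (\<Sum>w\<in>Y ` \<Omega>. real (card {\<omega> \<in> \<Omega>. Y \<omega> = w}))"
    by (rule sum_card_fibers[OF fin, symmetric])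
  also have "\<dots> = (\<Sum>w\<in>Y ` \<Omega>. real N)" by (rule sum.cong) (auto simp: fib)
  finally have "real (card \<Omega>) / real N = real (card (Y ` \<Omega>))" using N by simp
  then show ?thesis using c0 by (simp add: fent_def fib cong: sum.cong)
qed

section \<open>Entropy of discrete random variables\<close>

lemma information_space_pmf: "1 < b \<Longrightarrow> information_space (measure_pmf p) b"
  by (simp add: information_space_def information_space_axioms_def prob_space_measure_pmf)

lemma distributed_pmf:
  assumes B: "countable B" and X: "\<And>\<omega>. X \<omega> \<in> B"
  shows "distributed (measure_pmf p) (count_space B) X (\<lambda>x. ennreal (pmf (map_pmf X p) x))"
  unfolding distributed_def
proof (intro conjI)
  have meas: "X \<in> measurable (measure_pmf p) (count_space B)" using X by auto
  then show "X \<in> measurable (measure_pmf p) (count_space B)" .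
  show "distr (measure_pmf p) (count_space B) X = density (count_space B) (\<lambda>x. ennreal (pmf (map_pmf X p) x))"
  proof (rule measure_eqI_countable[OF _ _ B])
    fix a assume a: "a \<in> B"
    have "emeasure (distr (measure_pmf p) (count_space B) X) {a} = emeasure (measure_pmf p) (X -` {a})"
      using a meas by (subst emeasure_distr) auto
    also have "\<dots> = ennreal (pmf (map_pmf X p) a)"
      by (simp add: pmf_map measure_pmf.emeasure_eq_measure)
    also have "\<dots> = (\<integral>\<^sup>+x. ennreal (pmf (map_pmf X p) x) * indicator {a} x \<partial>count_space B)"
      using a by (subst nn_integral_count_space'[where A = "{a}"]) auto
    also have "\<dots> = emeasure (density (count_space B) (\<lambda>x. ennreal (pmf (map_pmf X p) x))) {a}"
      using a by (subst emeasure_density) auto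
    finally show "emeasure (distr (measure_pmf p) (count_space B) X) {a}
      = emeasure (density (count_space B) (\<lambda>x. ennreal (pmf (map_pmf X p) x))) {a}" .
  qed auto
qed auto

lemma entropy_pmf:
  fixes X :: "'a \<Rightarrow> 'b::countable"
  assumes b: "1 < b"
  shows "prob_space.entropy (measure_pmf p) b (count_space UNIV) X
    = (\<integral>x. - pmf (map_pmf X p) x * log b (pmf (map_pmf X p) x) \<partial>count_space UNIV)"
proof -
  interpret information_space "measure_pmf p" b by (rule information_space_pmf[OF b])
  show ?thesis
    using entropy_distr[OF distributed_pmf[of UNIV X p]] by simp
qed

text \<open>The tangent at \<open>y\<close> to the concave function \<open>- x * log b x\<close>. It
  serves for the comparison with a uniform law and for Jensen's inequality.\<close>

lemma entropy_term_le:
  fixes x y :: real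
  assumes b: "1 < b" and x: "0 \<le> x" and y: "0 < y"
  shows "- x * log b x \<le> - x * log b y + (y - x) / ln b"
proof (cases "x = 0")
  case False
  then have "0 < x" using x by simp
  have "x * (log b y - log b x) = x * (ln (y / x) / ln b)"
    using \<open>0 < x\<close> y by (simp add: log_def ln_div diff_divide_distrib)
  also have "\<dots> \<le> x * ((y / x - 1) / ln b)"
    using \<open>0 < x\<close> y b by (intro mult_left_mono divide_right_mono ln_le_minus_one) auto
  also have "\<dots> = (y - x) / ln b" using \<open>0 < x\<close> by (simp add: right_diff_distrib)
  finally show ?thesis by (simp add: algebra_simps)
qed (use b y in simp)

lemma entropy_term_nonneg: "1 < b \<Longrightarrow> 0 \<le> x \<Longrightarrow> x \<le> 1 \<Longrightarrow> 0 \<le> - x * log b x"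
  by (cases "x = 0") (auto simp: mult_nonneg_nonpos)

lemma
  fixes X :: "'a \<Rightarrow> 'b::countable"
  assumes b: "1 < b" and S: "finite S" "\<And>\<omega>. X \<omega> \<in> S"
  shows entropy_le_card_range:
      "prob_space.entropy (measure_pmf p) b (count_space UNIV) X \<le> log b (real (card S))"
    and finite_entropy_finite_range:
      "information_space.finite_entropy (measure_pmf p) b (count_space UNIV) X (pmf (map_pmf X p))"
    and entropy_finite_range:
      "prob_space.entropy (measure_pmf p) b (count_space UNIV) X
        = (\<Sum>x\<in>S. - pmf (map_pmf X p) x * log b (pmf (map_pmf X p) x))"
proof -
  interpret information_space "measure_pmf p" b by (rule information_space_pmf[OF b])
  let ?f = "pmf (map_pmf X p)"
  have out: "?f x = 0" if "x \<notin> S" for x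
    using that S(2) by (intro pmf_map_outside) auto
  have fin: "finite {x. - ?f x * log b (?f x) \<noteq> 0}"
    by (rule finite_subset[OF _ S(1)]) (use out in force)
  have "(\<integral>x. - ?f x * log b (?f x) \<partial>count_space UNIV) = (\<Sum>x | - ?f x * log b (?f x) \<noteq> 0. - ?f x * log b (?f x))"
    using lebesgue_integral_count_space_finite_support[of UNIV "\<lambda>x. - ?f x * log b (?f x)"] fin by simp
  also have "\<dots> = (\<Sum>x\<in>S. - ?f x * log b (?f x))"
    by (rule sum.mono_neutral_left[OF S(1)]) (use out in force)+
  finally have sum_eq: "(\<integral>x. - ?f x * log b (?f x) \<partial>count_space UNIV) = (\<Sum>x\<in>S. - ?f x * log b (?f x))" .
  show ent: "prob_space.entropy (measure_pmf p) b (count_space UNIV) X = (\<Sum>x\<in>S. - ?f x * log b (?f x))"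
    using entropy_pmf[where X = X and p = p, OF b] sum_eq by simp
  have total: "(\<Sum>x\<in>S. ?f x) = 1"
    by (rule sum_pmf_eq_1[OF S(1)]) (use S(2) in auto)
  have "S \<noteq> {}" using S(2) by auto
  then have c: "0 < card S" using S(1) by (simp add: card_gt_0_iff)
  have "(\<Sum>x\<in>S. - ?f x * log b (?f x)) \<le> (\<Sum>x\<in>S. - ?f x * log b (1 / card S) + (1 / card S - ?f x) / ln b)"
    by (intro sum_mono entropy_term_le b) (use c in auto)
  also have "\<dots> = - (\<Sum>x\<in>S. ?f x) * log b (1 / card S) + (card S * (1 / card S) - (\<Sum>x\<in>S. ?f x)) / ln b"
    by (simp add: sum.distrib sum_distrib_right sum_negf sum_divide_distrib[symmetric] sum_subtractf)
  also have "\<dots> = log b (card S)" using c by (simp add: total log_divide)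
  finally show "prob_space.entropy (measure_pmf p) b (count_space UNIV) X \<le> log b (real (card S))" unfolding ent .
  have "integrable (count_space UNIV) (\<lambda>x. ?f x * log b (?f x))"
  proof -
    have "(\<integral>\<^sup>+x. ennreal (norm (?f x * log b (?f x))) \<partial>count_space UNIV)
        = (\<Sum>x\<in>S. ennreal (norm (?f x * log b (?f x))))"
      by (rule nn_integral_count_space'[OF S(1)]) (simp_all add: out)
    also have "\<dots> < \<infinity>" by simp
    finally show ?thesis by (intro integrableI_bounded) simp_all
  qed
  then show "finite_entropy (count_space UNIV) X ?f"
    unfolding finite_entropy_def using distributed_pmf[of UNIV X p] by auto
qed

lemma pmf_map_pmf_of_set:
  assumes "finite \<Omega>" "\<Omega> \<noteq> {}"
  shows "pmf (map_pmf Y (pmf_of_set \<Omega>)) y = real (card {\<omega> \<in> \<Omega>. Y \<omega> = y}) / real (card \<Omega>)"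
  using assms by (simp add: pmf_map measure_pmf_of_set vimage_def Int_def conj_commute)

lemma fent_eq_sum:
  assumes fin: "finite \<Omega>" and ne: "\<Omega> \<noteq> {}" and S: "finite S" "Y ` \<Omega> \<subseteq> S"
  shows "fent b \<Omega> Y = (\<Sum>y\<in>S. - pmf (map_pmf Y (pmf_of_set \<Omega>)) y * log b (pmf (map_pmf Y (pmf_of_set \<Omega>)) y))"
proof -
  have c: "0 < card \<Omega>" using fin ne by (simp add: card_gt_0_iff)
  define N where "N = (\<lambda>y. real (card {\<omega> \<in> \<Omega>. Y \<omega> = y}))"
  have N_eq: "real (card {\<omega> \<in> \<Omega>. Y \<omega> = y}) = N y" for y by (simp add: N_def)
  have "(\<Sum>y\<in>S. - pmf (map_pmf Y (pmf_of_set \<Omega>)) y * log b (pmf (map_pmf Y (pmf_of_set \<Omega>)) y))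
      = (\<Sum>y\<in>Y ` \<Omega>. - pmf (map_pmf Y (pmf_of_set \<Omega>)) y * log b (pmf (map_pmf Y (pmf_of_set \<Omega>)) y))"
    using S fin ne by (intro sum.mono_neutral_right) (auto simp: pmf_map_outside)
  also have "\<dots> = (\<Sum>y\<in>Y ` \<Omega>. N y * log b (card \<Omega> / N y)) / card \<Omega>"
    unfolding sum_divide_distrib
  proof (rule sum.cong[OF refl])
    fix y assume "y \<in> Y ` \<Omega>"
    then have "0 < N y" unfolding N_def using fin by (auto simp: card_gt_0_iff)
    then show "- pmf (map_pmf Y (pmf_of_set \<Omega>)) y * log b (pmf (map_pmf Y (pmf_of_set \<Omega>)) y)
        = N y * log b (card \<Omega> / N y) / card \<Omega>"
      using c by (simp add: pmf_map_pmf_of_set[OF fin ne] N_eq log_divide field_simps)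
  qed
  also have "(\<Sum>y\<in>Y ` \<Omega>. N y * log b (card \<Omega> / N y)) = (\<Sum>\<omega>\<in>\<Omega>. log b (card \<Omega> / N (Y \<omega>)))"
    unfolding N_def by (rule sum_by_fibers[OF fin, of "\<lambda>y. log b (card \<Omega> / real (card {\<omega> \<in> \<Omega>. Y \<omega> = y}))", symmetric])
  finally show ?thesis by (simp add: fent_def N_def)
qed

lemma entropy_pmf_of_set:
  fixes Y :: "'a \<Rightarrow> 'b::countable"
  assumes b: "1 < b" and fin: "finite \<Omega>" and ne: "\<Omega> \<noteq> {}" and S: "finite S" "\<And>\<omega>. Y \<omega> \<in> S"
  shows "prob_space.entropy (measure_pmf (pmf_of_set \<Omega>)) b (count_space UNIV) Y = fent b \<Omega> Y"
proof -
  have "Y ` \<Omega> \<subseteq> S" using S(2) by blast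
  from fent_eq_sum[OF fin ne S(1) this, of b] show ?thesis
    unfolding entropy_finite_range[where X = Y, OF b S] by (rule sym)
qed

text \<open>Conditioning on the query does not increase entropy: Jensen's inequality for each answer
  value, then summation. There may be infinitely many values, so sum and expectation are exchanged
  for nonnegative extended reals, and \<open>int\<close> leads back to a real integral.\<close>

lemma expectation_fent_le:
  fixes F :: "'s \<Rightarrow> 'a \<Rightarrow> nat"
  assumes b: "1 < b" and fin: "finite \<Omega>" and ne: "\<Omega> \<noteq> {}"
    and p: "p = bind_pmf Q (\<lambda>s. map_pmf (F s) (pmf_of_set \<Omega>))"
    and int: "integrable (count_space UNIV) (\<lambda>x. pmf p x * log b (pmf p x))"
  shows "measure_pmf.expectation Q (\<lambda>s. fent b \<Omega> (F s)) \<le> (\<integral>x. - pmf p x * log b (pmf p x) \<partial>count_space UNIV)"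
proof -
  let ?\<eta> = "\<lambda>x. - x * log b x"
  let ?P = "\<lambda>s. map_pmf (F s) (pmf_of_set \<Omega>)"
  have eta: "0 \<le> ?\<eta> (pmf P a)" for P :: "nat pmf" and a
    by (rule entropy_term_nonneg[OF b]) (auto simp: pmf_le_1)
  have fent: "ennreal (fent b \<Omega> (F s)) = (\<Sum>a. ennreal (?\<eta> (pmf (?P s) a)))" for s
  proof -
    have "ennreal (fent b \<Omega> (F s)) = (\<Sum>a\<in>F s ` \<Omega>. ennreal (?\<eta> (pmf (?P s) a)))"
      using eta by (subst fent_eq_sum[OF fin ne finite_imageI[OF fin] subset_refl]) (simp add: sum_ennreal)
    also have "\<dots> = (\<Sum>a. ennreal (?\<eta> (pmf (?P s) a)))"
      by (rule suminf_finite[symmetric]) (use fin ne in \<open>auto simp: pmf_map_outside\<close>)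
    finally show ?thesis .
  qed
  have jensen: "(\<integral>\<^sup>+s. ennreal (?\<eta> (pmf (?P s) a)) \<partial>measure_pmf Q) \<le> ennreal (?\<eta> (pmf p a))" for a
  proof -
    have pa: "pmf p a = measure_pmf.expectation Q (\<lambda>s. pmf (?P s) a)" unfolding p by (rule pmf_bind)
    have int1: "integrable (measure_pmf Q) (\<lambda>s. pmf (?P s) a)"
      by (rule measure_pmf.integrable_const_bound[where B = 1]) (auto simp: pmf_le_1)
    show ?thesis
    proof (cases "pmf p a = 0")
      \<comment> \<open>There is no tangent at 0, but a value of probability 0 is also impossible
        under almost every query.\<close>
      case True
      have "AE s in measure_pmf Q. pmf (?P s) a = 0"
        using integral_nonneg_eq_0_iff_AE[OF int1] True pa by simp
      then have "(\<integral>\<^sup>+s. ennreal (?\<eta> (pmf (?P s) a)) \<partial>measure_pmf Q) = (\<integral>\<^sup>+s. 0 \<partial>measure_pmf Q)"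
        by (intro nn_integral_cong_AE) auto
      then show ?thesis by simp
    next
      case False
      then have pos: "0 < pmf p a" by (simp add: pmf_pos)
      let ?u = "\<lambda>s. - pmf (?P s) a * log b (pmf p a) + (pmf p a - pmf (?P s) a) / ln b"
      have le: "?\<eta> (pmf (?P s) a) \<le> ?u s" for s by (rule entropy_term_le[OF b _ pos]) simp
      have intu: "integrable (measure_pmf Q) ?u" using int1 by auto
      have "(\<integral>\<^sup>+s. ennreal (?\<eta> (pmf (?P s) a)) \<partial>measure_pmf Q) \<le> (\<integral>\<^sup>+s. ennreal (?u s) \<partial>measure_pmf Q)"
        by (intro nn_integral_mono ennreal_leI le)
      also have "\<dots> = ennreal (measure_pmf.expectation Q ?u)"
        by (rule nn_integral_eq_integral[OF intu]) (use le eta order_trans in blast)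
      also have "measure_pmf.expectation Q ?u = ?\<eta> (pmf p a)"
        using int1 by (simp add: pa)
      finally show ?thesis .
    qed
  qed
  have bound: "fent b \<Omega> (F s) \<le> log b (card \<Omega>)" "0 \<le> fent b \<Omega> (F s)" for s
    by (rule fent_le[OF fin b ne], rule fent_nonneg[OF fin b])
  have intf: "integrable (measure_pmf Q) (\<lambda>s. fent b \<Omega> (F s))"
    by (rule measure_pmf.integrable_const_bound[where B = "log b (card \<Omega>)"]) (use bound in auto)
  have "ennreal (measure_pmf.expectation Q (\<lambda>s. fent b \<Omega> (F s))) = (\<integral>\<^sup>+s. ennreal (fent b \<Omega> (F s)) \<partial>measure_pmf Q)"
    by (rule nn_integral_eq_integral[symmetric, OF intf]) (use bound in auto)
  also have "\<dots> = (\<Sum>a. \<integral>\<^sup>+s. ennreal (?\<eta> (pmf (?P s) a)) \<partial>measure_pmf Q)"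
    unfolding fent by (rule nn_integral_suminf) simp
  also have "\<dots> \<le> (\<Sum>a. ennreal (?\<eta> (pmf p a)))"
    by (rule suminf_le, rule jensen) auto
  also have "\<dots> = (\<integral>\<^sup>+a. ennreal (?\<eta> (pmf p a)) \<partial>count_space UNIV)"
    by (rule nn_integral_count_space_nat[symmetric])
  also have "\<dots> = ennreal (\<integral>a. ?\<eta> (pmf p a) \<partial>count_space UNIV)"
    by (rule nn_integral_eq_integral) (use int eta in auto)
  finally have "ennreal (measure_pmf.expectation Q (\<lambda>s. fent b \<Omega> (F s)))
      \<le> ennreal (\<integral>a. ?\<eta> (pmf p a) \<partial>count_space UNIV)" .
  moreover have "0 \<le> (\<integral>a. ?\<eta> (pmf p a) \<partial>count_space UNIV)"
    by (intro integral_nonneg_AE AE_I2 eta)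
  ultimately show ?thesis using ennreal_le_iff by blast
qed

lemma conditional_entropy_pmf:
  fixes X :: "'a \<Rightarrow> 'b" and Y :: "'a \<Rightarrow> 'c::countable"
  assumes b: "1 < b" and A: "finite A" "\<And>\<omega>. X \<omega> \<in> A"
  shows "prob_space.conditional_entropy (measure_pmf p) b (count_space A) (count_space UNIV) X Y
    = - (\<integral>(x, y). pmf (map_pmf (\<lambda>\<omega>. (X \<omega>, Y \<omega>)) p) (x, y)
          * log b (pmf (map_pmf (\<lambda>\<omega>. (X \<omega>, Y \<omega>)) p) (x, y) / pmf (map_pmf Y p) y) \<partial>count_space (A \<times> UNIV))"
proof -
  interpret information_space "measure_pmf p" b by (rule information_space_pmf[OF b])
  have cA: "countable A" using A(1) by (rule countable_finite)
  have prod: "count_space A \<Otimes>\<^sub>M count_space (UNIV :: 'c set) = count_space (A \<times> UNIV)"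
    by (rule pair_measure_countable[OF cA]) auto
  have "distributed (measure_pmf p) (count_space A \<Otimes>\<^sub>M count_space (UNIV :: 'c set)) (\<lambda>\<omega>. (X \<omega>, Y \<omega>))
      (\<lambda>x. ennreal (pmf (map_pmf (\<lambda>\<omega>. (X \<omega>, Y \<omega>)) p) x))"
    unfolding prod by (rule distributed_pmf) (use cA A(2) in auto)
  from conditional_entropy_generic_eq[OF sigma_finite_measure_count_space_countable[OF cA]
      sigma_finite_measure_count_space_countable[OF _] distributed_pmf[of UNIV Y p] _ this]
  show ?thesis unfolding prod by auto
qed

text \<open>The integrand is nonnegative, so the integral vanishes only if the integrand does.
  Integrability has to come first, since the integral of a nonintegrable function defaults to 0 and
  recovery would then say nothing.\<close>

lemma conditional_entropy_eq_0_iff_determined: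
  fixes X :: "'a \<Rightarrow> 'b" and Y :: "'a \<Rightarrow> 'c::countable"
  assumes b: "1 < b" and A: "finite A" "\<And>\<omega>. X \<omega> \<in> A"
  shows "prob_space.conditional_entropy (measure_pmf p) b (count_space A) (count_space UNIV) X Y = 0
    \<longleftrightarrow> (\<forall>\<omega>\<in>set_pmf p. \<forall>\<omega>'\<in>set_pmf p. Y \<omega> = Y \<omega>' \<longrightarrow> X \<omega> = X \<omega>')"
proof -
  define Pxy where "Pxy = (\<lambda>x y. measure (measure_pmf p) {\<omega>. X \<omega> = x \<and> Y \<omega> = y})"
  define Py where "Py = (\<lambda>y. measure (measure_pmf p) {\<omega>. Y \<omega> = y})"
  have cA: "countable A" using A(1) by (rule countable_finite)
  have prod: "count_space A \<Otimes>\<^sub>M count_space (UNIV :: 'c set) = count_space (A \<times> UNIV)"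
    by (rule pair_measure_countable[OF cA]) auto
  define I where "I = (\<lambda>(x, y). Pxy x y * log b (Py y / Pxy x y))"
  have le: "Pxy x y \<le> Py y" for x y
    unfolding Pxy_def Py_def by (intro measure_pmf.finite_measure_mono) auto
  have nn: "0 \<le> Pxy x y" "0 \<le> Py y" for x y unfolding Pxy_def Py_def by auto
  have I_nonneg: "0 \<le> I z" for z
  proof (cases z)
    case (Pair x y)
    show ?thesis
    proof (cases "Pxy x y = 0")
      case False
      then have "0 < Pxy x y" using nn by (simp add: less_le)
      then show ?thesis using le[of x y] b by (simp add: I_def Pair)
    qed (simp add: I_def Pair)
  qed
  \<comment> \<open>The bound is summable over the possibly infinite range of \<open>Y\<close>, and
    the range \<open>A\<close> of \<open>X\<close> is finite; this gives integrability.\<close>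
  have I_le: "I (x, y) \<le> Py y / ln b" for x y
  proof (cases "Pxy x y = 0")
    case False
    then have pos: "0 < Pxy x y" using nn by (simp add: less_le)
    then have "Pxy x y * log b (Py y / Pxy x y) \<le> Pxy x y * ((Py y / Pxy x y - 1) / ln b)"
      unfolding log_def using le[of x y] b by (intro mult_left_mono divide_right_mono ln_le_minus_one) auto
    also have "\<dots> = (Py y - Pxy x y) / ln b" using pos by (simp add: right_diff_distrib)
    also have "\<dots> \<le> Py y / ln b" using pos b by (intro divide_right_mono) auto
    finally show ?thesis by (simp add: I_def)
  qed (use nn b in \<open>simp add: I_def\<close>)
  have intI: "integrable (count_space (A \<times> UNIV)) I"
  proof (rule integrableI_bounded)
    have "(\<integral>\<^sup>+z. ennreal (norm (I z)) \<partial>count_space (A \<times> UNIV)) \<le> (\<integral>\<^sup>+z. ennreal (Py (snd z) / ln b) \<partial>count_space (A \<times> UNIV))"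
      using I_nonneg I_le by (intro nn_integral_mono ennreal_leI) auto
    also have "\<dots> = (\<integral>\<^sup>+x. \<integral>\<^sup>+y. ennreal (Py y / ln b) \<partial>count_space UNIV \<partial>count_space A)"
    proof -
      interpret sigma_finite_measure "count_space (UNIV :: 'c set)"
        by (rule sigma_finite_measure_count_space_countable) simp
      show ?thesis unfolding prod[symmetric] by (subst nn_integral_fst[symmetric]) (auto simp: prod)
    qed
    also have "\<dots> = (\<integral>\<^sup>+x. ennreal (1 / ln b) \<partial>count_space A)"
    proof (rule nn_integral_cong)
      fix x
      have "(\<integral>\<^sup>+y. ennreal (Py y / ln b) \<partial>count_space UNIV)
          = (\<integral>\<^sup>+y. ennreal (1 / ln b) * ennreal (pmf (map_pmf Y p) y) \<partial>count_space UNIV)"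
        using b by (intro nn_integral_cong) (simp add: pmf_map Py_def vimage_def ennreal_mult[symmetric])
      also have "\<dots> = ennreal (1 / ln b)"
        by (subst nn_integral_cmult) (auto simp: nn_integral_pmf)
      finally show "(\<integral>\<^sup>+y. ennreal (Py y / ln b) \<partial>count_space UNIV) = ennreal (1 / ln b)" .
    qed
    also have "\<dots> < \<infinity>" using A(1) by (simp add: nn_integral_count_space_finite ennreal_mult_less_top of_nat_less_top)
    finally show "(\<integral>\<^sup>+z. ennreal (norm (I z)) \<partial>count_space (A \<times> UNIV)) < \<infinity>" .
  qed simp
  have "prob_space.conditional_entropy (measure_pmf p) b (count_space A) (count_space UNIV) X Y
      = (\<integral>z. I z \<partial>count_space (A \<times> UNIV))"
    unfolding conditional_entropy_pmf[OF b A] integral_minus[symmetric]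
  proof (rule Bochner_Integration.integral_cong[OF refl])
    fix z :: "'b \<times> 'c"
    obtain x y where z: "z = (x, y)" by (cases z)
    have "pmf (map_pmf (\<lambda>\<omega>. (X \<omega>, Y \<omega>)) p) (x, y) = Pxy x y" "pmf (map_pmf Y p) y = Py y"
      by (auto simp: pmf_map Pxy_def Py_def vimage_def)
    moreover have "- (Pxy x y * log b (Pxy x y / Py y)) = Pxy x y * log b (Py y / Pxy x y)"
    proof (cases "Pxy x y = 0")
      case False
      then have pos: "0 < Pxy x y" using nn(1)[of x y] by linarith
      have "0 < Py y" using pos le[of x y] by linarith
      with pos show ?thesis by (simp add: log_divide algebra_simps)
    qed simp
    ultimately show "- (case z of (x, y) \<Rightarrow> pmf (map_pmf (\<lambda>\<omega>. (X \<omega>, Y \<omega>)) p) (x, y) *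
        log b (pmf (map_pmf (\<lambda>\<omega>. (X \<omega>, Y \<omega>)) p) (x, y) / pmf (map_pmf Y p) y)) = I z"
      by (simp add: I_def z)
  qed
  also have "\<dots> = 0 \<longleftrightarrow> (\<forall>z\<in>A \<times> UNIV. I z = 0)"
    using integral_nonneg_eq_0_iff_AE[OF intI] I_nonneg by (auto simp: AE_count_space)
  also have "\<dots> \<longleftrightarrow> (\<forall>\<omega>\<in>set_pmf p. \<forall>\<omega>'\<in>set_pmf p. Y \<omega> = Y \<omega>' \<longrightarrow> X \<omega> = X \<omega>')"
  proof
    assume I0: "\<forall>z\<in>A \<times> UNIV. I z = 0"
    show "\<forall>\<omega>\<in>set_pmf p. \<forall>\<omega>'\<in>set_pmf p. Y \<omega> = Y \<omega>' \<longrightarrow> X \<omega> = X \<omega>'"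
    proof (intro ballI impI, rule ccontr)
      fix \<omega> \<omega>' assume w: "\<omega> \<in> set_pmf p" "\<omega>' \<in> set_pmf p" "Y \<omega> = Y \<omega>'" "X \<omega> \<noteq> X \<omega>'"
      have pos: "0 < Pxy (X u) (Y u)" if "u \<in> set_pmf p" for u
      proof -
        have "measure (measure_pmf p) {u} \<le> Pxy (X u) (Y u)"
          unfolding Pxy_def by (intro measure_pmf.finite_measure_mono) auto
        moreover have "0 < pmf p u" using that by (simp add: pmf_positive)
        ultimately show ?thesis by (simp add: pmf.rep_eq)
      qed
      \<comment> \<open>Two values of \<open>X\<close> that occur with the same value of
        \<open>Y\<close> share its probability, so the quotient inside the logarithm exceeds
        1.\<close>
      have disj: "{u. X u = X \<omega> \<and> Y u = Y \<omega>} \<inter> {u. X u = X \<omega>' \<and> Y u = Y \<omega>'} = {}"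
        using w(4) by auto
      have "Pxy (X \<omega>) (Y \<omega>) + Pxy (X \<omega>') (Y \<omega>')
          = measure (measure_pmf p) ({u. X u = X \<omega> \<and> Y u = Y \<omega>} \<union> {u. X u = X \<omega>' \<and> Y u = Y \<omega>'})"
        unfolding Pxy_def by (rule measure_pmf.finite_measure_Union[symmetric, OF _ _ disj]) simp_all
      also have "\<dots> \<le> Py (Y \<omega>)"
        unfolding Py_def using w(3) by (intro measure_pmf.finite_measure_mono) auto
      finally have "Pxy (X \<omega>) (Y \<omega>) + Pxy (X \<omega>') (Y \<omega>') \<le> Py (Y \<omega>)" .
      then have "1 < Py (Y \<omega>) / Pxy (X \<omega>) (Y \<omega>)" using pos[OF w(1)] pos[OF w(2)] by simp
      then have "0 < I (X \<omega>, Y \<omega>)" using pos[OF w(1)] b by (simp add: I_def)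
      then show False using I0 A(2)[of \<omega>] by auto
    qed
  next
    assume det: "\<forall>\<omega>\<in>set_pmf p. \<forall>\<omega>'\<in>set_pmf p. Y \<omega> = Y \<omega>' \<longrightarrow> X \<omega> = X \<omega>'"
    show "\<forall>z\<in>A \<times> UNIV. I z = 0"
    proof
      fix z :: "'b \<times> 'c"
      obtain x y where z: "z = (x, y)" by (cases z)
      show "I z = 0"
      proof (cases "Pxy x y = 0")
        case False
        then have "set_pmf p \<inter> {\<omega>. X \<omega> = x \<and> Y \<omega> = y} \<noteq> {}"
          unfolding Pxy_def by (auto simp: measure_pmf_zero_iff)
        then obtain \<omega> where w: "\<omega> \<in> set_pmf p" "X \<omega> = x" "Y \<omega> = y" by auto
        have "X u = x" if "u \<in> set_pmf p" "Y u = y" for u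
          using det[rule_format, OF that(1) w(1)] that(2) w by simp
        then have "AE u in measure_pmf p. u \<in> {u. X u = x \<and> Y u = y} \<longleftrightarrow> u \<in> {u. Y u = y}"
          unfolding AE_measure_pmf_iff mem_Collect_eq by blast
        then have "Pxy x y = Py y"
          unfolding Pxy_def Py_def by (rule measure_pmf.finite_measure_eq_AE) simp_all
        then show ?thesis using False by (simp add: I_def z)
      qed (simp add: I_def z)
    qed
  qed
  finally show ?thesis .
qed

section \<open>Information sets and contents\<close>

text \<open>Double counting: each row support contains an information set of size \<open>k\<close>,
  while the column weights leave only \<open>\<nu> * k\<close> ones in the whole matrix. Hence every
  row support is itself an information set, and the chosen sets cover each database equally
  often.\<close>

lemma MDS_PIR_information_sets:
  assumes G: "G \<in> carrier_mat k n" and k: "1 \<le> k" "k \<le> n" and mds: "MDS_PIR_capacity_achieving G"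
  obtains \<kappa> \<nu> I where "0 < \<nu>" "\<And>u. u < \<nu> \<Longrightarrow> information_set G (I u)"
    "\<And>j. j < n \<Longrightarrow> card {u. u < \<nu> \<and> j \<in> I u} = \<kappa>" "\<kappa> * n = \<nu> * k"
proof -
  obtain \<kappa> \<nu> \<Lambda> where nu: "0 < \<nu>" and L: "pir_achievable_rate_matrix G \<kappa> \<nu> \<Lambda>"
    and rate: "real \<kappa> / real \<nu> = real k / real n"
    using mds G unfolding MDS_PIR_capacity_achieving_def by auto
  define J where "J = (\<lambda>u. {j. j < n \<and> \<Lambda> $$ (u, j) \<noteq> 0})"
  have dims: "dim_row G = k" "dim_col G = n" using G by auto
  have "\<forall>u. \<exists>I. u < \<nu> \<longrightarrow> information_set G I \<and> I \<subseteq> J u"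
    using L unfolding pir_achievable_rate_matrix_def dims J_def by blast
  then have "\<exists>I. \<forall>u. u < \<nu> \<longrightarrow> information_set G (I u) \<and> I u \<subseteq> J u" by (rule choice)
  then obtain I where I0: "\<forall>u. u < \<nu> \<longrightarrow> information_set G (I u) \<and> I u \<subseteq> J u" by (elim exE)
  have I: "information_set G (I u)" "I u \<subseteq> J u" if "u < \<nu>" for u using I0 that by simp_all
  have cI: "card (I u) = k" if "u < \<nu>" for u using I(1)[OF that] dims by (simp add: information_set_def)
  have col: "card {u. u < \<nu> \<and> j \<in> J u} = \<kappa>" if "j < n" for j
    using L that unfolding pir_achievable_rate_matrix_def dims J_def by simp
  have prod: "\<kappa> * n = \<nu> * k"
  proof -
    have "real \<kappa> * real n = real \<nu> * real k" using rate nu k by (simp add: field_simps)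
    then show ?thesis by (simp only: of_nat_mult[symmetric] of_nat_eq_iff)
  qed
  have finJ: "finite (J u)" for u unfolding J_def by simp
  have "(\<Sum>u<\<nu>. card (J u)) = (\<Sum>u<\<nu>. \<Sum>j<n. if j \<in> J u then 1 else 0)"
  proof (rule sum.cong[OF refl])
    fix u
    have "{j \<in> {..<n}. j \<in> J u} = J u" unfolding J_def by blast
    moreover have "(\<Sum>j<n. if j \<in> J u then 1 else 0) = card {j \<in> {..<n}. j \<in> J u}"
      by (simp add: sum.inter_filter[symmetric])
    ultimately show "card (J u) = (\<Sum>j<n. if j \<in> J u then 1 else 0)" by simp
  qed
  also have "\<dots> = (\<Sum>j<n. card {u. u < \<nu> \<and> j \<in> J u})"
  proof (subst sum.swap, rule sum.cong[OF refl])
    fix j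
    have "(\<Sum>u<\<nu>. if j \<in> J u then 1 else 0) = card {u \<in> {..<\<nu>}. j \<in> J u}"
      by (simp add: sum.inter_filter[symmetric])
    also have "{u \<in> {..<\<nu>}. j \<in> J u} = {u. u < \<nu> \<and> j \<in> J u}" by blast
    finally show "(\<Sum>u<\<nu>. if j \<in> J u then 1 else 0) = card {u. u < \<nu> \<and> j \<in> J u}" .
  qed
  also have "\<dots> = n * \<kappa>" using col by simp
  also have "\<dots> = (\<Sum>u<\<nu>. card (I u))" using cI prod by (simp add: mult.commute)
  finally have total: "(\<Sum>u<\<nu>. card (J u)) = (\<Sum>u<\<nu>. card (I u))" .
  have IJ: "I u = J u" if u: "u < \<nu>" for u
  proof (rule card_subset_eq[OF finJ I(2)[OF u]], rule ccontr)
    assume ne: "card (I u) \<noteq> card (J u)"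
    have le: "card (I u') \<le> card (J u')" if "u' < \<nu>" for u' by (rule card_mono[OF finJ I(2)[OF that]])
    have "(\<Sum>u<\<nu>. card (I u)) < (\<Sum>u<\<nu>. card (J u))"
      by (rule sum_strict_mono_ex1) (use le u ne in \<open>auto intro!: bexI[of _ u] simp: nat_less_le\<close>)
    then show False using total by simp
  qed
  show thesis
  proof (rule that[OF nu I(1) _ prod])
    fix j assume "j < n"
    have "{u. u < \<nu> \<and> j \<in> I u} = {u. u < \<nu> \<and> j \<in> J u}" using IJ by auto
    then show "card {u. u < \<nu> \<and> j \<in> I u} = \<kappa>" using col[OF \<open>j < n\<close>] by simp
  qed
qed

text \<open>On \<open>I\<close> the codeword of \<open>x\<close> is \<open>x\<close> times an
  invertible submatrix; \<open>pick I\<close> translates its column positions into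
  databases.\<close>

lemma information_set_inj:
  fixes G :: "'a::field mat"
  assumes G: "G \<in> carrier_mat k n" and I: "information_set G I"
    and zero: "\<And>j. j \<in> I \<Longrightarrow> (\<Sum>a<k. x a * G $$ (a, j)) = 0" and a: "a < k"
  shows "x a = 0"
proof -
  have dims: "dim_row G = k" "dim_col G = n" using G by auto
  have sub: "I \<subseteq> {..<n}" "card I = k" "invertible_mat (submatrix G UNIV I)"
    using I by (auto simp: information_set_def dims)
  have cI: "{j. j < n \<and> j \<in> I} = I" using sub(1) by auto
  define S where "S = submatrix G UNIV I"
  have S: "S \<in> carrier_mat k k" unfolding S_def
    by (rule carrier_matI) (simp_all add: dim_submatrix dims cI sub(2))
  obtain B where B: "S * B = 1\<^sub>m k" "dim_col B = k" "dim_row B = k"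
  proof -
    obtain B where B: "inverts_mat S B" "inverts_mat B S"
      using sub(3) unfolding invertible_mat_def S_def by auto
    have SB: "S * B = 1\<^sub>m k" using B(1) S by (simp add: inverts_mat_def)
    have "dim_col (S * B) = dim_col (1\<^sub>m k :: 'a mat)" by (simp only: SB)
    then have c: "dim_col B = k" by simp
    have "B * S = 1\<^sub>m (dim_row B)" using B(2) by (simp add: inverts_mat_def)
    then have "dim_col (B * S) = dim_col (1\<^sub>m (dim_row B) :: 'a mat)" by simp
    then have "dim_row B = k" using S by simp
    with SB c show thesis by (rule that)
  qed
  have Sx: "(\<Sum>a<k. x a * S $$ (a, c)) = 0" if c: "c < k" for c
  proof -
    have "pick I c \<in> I"
      using c sub(2) cI by (metis (no_types, lifting) card.infinite not_less_zero pick_in_set)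
    moreover have "S $$ (a, c) = G $$ (a, pick I c)" if "a < k" for a
      unfolding S_def using that c by (subst submatrix_index) (auto simp: dims cI sub(2) pick_UNIV)
    ultimately show ?thesis using zero[of "pick I c"] by simp
  qed
  have "x a = (\<Sum>a'<k. if a' = a then x a' else 0)" using a by simp
  also have "\<dots> = (\<Sum>a'<k. x a' * (S * B) $$ (a', a))"
    unfolding B(1) by (intro sum.cong refl) (use a in auto)
  also have "\<dots> = (\<Sum>a'<k. \<Sum>c<k. B $$ (c, a) * (x a' * S $$ (a', c)))"
    using S B(2,3) a
    by (intro sum.cong refl) (simp add: scalar_prod_def sum_distrib_left lessThan_atLeast0 mult_ac)
  also have "\<dots> = (\<Sum>c<k. B $$ (c, a) * (\<Sum>a'<k. x a' * S $$ (a', c)))"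
    by (subst sum.swap) (simp add: sum_distrib_left)
  also have "\<dots> = 0" by (intro sum.neutral) (simp add: Sx)
  finally show ?thesis .
qed

section \<open>Messages and database contents as products of independent symbols\<close>

abbreviation messages :: "nat \<Rightarrow> nat \<Rightarrow> nat \<Rightarrow> (nat \<Rightarrow> 'a mat) set" where
  "messages f \<beta> k \<equiv> {..<f} \<rightarrow>\<^sub>E carrier_mat \<beta> k"

abbreviation contents :: "nat \<Rightarrow> nat \<Rightarrow> (nat \<Rightarrow> 'a vec) set" where
  "contents f \<beta> \<equiv> {..<f} \<rightarrow>\<^sub>E carrier_vec \<beta>"

abbreviation symbols :: "nat \<Rightarrow> (nat \<Rightarrow> 'a) set" where
  "symbols f \<equiv> {..<f} \<rightarrow>\<^sub>E UNIV"

text \<open>The position becomes the outer index and the message the inner one. The candidate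
  functions act at each position separately, so the positions are independent coordinates for
  them.\<close>

lemma bij_betw_messages:
  "bij_betw (\<lambda>w. \<lambda>p\<in>{..<\<beta>} \<times> {..<k}. \<lambda>m\<in>{..<f}. w m $$ p) (messages f \<beta> k :: (nat \<Rightarrow> 'a mat) set)
    (PiE ({..<\<beta>} \<times> {..<k}) (\<lambda>_. symbols f))"
proof (rule bij_betw_byWitness[where f' = "\<lambda>c. \<lambda>m\<in>{..<f}. mat \<beta> k (\<lambda>p. c p m)"])
  show "\<forall>w\<in>messages f \<beta> k. (\<lambda>m\<in>{..<f}. mat \<beta> k (\<lambda>p. (\<lambda>p\<in>{..<\<beta>} \<times> {..<k}. \<lambda>m\<in>{..<f}. w m $$ p) p m)) = (w :: nat \<Rightarrow> 'a mat)"
  proof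
    fix w :: "nat \<Rightarrow> 'a mat" assume w: "w \<in> messages f \<beta> k"
    show "(\<lambda>m\<in>{..<f}. mat \<beta> k (\<lambda>p. (\<lambda>p\<in>{..<\<beta>} \<times> {..<k}. \<lambda>m\<in>{..<f}. w m $$ p) p m)) = w"
    proof
      fix m
      show "(\<lambda>m\<in>{..<f}. mat \<beta> k (\<lambda>p. (\<lambda>p\<in>{..<\<beta>} \<times> {..<k}. \<lambda>m\<in>{..<f}. w m $$ p) p m)) m = w m"
      proof (cases "m < f")
        case True
        then have "w m \<in> carrier_mat \<beta> k" using w by auto
        then show ?thesis using True by (auto intro!: eq_matI)
      next
        case False
        then show ?thesis using PiE_arb[OF w, of m] by simp
      qed
    qed
  qed
  show "\<forall>c\<in>PiE ({..<\<beta>} \<times> {..<k}) (\<lambda>_. symbols f). (\<lambda>p\<in>{..<\<beta>} \<times> {..<k}. \<lambda>m\<in>{..<f}. (\<lambda>m\<in>{..<f}. mat \<beta> k (\<lambda>p. c p m)) m $$ p) = (c :: nat \<times> nat \<Rightarrow> nat \<Rightarrow> 'a)"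
  proof
    fix c :: "nat \<times> nat \<Rightarrow> nat \<Rightarrow> 'a" assume c: "c \<in> PiE ({..<\<beta>} \<times> {..<k}) (\<lambda>_. symbols f)"
    show "(\<lambda>p\<in>{..<\<beta>} \<times> {..<k}. \<lambda>m\<in>{..<f}. (\<lambda>m\<in>{..<f}. mat \<beta> k (\<lambda>p. c p m)) m $$ p) = c"
    proof (intro ext)
      fix p m
      show "(\<lambda>p\<in>{..<\<beta>} \<times> {..<k}. \<lambda>m\<in>{..<f}. (\<lambda>m\<in>{..<f}. mat \<beta> k (\<lambda>p. c p m)) m $$ p) p m = c p m"
      proof (cases "p \<in> {..<\<beta>} \<times> {..<k}")
        case True
        then have "c p \<in> symbols f" using c by blast
        then show ?thesis using True PiE_arb[of "c p" "{..<f}" "\<lambda>_. UNIV" m] by (cases p) auto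
      next
        case False
        then show ?thesis using PiE_arb[OF c False] by simp
      qed
    qed
  qed
qed auto

lemma bij_betw_contents:
  "bij_betw (\<lambda>C. \<lambda>i\<in>{..<\<beta>}. \<lambda>m\<in>{..<f}. C m $ i) (contents f \<beta> :: (nat \<Rightarrow> 'a vec) set)
    (PiE {..<\<beta>} (\<lambda>_. symbols f))"
proof (rule bij_betw_byWitness[where f' = "\<lambda>c. \<lambda>m\<in>{..<f}. vec \<beta> (\<lambda>i. c i m)"])
  show "\<forall>C\<in>contents f \<beta>. (\<lambda>m\<in>{..<f}. vec \<beta> (\<lambda>i. (\<lambda>i\<in>{..<\<beta>}. \<lambda>m\<in>{..<f}. C m $ i) i m)) = (C :: nat \<Rightarrow> 'a vec)"
  proof
    fix C :: "nat \<Rightarrow> 'a vec" assume C: "C \<in> contents f \<beta>"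
    show "(\<lambda>m\<in>{..<f}. vec \<beta> (\<lambda>i. (\<lambda>i\<in>{..<\<beta>}. \<lambda>m\<in>{..<f}. C m $ i) i m)) = C"
    proof
      fix m
      show "(\<lambda>m\<in>{..<f}. vec \<beta> (\<lambda>i. (\<lambda>i\<in>{..<\<beta>}. \<lambda>m\<in>{..<f}. C m $ i) i m)) m = C m"
      proof (cases "m < f")
        case True
        then have "C m \<in> carrier_vec \<beta>" using C by auto
        then show ?thesis using True by (auto intro!: eq_vecI)
      next
        case False
        then show ?thesis using PiE_arb[OF C, of m] by simp
      qed
    qed
  qed
  show "\<forall>c\<in>PiE {..<\<beta>} (\<lambda>_. symbols f). (\<lambda>i\<in>{..<\<beta>}. \<lambda>m\<in>{..<f}. (\<lambda>m\<in>{..<f}. vec \<beta> (\<lambda>i. c i m)) m $ i) = (c :: nat \<Rightarrow> nat \<Rightarrow> 'a)"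
  proof
    fix c :: "nat \<Rightarrow> nat \<Rightarrow> 'a" assume c: "c \<in> PiE {..<\<beta>} (\<lambda>_. symbols f)"
    show "(\<lambda>i\<in>{..<\<beta>}. \<lambda>m\<in>{..<f}. (\<lambda>m\<in>{..<f}. vec \<beta> (\<lambda>i. c i m)) m $ i) = c"
    proof (intro ext)
      fix i m
      show "(\<lambda>i\<in>{..<\<beta>}. \<lambda>m\<in>{..<f}. (\<lambda>m\<in>{..<f}. vec \<beta> (\<lambda>i. c i m)) m $ i) i m = c i m"
      proof (cases "i \<in> {..<\<beta>}")
        case True
        then have "c i \<in> symbols f" using c by blast
        then show ?thesis using True PiE_arb[of "c i" "{..<f}" "\<lambda>_. UNIV" m] by auto
      next
        case False
        then show ?thesis using PiE_arb[OF c False] by simp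
      qed
    qed
  qed
qed auto

context
  fixes f \<beta> k :: nat
begin

lemma finite_symbols: "finite (symbols f :: (nat \<Rightarrow> 'a::finite) set)"
  by (intro finite_PiE) auto

lemma finite_messages: "finite (messages f \<beta> k :: (nat \<Rightarrow> 'a::finite mat) set)"
  unfolding bij_betw_finite[OF bij_betw_messages] by (intro finite_PiE finite_symbols) auto

lemma finite_contents: "finite (contents f \<beta> :: (nat \<Rightarrow> 'a::finite vec) set)"
  unfolding bij_betw_finite[OF bij_betw_contents] by (intro finite_PiE finite_symbols) auto

lemma card_messages: "card (messages f \<beta> k :: (nat \<Rightarrow> 'a::finite mat) set) = card (symbols f :: (nat \<Rightarrow> 'a) set) ^ (\<beta> * k)"
  unfolding bij_betw_same_card[OF bij_betw_messages] by (simp add: card_PiE_const)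

lemma card_contents: "card (contents f \<beta> :: (nat \<Rightarrow> 'a::finite vec) set) = card (symbols f :: (nat \<Rightarrow> 'a) set) ^ \<beta>"
  unfolding bij_betw_same_card[OF bij_betw_contents] by (simp add: card_PiE_const)

lemma messages_nonempty: "(messages f \<beta> k :: (nat \<Rightarrow> 'a::zero mat) set) \<noteq> {}"
  by (auto simp: PiE_eq_empty_iff intro: zero_carrier_mat)

lemma contents_nonempty: "(contents f \<beta> :: (nat \<Rightarrow> 'a::zero vec) set) \<noteq> {}"
  by (auto simp: PiE_eq_empty_iff intro: zero_carrier_vec)

lemma symbols_nonempty: "(symbols f :: (nat \<Rightarrow> 'a) set) \<noteq> {}"
  by (auto simp: PiE_eq_empty_iff)

end

lemma database_content_index:
  assumes "G \<in> carrier_mat k n" "w m \<in> carrier_mat \<beta> k" "m < f" "j < n" "i < \<beta>"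
  shows "database_content G f j w m $ i = (\<Sum>a<k. w m $$ (i, a) * G $$ (a, j))"
  using assms by (simp add: database_content_def scalar_prod_def lessThan_atLeast0)

lemma database_content_in:
  assumes "G \<in> carrier_mat k n" "w \<in> messages f \<beta> k"
  shows "database_content G f j w \<in> contents f \<beta>"
proof
  fix m assume m: "m \<in> {..<f}"
  then have "w m \<in> carrier_mat \<beta> k" using assms(2) by auto
  then show "database_content G f j w m \<in> carrier_vec \<beta>"
    using m by (simp add: database_content_def carrier_vecI)
qed (simp add: database_content_def)

text \<open>The contents on an information set determine the messages, and surjectivity follows by
  counting: \<open>k\<close> contents of \<beta> symbols against \<open>\<beta> * k\<close> entries
  per message. Thus these contents are independent and uniform.\<close>

lemma bij_betw_database_contents:
  fixes G :: "'a::{field,finite} mat"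
  assumes G: "G \<in> carrier_mat k n" and I: "information_set G I"
  shows "bij_betw (\<lambda>w. \<lambda>j\<in>I. database_content G f j w) (messages f \<beta> k) (PiE I (\<lambda>_. contents f \<beta>))"
proof -
  let ?\<phi> = "\<lambda>w. \<lambda>j\<in>I. database_content G f j w"
  have sub: "I \<subseteq> {..<n}" "card I = k" using I G by (auto simp: information_set_def)
  then have finI: "finite I" using finite_subset by blast
  have inj: "inj_on ?\<phi> (messages f \<beta> k)"
  proof (rule inj_onI)
    fix w w' :: "nat \<Rightarrow> 'a mat"
    assume w: "w \<in> messages f \<beta> k" "w' \<in> messages f \<beta> k" and eq: "?\<phi> w = ?\<phi> w'"
    show "w = w'"
    proof (rule PiE_ext[OF w])
      fix m assume "m \<in> {..<f}"
      then have m: "m < f" "w m \<in> carrier_mat \<beta> k" "w' m \<in> carrier_mat \<beta> k" using w by auto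
      have "w m $$ (i, a) - w' m $$ (i, a) = 0" if ia: "i < \<beta>" "a < k" for i a
      proof (rule information_set_inj[OF G I _ ia(2), where x = "\<lambda>a. w m $$ (i, a) - w' m $$ (i, a)"])
        fix j assume j: "j \<in> I"
        then have jn: "j < n" using sub(1) by auto
        have "database_content G f j w m $ i = database_content G f j w' m $ i"
          using eq j unfolding restrict_eq_iff by simp
        then show "(\<Sum>a<k. (w m $$ (i, a) - w' m $$ (i, a)) * G $$ (a, j)) = 0"
          using database_content_index[where w = w, OF G m(2,1) jn ia(1)]
            database_content_index[where w = w', OF G m(3,1) jn ia(1)]
          by (simp add: left_diff_distrib sum_subtractf)
      qed
      then show "w m = w' m" using m by (intro eq_matI) auto
    qed
  qed
  have maps: "?\<phi> ` messages f \<beta> k \<subseteq> PiE I (\<lambda>_. contents f \<beta>)"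
    using database_content_in[OF G] by (intro image_subsetI restrict_PiE_iff[THEN iffD2] ballI) blast
  have "card (?\<phi> ` messages f \<beta> k) = card (PiE I (\<lambda>_. contents f \<beta> :: (nat \<Rightarrow> 'a vec) set))"
    unfolding card_image[OF inj] card_PiE_const[OF finI] card_messages card_contents sub(2) power_mult ..
  then have "?\<phi> ` messages f \<beta> k = PiE I (\<lambda>_. contents f \<beta>)"
    by (intro card_subset_eq maps finite_PiE finI finite_contents)
  then show ?thesis using inj by (simp add: bij_betw_def)
qed

text \<open>All fibres are translates of the kernel, and independence of the rows makes every value
  occur, so the value is uniform.\<close>

lemma fent_linear:
  fixes \<rho> :: "nat \<Rightarrow> nat \<Rightarrow> 'a::{field,finite}"
  assumes T: "finite T" "indep_rows \<rho> f T"
  shows "fent (real CARD('a)) (symbols f) (\<lambda>c. \<lambda>v\<in>T. \<Sum>m<f. \<rho> v m * c m) = real (card T)"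
proof -
  let ?z = "\<lambda>c. \<lambda>v\<in>T. \<Sum>m<f. \<rho> v m * c m"
  let ?K = "{c \<in> symbols f. ?z c = ?z (\<lambda>_. 0)}"
  have fib: "card {c' \<in> symbols f. ?z c' = ?z c} = card ?K" if c: "c \<in> symbols f" for c
  proof (rule bij_betw_same_card, rule bij_betw_byWitness[where f' = "\<lambda>d. \<lambda>m\<in>{..<f}. d m + c m"])
    let ?g = "\<lambda>c'. \<lambda>m\<in>{..<f}. c' m - c m"
    have ext: "d m = undefined" if "d \<in> symbols f" "\<not> m < f" for d :: "nat \<Rightarrow> 'a" and m
      using PiE_arb[OF that(1), of m] that(2) by simp
    show "\<forall>c'\<in>{c' \<in> symbols f. ?z c' = ?z c}. (\<lambda>m\<in>{..<f}. ?g c' m + c m) = c'"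
      by (auto simp: fun_eq_iff ext)
    show "\<forall>d\<in>?K. ?g (\<lambda>m\<in>{..<f}. d m + c m) = d"
      by (auto simp: fun_eq_iff ext)
    have z1: "(\<Sum>m<f. \<rho> v m * (c' m - c m)) = (\<Sum>m<f. \<rho> v m * c' m) - (\<Sum>m<f. \<rho> v m * c m)" for v c'
      by (simp add: right_diff_distrib sum_subtractf)
    have z2: "(\<Sum>m<f. \<rho> v m * (d m + c m)) = (\<Sum>m<f. \<rho> v m * d m) + (\<Sum>m<f. \<rho> v m * c m)" for v d
      by (simp add: distrib_left sum.distrib)
    show "?g ` {c' \<in> symbols f. ?z c' = ?z c} \<subseteq> ?K"
      unfolding restrict_eq_iff by (intro image_subsetI) (simp add: z1)
    show "(\<lambda>d. \<lambda>m\<in>{..<f}. d m + c m) ` ?K \<subseteq> {c' \<in> symbols f. ?z c' = ?z c}"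
      unfolding restrict_eq_iff by (intro image_subsetI) (simp add: z2)
  qed
  have img: "?z ` symbols f = T \<rightarrow>\<^sub>E UNIV"
  proof
    show "T \<rightarrow>\<^sub>E UNIV \<subseteq> ?z ` symbols f"
    proof
      fix g :: "nat \<Rightarrow> 'a" assume g: "g \<in> T \<rightarrow>\<^sub>E UNIV"
      obtain x where x: "\<forall>v\<in>T. (\<Sum>m<f. \<rho> v m * x m) = g v"
        using T(2)[unfolded indep_rows_def, rule_format, of g] by (elim exE)
      have "?z (restrict x {..<f}) = g"
      proof
        fix v
        have "(\<Sum>m<f. \<rho> v m * restrict x {..<f} m) = (\<Sum>m<f. \<rho> v m * x m)" by simp
        then show "?z (restrict x {..<f}) v = g v"
          using x PiE_arb[OF g, of v] by (cases "v \<in> T") simp_all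
      qed
      then show "g \<in> ?z ` symbols f" by (intro image_eqI[of _ _ "restrict x {..<f}"]) auto
    qed
  qed auto
  have "fent (real CARD('a)) (symbols f) ?z = log CARD('a) (card (?z ` symbols f))"
    by (rule fent_equal_fibers[OF finite_symbols symbols_nonempty fib])
  also have "\<dots> = card T"
    using T(1) one_less_card_field[where 'a = 'a]
    by (simp add: img card_PiE log_nat_power)
  finally show ?thesis .
qed

section \<open>Candidate functions and their coded versions\<close>

locale coded_functions =
  fixes G V :: "'q::{field,finite} mat" and k n f \<mu> \<beta> :: nat and q :: real
  assumes q_eq: "q = real CARD('q)" and G: "G \<in> carrier_mat k n" and V: "V \<in> carrier_mat \<mu> f" and k_pos: "1 \<le> k" and \<beta>_pos: "0 < \<beta>"
begin

abbreviation "\<Omega> \<equiv> messages f \<beta> k :: (nat \<Rightarrow> 'q mat) set"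

definition cand :: "nat set \<Rightarrow> (nat \<Rightarrow> 'q mat) \<Rightarrow> nat \<Rightarrow> nat \<times> nat \<Rightarrow> 'q" where
  "cand T w = (\<lambda>v\<in>T. \<lambda>p\<in>{..<\<beta>} \<times> {..<k}. \<Sum>m<f. V $$ (v, m) * w m $$ p)"

definition coded_cand :: "nat set \<Rightarrow> (nat \<Rightarrow> 'q vec) \<Rightarrow> nat \<Rightarrow> nat \<Rightarrow> 'q" where
  "coded_cand T c = (\<lambda>v\<in>T. \<lambda>i\<in>{..<\<beta>}. \<Sum>m<f. V $$ (v, m) * c m $ i)"

abbreviation "stored j w \<equiv> database_content G f j w"

lemma q_gt_1: "1 < q" using one_less_card_field[where 'a = 'q] by (simp add: q_eq)

lemma message_carrier: "w \<in> \<Omega> \<Longrightarrow> m < f \<Longrightarrow> w m \<in> carrier_mat \<beta> k"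
  by auto

lemma coded_sum:
  assumes w: "w \<in> \<Omega>" and "j < n" "i < \<beta>"
  shows "(\<Sum>m<f. V $$ (v, m) * stored j w m $ i) = (\<Sum>a<k. (\<Sum>m<f. V $$ (v, m) * w m $$ (i, a)) * G $$ (a, j))"
proof -
  have "(\<Sum>m<f. V $$ (v, m) * stored j w m $ i)
      = (\<Sum>m<f. \<Sum>a<k. V $$ (v, m) * w m $$ (i, a) * G $$ (a, j))"
    by (intro sum.cong refl)
      (simp add: database_content_index[where w = w, OF G message_carrier[OF w]] assms sum_distrib_left mult.assoc)
  also have "\<dots> = (\<Sum>a<k. (\<Sum>m<f. V $$ (v, m) * w m $$ (i, a)) * G $$ (a, j))"
    by (subst sum.swap) (simp add: sum_distrib_right)
  finally show ?thesis .
qed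

lemma cand_eq_iff: "cand T w = cand T w' \<longleftrightarrow>
  (\<forall>v\<in>T. \<forall>i<\<beta>. \<forall>a<k. (\<Sum>m<f. V $$ (v, m) * w m $$ (i, a)) = (\<Sum>m<f. V $$ (v, m) * w' m $$ (i, a)))"
  unfolding cand_def restrict_eq_iff by (auto simp: restrict_eq_iff)

text \<open>Combining messages commutes with encoding, so applying the candidate function to stored
  symbols gives the codeword of its value, which the coordinates in \<open>I\<close>
  determine.\<close>

lemma cand_eq_iff_coded:
  assumes I: "information_set G I" and w: "w \<in> \<Omega>" "w' \<in> \<Omega>"
  shows "cand T w = cand T w' \<longleftrightarrow> (\<forall>j\<in>I. coded_cand T (stored j w) = coded_cand T (stored j w'))"
proof
  have sub: "j < n" if "j \<in> I" for j using I G that by (auto simp: information_set_def)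
  assume "cand T w = cand T w'"
  then show "\<forall>j\<in>I. coded_cand T (stored j w) = coded_cand T (stored j w')"
    unfolding cand_eq_iff coded_cand_def restrict_eq_iff
    by (intro ballI) (simp add: coded_sum[OF w(1)] coded_sum[OF w(2)] sub)
next
  have sub: "j < n" if "j \<in> I" for j using I G that by (auto simp: information_set_def)
  assume eq: "\<forall>j\<in>I. coded_cand T (stored j w) = coded_cand T (stored j w')"
  show "cand T w = cand T w'" unfolding cand_eq_iff
  proof (intro ballI allI impI)
    fix v i a assume v: "v \<in> T" and i: "i < \<beta>" and a: "a < k"
    let ?X = "\<lambda>w a. \<Sum>m<f. V $$ (v, m) * w m $$ (i, a)"
    have "?X w a - ?X w' a = 0"
    proof (rule information_set_inj[OF G I _ a, where x = "\<lambda>a. ?X w a - ?X w' a"])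
      fix j assume j: "j \<in> I"
      have "coded_cand T (stored j w) v i = coded_cand T (stored j w') v i" using eq j by simp
      then have "(\<Sum>a<k. ?X w a * G $$ (a, j)) = (\<Sum>a<k. ?X w' a * G $$ (a, j))"
        using v i by (simp add: coded_cand_def coded_sum[OF w(1)] coded_sum[OF w(2)] sub[OF j])
      then show "(\<Sum>a<k. (?X w a - ?X w' a) * G $$ (a, j)) = 0"
        by (simp add: left_diff_distrib sum_subtractf)
    qed
    then show "?X w a = ?X w' a" by simp
  qed
qed

text \<open>The conditional entropy of \<open>A\<close> given the candidate functions in
  \<open>T\<close>, by the chain rule.\<close>

definition cond :: "nat set \<Rightarrow> ((nat \<Rightarrow> 'q mat) \<Rightarrow> 'c) \<Rightarrow> real" where
  "cond T A = fent q \<Omega> (\<lambda>w. (A w, cand T w)) - fent q \<Omega> (cand T)"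

text \<open>The databases of an information set store independent contents, and the candidate functions
  split into their coded versions.\<close>

lemma fent_information_set:
  fixes A :: "nat \<Rightarrow> (nat \<Rightarrow> 'q vec) \<Rightarrow> 'c"
  assumes I: "information_set G I" and K: "K \<subseteq> I"
  shows "fent q \<Omega> (\<lambda>w. (\<lambda>j\<in>K. A j (stored j w), cand T w))
    = (\<Sum>j\<in>I. fent q (contents f \<beta>) (\<lambda>c. (if j \<in> K then Some (A j c) else None, coded_cand T c)))"
proof -
  have finI: "finite I" using I G by (auto simp: information_set_def intro: finite_subset)
  \<comment> \<open>\<open>None\<close> allows answers from only a part \<open>K\<close> of the
    information set, while the coded candidate values of all its databases are kept.\<close>
  let ?Y = "\<lambda>j c. (if j \<in> K then Some (A j c) else None, coded_cand T c)"
  let ?\<phi> = "\<lambda>w. \<lambda>j\<in>I. stored j w"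
  have "fent q \<Omega> (\<lambda>w. (\<lambda>j\<in>K. A j (stored j w), cand T w)) = fent q \<Omega> (\<lambda>w. \<lambda>j\<in>I. ?Y j (?\<phi> w j))"
  proof (rule fent_cong)
    fix w w' assume w: "w \<in> \<Omega>" "w' \<in> \<Omega>"
    have "(\<lambda>j\<in>I. ?Y j (?\<phi> w' j)) = (\<lambda>j\<in>I. ?Y j (?\<phi> w j)) \<longleftrightarrow>
        (\<forall>j\<in>K. A j (stored j w') = A j (stored j w)) \<and>
        (\<forall>j\<in>I. coded_cand T (stored j w') = coded_cand T (stored j w))"
      unfolding restrict_eq_iff using K by auto
    also have "\<dots> \<longleftrightarrow> (\<lambda>j\<in>K. A j (stored j w')) = (\<lambda>j\<in>K. A j (stored j w)) \<and> cand T w' = cand T w"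
      unfolding restrict_eq_iff cand_eq_iff_coded[OF I w(2,1)] ..
    finally show "((\<lambda>j\<in>K. A j (stored j w'), cand T w') = (\<lambda>j\<in>K. A j (stored j w), cand T w)) \<longleftrightarrow>
        (\<lambda>j\<in>I. ?Y j (?\<phi> w' j)) = (\<lambda>j\<in>I. ?Y j (?\<phi> w j))" by simp
  qed
  also have "\<dots> = fent q (PiE I (\<lambda>_. contents f \<beta>)) (\<lambda>\<omega>. \<lambda>j\<in>I. ?Y j (\<omega> j))"
    by (rule fent_bij[OF bij_betw_database_contents[OF G I]])
  also have "\<dots> = (\<Sum>j\<in>I. fent q (contents f \<beta>) (?Y j))"
    by (rule fent_product[OF finite_contents contents_nonempty finI])
  finally show ?thesis .
qed

text \<open>The entropy splits into one summand for each database of \<open>I\<close>. An answer of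
  \<open>j\<close> changes summand \<open>j\<close> only, and the others cancel against the entropy
  of the candidate values.\<close>

lemma cond_information_set:
  fixes A :: "nat \<Rightarrow> (nat \<Rightarrow> 'q vec) \<Rightarrow> 'c"
  assumes I: "information_set G I"
  shows "cond T (\<lambda>w. \<lambda>j\<in>I. A j (stored j w)) = (\<Sum>j\<in>I. cond T (\<lambda>w. A j (stored j w)))"
proof -
  have finI: "finite I" using I G by (auto simp: information_set_def intro: finite_subset)
  let ?F = "\<lambda>K j. fent q (contents f \<beta>) (\<lambda>c. (if j \<in> K then Some (A j c) else None, coded_cand T c))"
  have none: "fent q \<Omega> (cand T) = (\<Sum>j\<in>I. ?F {} j)"
  proof -
    have "fent q \<Omega> (cand T) = fent q \<Omega> (\<lambda>w. (\<lambda>j\<in>{}. A j (stored j w), cand T w))"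
      by (rule fent_cong) (auto simp: restrict_eq_iff)
    also have "\<dots> = (\<Sum>j\<in>I. ?F {} j)" by (rule fent_information_set[OF I]) simp
    finally show ?thesis .
  qed
  have one: "cond T (\<lambda>w. A j (stored j w)) = ?F I j - ?F {} j" if j: "j \<in> I" for j
  proof -
    have "fent q \<Omega> (\<lambda>w. (A j (stored j w), cand T w)) = fent q \<Omega> (\<lambda>w. (\<lambda>i\<in>{j}. A i (stored i w), cand T w))"
      by (rule fent_cong) (auto simp: restrict_eq_iff)
    also have "\<dots> = (\<Sum>i\<in>I. ?F {j} i)" by (rule fent_information_set[OF I]) (use j in simp)
    also have "\<dots> = ?F {j} j + (\<Sum>i\<in>I - {j}. ?F {j} i)" by (rule sum.remove[OF finI j])
    also have "(\<Sum>i\<in>I - {j}. ?F {j} i) = (\<Sum>i\<in>I - {j}. ?F {} i)" by (rule sum.cong) auto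
    also have "\<dots> = (\<Sum>i\<in>I. ?F {} i) - ?F {} j" by (simp only: sum_diff1[OF finI] j if_True)
    finally show ?thesis using j by (simp add: cond_def none)
  qed
  have "cond T (\<lambda>w. \<lambda>j\<in>I. A j (stored j w)) = (\<Sum>j\<in>I. ?F I j) - (\<Sum>j\<in>I. ?F {} j)"
    unfolding cond_def none[symmetric] fent_information_set[OF I subset_refl] ..
  also have "\<dots> = (\<Sum>j\<in>I. ?F I j - ?F {} j)" by (rule sum_subtractf[symmetric])
  also have "\<dots> = (\<Sum>j\<in>I. cond T (\<lambda>w. A j (stored j w)))" by (rule sum.cong) (simp_all only: one)
  finally show ?thesis .
qed

lemma fent_entrywise:
  fixes Y :: "nat \<times> nat \<Rightarrow> (nat \<Rightarrow> 'q) \<Rightarrow> 'c"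
  shows "fent q \<Omega> (\<lambda>w. \<lambda>p\<in>{..<\<beta>} \<times> {..<k}. Y p (\<lambda>m\<in>{..<f}. w m $$ p)) = (\<Sum>p\<in>{..<\<beta>} \<times> {..<k}. fent q (symbols f) (Y p))"
proof -
  let ?\<phi> = "\<lambda>w. \<lambda>p\<in>{..<\<beta>} \<times> {..<k}. \<lambda>m\<in>{..<f}. w m $$ p"
  have "fent q \<Omega> (\<lambda>w. \<lambda>p\<in>{..<\<beta>} \<times> {..<k}. Y p (\<lambda>m\<in>{..<f}. w m $$ p)) = fent q \<Omega> (\<lambda>w. \<lambda>p\<in>{..<\<beta>} \<times> {..<k}. Y p (?\<phi> w p))"
    by (rule fent_cong) (simp add: restrict_eq_iff)
  also have "\<dots> = fent q (PiE ({..<\<beta>} \<times> {..<k}) (\<lambda>_. symbols f)) (\<lambda>\<omega>. \<lambda>p\<in>{..<\<beta>} \<times> {..<k}. Y p (\<omega> p))"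
    by (rule fent_bij[OF bij_betw_messages])
  also have "\<dots> = (\<Sum>p\<in>{..<\<beta>} \<times> {..<k}. fent q (symbols f) (Y p))"
    by (rule fent_product[OF finite_symbols symbols_nonempty]) simp
  finally show ?thesis .
qed

lemma fent_cand:
  assumes T: "finite T" "indep_rows (\<lambda>v m. V $$ (v, m)) f T"
  shows "fent q \<Omega> (cand T) = real (card T) * real (\<beta> * k)"
proof -
  have "fent q \<Omega> (cand T) = fent q \<Omega> (\<lambda>w. \<lambda>p\<in>{..<\<beta>} \<times> {..<k}. \<lambda>v\<in>T. \<Sum>m<f. V $$ (v, m) * (\<lambda>m\<in>{..<f}. w m $$ p) m)"
    by (rule fent_cong) (auto simp: cand_eq_iff restrict_eq_iff)
  also have "\<dots> = (\<Sum>p\<in>{..<\<beta>} \<times> {..<k}. fent q (symbols f) (\<lambda>c. \<lambda>v\<in>T. \<Sum>m<f. V $$ (v, m) * c m))"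
    by (rule fent_entrywise)
  also have "\<dots> = real (card T) * real (\<beta> * k)"
    unfolding fent_linear[OF T, folded q_eq] by (simp add: card_cartesian_product)
  finally show ?thesis .
qed

lemma cand_index:
  assumes "v < \<mu>" "l < \<beta> * k"
  shows "candidate_matrix G V \<beta> w $$ (v, l) = (\<Sum>m<f. V $$ (v, m) * w m $$ (l div k, l mod k))"
  using assms G V by (simp add: candidate_matrix_def message_matrix_def scalar_prod_def lessThan_atLeast0)

lemma row_cand_eq_iff:
  assumes v: "v < \<mu>"
  shows "row (candidate_matrix G V \<beta> w) v = row (candidate_matrix G V \<beta> w') v \<longleftrightarrow> cand {v} w = cand {v} w'"
proof -
  have dims: "candidate_matrix G V \<beta> w \<in> carrier_mat \<mu> (\<beta> * k)" for w
    unfolding candidate_matrix_def message_matrix_def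
    by (rule mult_carrier_mat[of _ _ f]) (use G V in auto)
  have "row (candidate_matrix G V \<beta> w) v = row (candidate_matrix G V \<beta> w') v \<longleftrightarrow>
      (\<forall>l<\<beta> * k. candidate_matrix G V \<beta> w $$ (v, l) = candidate_matrix G V \<beta> w' $$ (v, l))"
  proof
    assume eq: "row (candidate_matrix G V \<beta> w) v = row (candidate_matrix G V \<beta> w') v"
    show "\<forall>l<\<beta> * k. candidate_matrix G V \<beta> w $$ (v, l) = candidate_matrix G V \<beta> w' $$ (v, l)"
    proof (intro allI impI)
      fix l assume "l < \<beta> * k"
      then show "candidate_matrix G V \<beta> w $$ (v, l) = candidate_matrix G V \<beta> w' $$ (v, l)"
        using arg_cong[OF eq, of "\<lambda>x. x $ l"] v carrier_matD[OF dims[of w]] carrier_matD[OF dims[of w']]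
        by simp
    qed
  next
    assume "\<forall>l<\<beta> * k. candidate_matrix G V \<beta> w $$ (v, l) = candidate_matrix G V \<beta> w' $$ (v, l)"
    then show "row (candidate_matrix G V \<beta> w) v = row (candidate_matrix G V \<beta> w') v"
      using v carrier_matD[OF dims[of w]] carrier_matD[OF dims[of w']] by (intro eq_vecI) simp_all
  qed
  also have "\<dots> \<longleftrightarrow> (\<forall>i<\<beta>. \<forall>a<k. (\<Sum>m<f. V $$ (v, m) * w m $$ (i, a)) = (\<Sum>m<f. V $$ (v, m) * w' m $$ (i, a)))"
  proof (intro iffI allI impI)
    fix i a assume eq: "\<forall>l<\<beta> * k. candidate_matrix G V \<beta> w $$ (v, l) = candidate_matrix G V \<beta> w' $$ (v, l)"
      and ia: "i < \<beta>" "a < k"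
    have "a + i * k < k + i * k" using ia by simp
    also have "\<dots> = Suc i * k" by simp
    also have "\<dots> \<le> \<beta> * k" using ia by (intro mult_le_mono1) simp
    finally have l: "a + i * k < \<beta> * k" .
    then show "(\<Sum>m<f. V $$ (v, m) * w m $$ (i, a)) = (\<Sum>m<f. V $$ (v, m) * w' m $$ (i, a))"
      using eq[rule_format, OF l] ia unfolding cand_index[OF v l] by simp
  next
    fix l assume eq: "\<forall>i<\<beta>. \<forall>a<k. (\<Sum>m<f. V $$ (v, m) * w m $$ (i, a)) = (\<Sum>m<f. V $$ (v, m) * w' m $$ (i, a))"
      and l: "l < \<beta> * k"
    have "l div k < \<beta>" "l mod k < k" using l k_pos by (simp_all add: less_mult_imp_div_less)
    then show "candidate_matrix G V \<beta> w $$ (v, l) = candidate_matrix G V \<beta> w' $$ (v, l)"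
      unfolding cand_index[OF v l] using eq by simp
  qed
  finally show ?thesis by (simp add: cand_eq_iff)
qed

lemma H_min_eq_1:
  assumes \<mu>: "1 \<le> \<mu>" and rows: "\<forall>v<\<mu>. row V v \<noteq> 0\<^sub>v f"
  shows "H_min G V \<beta> = 1"
proof -
  have H: "prob_space.entropy (measure_pmf (message_pmf f \<beta> k)) q (count_space UNIV)
      (\<lambda>w. candidate_matrix G V \<beta> w $$ (v, 0)) = 1" if v: "v < \<mu>" for v
  proof -
    obtain m0 where m0: "m0 < f" "V $$ (v, m0) \<noteq> 0"
    proof -
      have "\<exists>m<f. row V v $ m \<noteq> 0\<^sub>v f $ m"
      proof (rule ccontr)
        assume "\<not> ?thesis"
        then have "row V v = 0\<^sub>v f" using V by (intro eq_vecI) auto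
        then show False using rows v by simp
      qed
      then show thesis using that V v by auto
    qed
    have indep: "indep_rows (\<lambda>v m. V $$ (v, m)) f {v}"
      unfolding indep_rows_def
    proof
      fix c
      have "(\<Sum>m<f. V $$ (v, m) * (if m = m0 then c v / V $$ (v, m0) else 0)) = c v"
        using m0 by (simp add: if_distrib[where f = "\<lambda>a. _ * a"] cong: if_cong)
      then show "\<exists>x. \<forall>v\<in>{v}. (\<Sum>m<f. V $$ (v, m) * x m) = c v" by (intro exI) auto
    qed
    have l: "0 < \<beta> * k" using \<beta>_pos k_pos by simp
    let ?P = "{..<\<beta>} \<times> {..<k}"
    \<comment> \<open>Only position \<open>(0, 0)\<close> is observed; at all others the empty set
      of rows gives a constant of entropy 0.\<close>
    let ?Y = "\<lambda>p c. \<lambda>v\<in>(if p = (0, 0) then {v} else {}). \<Sum>m<f. V $$ (v, m) * c m"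
    have "prob_space.entropy (measure_pmf (message_pmf f \<beta> k)) q (count_space UNIV)
        (\<lambda>w. candidate_matrix G V \<beta> w $$ (v, 0)) = fent q \<Omega> (\<lambda>w. candidate_matrix G V \<beta> w $$ (v, 0))"
      unfolding message_pmf_def
      by (rule entropy_pmf_of_set[OF q_gt_1 finite_messages messages_nonempty, where S = UNIV]) auto
    also have "\<dots> = fent q \<Omega> (\<lambda>w. \<lambda>p\<in>?P. ?Y p (\<lambda>m\<in>{..<f}. w m $$ p))"
    proof (rule fent_cong)
      fix w w'
      have "(0, 0) \<in> ?P" using \<beta>_pos k_pos by auto
      then have "(\<lambda>p\<in>?P. ?Y p (\<lambda>m\<in>{..<f}. w' m $$ p)) = (\<lambda>p\<in>?P. ?Y p (\<lambda>m\<in>{..<f}. w m $$ p)) \<longleftrightarrow>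
        (\<Sum>m<f. V $$ (v, m) * w' m $$ (0, 0)) = (\<Sum>m<f. V $$ (v, m) * w m $$ (0, 0))"
        unfolding restrict_eq_iff by auto
      then show "candidate_matrix G V \<beta> w' $$ (v, 0) = candidate_matrix G V \<beta> w $$ (v, 0) \<longleftrightarrow>
        (\<lambda>p\<in>?P. ?Y p (\<lambda>m\<in>{..<f}. w' m $$ p)) = (\<lambda>p\<in>?P. ?Y p (\<lambda>m\<in>{..<f}. w m $$ p))"
        unfolding cand_index[OF v l] by simp
    qed
    also have "\<dots> = (\<Sum>p\<in>?P. fent q (symbols f) (?Y p))" by (rule fent_entrywise)
    also have "\<dots> = (\<Sum>p\<in>?P. if p = (0, 0) then 1 else 0)"
    proof (rule sum.cong[OF refl])
      fix p :: "nat \<times> nat"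
      have "fent q (symbols f) (?Y p) = real (card (if p = (0, 0) then {v} else {}))"
        unfolding q_eq by (rule fent_linear) (auto intro: indep_rows_subset[OF indep])
      then show "fent q (symbols f) (?Y p) = (if p = (0, 0) then 1 else 0)" by simp
    qed
    also have "\<dots> = 1" using \<beta>_pos k_pos by (simp add: sum.delta)
    finally show ?thesis .
  qed
  have "(\<lambda>v. prob_space.entropy (measure_pmf (message_pmf (dim_col V) \<beta> (dim_row G))) q
        (count_space UNIV) (\<lambda>w. candidate_matrix G V \<beta> w $$ (v, 0))) ` {..<dim_row V} = {1}"
    using H \<mu> G V by (auto simp: image_iff intro!: exI[of _ 0])
  then show ?thesis unfolding H_min_def q_eq by simp
qed

end

section \<open>Lower bound on the download cost\<close>

lemma finite_carrier_vec: "finite (carrier_vec n :: 'a::finite vec set)"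
proof (rule finite_surj)
  show "finite ({..<n} \<rightarrow>\<^sub>E (UNIV :: 'a set))" by (intro finite_PiE) auto
  show "carrier_vec n \<subseteq> vec n ` ({..<n} \<rightarrow>\<^sub>E (UNIV :: 'a set))"
  proof
    fix x :: "'a vec" assume "x \<in> carrier_vec n"
    then have "x = vec n (restrict (\<lambda>i. x $ i) {..<n})" by (intro eq_vecI) auto
    then show "x \<in> vec n ` ({..<n} \<rightarrow>\<^sub>E UNIV)"
      by (rule image_eqI[where f = "vec n" and x = "restrict (\<lambda>i. x $ i) {..<n}"]) simp
  qed
qed

locale plc_scheme = coded_functions G V k n f \<mu> "block P" "real CARD('q)"
  for G V :: "'q::{field,finite} mat" and k n f \<mu> :: nat and P :: "'q plc_protocol" +
  fixes I :: "nat \<Rightarrow> nat set" and \<kappa> \<nu> :: nat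
  assumes protocol: "plc_protocol_for G V P"
    and \<nu>_pos: "0 < \<nu>" and info: "\<And>u. u < \<nu> \<Longrightarrow> information_set G (I u)"
    and cover: "\<And>j. j < n \<Longrightarrow> card {u. u < \<nu> \<and> j \<in> I u} = \<kappa>"
begin

abbreviation "ans j s w \<equiv> answer P j s (stored j w)"

definition ce :: "nat set \<Rightarrow> nat \<Rightarrow> nat \<Rightarrow> real" where
  "ce T j s = cond T (\<lambda>w. ans j s w)"

lemma dims: "dim_row G = k" "dim_col G = n" "dim_row V = \<mu>" "dim_col V = f"
  using G V by auto

lemma plc_pmf_eq: "plc_pmf G V P v = pair_pmf (pmf_of_set \<Omega>) (query_dist P v)"
  by (simp add: plc_pmf_def message_pmf_def dims)

lemma plc_answer_eq: "plc_answer G V P j (w, Q) = ans j (Q j) w"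
  by (simp add: plc_answer_def dims)

text \<open>Every message tuple occurs with every possible query with positive probability, so zero
  conditional entropy means functional dependence for each fixed query.\<close>

lemma recover:
  assumes v: "v < \<mu>" and Q: "Q \<in> set_pmf (query_dist P v)" and w: "w \<in> \<Omega>" "w' \<in> \<Omega>"
    and eq: "\<And>j. j < n \<Longrightarrow> ans j (Q j) w = ans j (Q j) w'"
  shows "cand {v} w = cand {v} w'"
proof -
  let ?X = "\<lambda>(w, Q :: nat \<Rightarrow> nat). row (candidate_matrix G V (block P) w) v"
  let ?Y = "\<lambda>(w, Q). (map (\<lambda>j. plc_answer G V P j (w, Q)) [0..<n], map Q [0..<n])"
  have X: "?X \<omega> \<in> carrier_vec (block P * k)" for \<omega>
    using G by (auto simp: candidate_matrix_def message_matrix_def split: prod.split intro!: carrier_vecI)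
  have "prob_space.conditional_entropy (measure_pmf (plc_pmf G V P v)) (real CARD('q))
      (count_space (carrier_vec (block P * k))) (count_space UNIV) ?X ?Y = 0"
    using protocol v unfolding plc_protocol_for_def plc_recoverable_def dims by blast
  then have "\<forall>\<omega>\<in>set_pmf (plc_pmf G V P v). \<forall>\<omega>'\<in>set_pmf (plc_pmf G V P v). ?Y \<omega> = ?Y \<omega>' \<longrightarrow> ?X \<omega> = ?X \<omega>'"
    by (subst (asm) conditional_entropy_eq_0_iff_determined[OF q_gt_1 _ X])
      (simp add: finite_carrier_vec)
  moreover have "(w, Q) \<in> set_pmf (plc_pmf G V P v)" "(w', Q) \<in> set_pmf (plc_pmf G V P v)"
    using w Q by (simp_all add: plc_pmf_eq set_pmf_of_set[OF messages_nonempty finite_messages])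
  moreover have "?Y (w, Q) = ?Y (w', Q)" using eq by (simp add: plc_answer_eq)
  ultimately have "?X (w, Q) = ?X (w', Q)" by blast
  then show ?thesis using row_cand_eq_iff[OF v] by simp
qed

lemma cond_mono:
  assumes "\<And>w w'. w \<in> \<Omega> \<Longrightarrow> w' \<in> \<Omega> \<Longrightarrow> A w' = A w \<Longrightarrow> B w' = B w"
  shows "cond T B \<le> cond T A"
proof -
  have "fent (real CARD('q)) \<Omega> (\<lambda>w. (B w, cand T w)) \<le> fent (real CARD('q)) \<Omega> (\<lambda>w. (A w, cand T w))"
  proof (rule fent_mono[OF finite_messages q_gt_1])
    fix w w' assume w: "w \<in> \<Omega>" "w' \<in> \<Omega>" and eq: "(A w', cand T w') = (A w, cand T w)"
    have "B w' = B w" by (rule assms[OF w]) (use eq in blast)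
    then show "(B w', cand T w') = (B w, cand T w)" using eq by blast
  qed
  then show ?thesis by (simp add: cond_def)
qed

text \<open>By subadditivity the right-hand side bounds the joint conditional entropy of the
  answers. Decoding function \<open>v\<close> splits off \<open>L\<close> from it, as row
  \<open>v\<close> is independent of \<open>T\<close>. The rest is at least the sum over any one
  information set; adding this over the \<nu> sets counts each database \<kappa> times.\<close>

lemma cond_step:
  assumes T: "finite T" "v \<notin> T" "indep_rows (\<lambda>v m. V $$ (v, m)) f (insert v T)"
    and v: "v < \<mu>" and Q: "Q \<in> set_pmf (query_dist P v)"
  shows "real (block P * k) + real \<kappa> / real \<nu> * (\<Sum>j<n. ce (insert v T) j (Q j)) \<le> (\<Sum>j<n. ce T j (Q j))"
proof -
  define A where "A = (\<lambda>w. \<lambda>j\<in>{..<n}. ans j (Q j) w)"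
  have A_eq: "A w' = A w \<longleftrightarrow> (\<forall>j<n. ans j (Q j) w' = ans j (Q j) w)" for w w'
    unfolding A_def restrict_eq_iff by auto
  have "fent (real CARD('q)) \<Omega> (\<lambda>w. (A w, cand T w)) = fent (real CARD('q)) \<Omega> (\<lambda>w. (A w, cand (insert v T) w))"
  proof (rule fent_cong)
    fix w w' assume w: "w \<in> \<Omega>" "w' \<in> \<Omega>"
    have "cand {v} w' = cand {v} w" if "A w' = A w"
      by (rule recover[OF v Q w(2,1)]) (use that A_eq in blast)
    moreover have "cand (insert v T) w' = cand (insert v T) w \<longleftrightarrow> cand {v} w' = cand {v} w \<and> cand T w' = cand T w"
      unfolding cand_eq_iff by simp
    ultimately show "(A w', cand T w') = (A w, cand T w) \<longleftrightarrow>
        (A w', cand (insert v T) w') = (A w, cand (insert v T) w)" by auto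
  qed
  moreover have "fent (real CARD('q)) \<Omega> (cand (insert v T)) = fent (real CARD('q)) \<Omega> (cand T) + real (block P * k)"
  proof -
    have "indep_rows (\<lambda>v m. V $$ (v, m)) f T" by (rule indep_rows_subset[OF T(3)]) auto
    from fent_cand[OF T(1) this] fent_cand[OF _ T(3)] T(1,2) show ?thesis
      by (simp add: algebra_simps)
  qed
  ultimately have step: "cond T A = cond (insert v T) A + real (block P * k)" by (simp add: cond_def)
  have up: "cond T A \<le> (\<Sum>j<n. ce T j (Q j))"
    unfolding cond_def A_def ce_def by (rule fent_subadditive[OF finite_messages q_gt_1]) simp
  have low: "(\<Sum>j\<in>I u. ce (insert v T) j (Q j)) \<le> cond (insert v T) A" if u: "u < \<nu>" for u
  proof -
    have sub: "I u \<subseteq> {..<n}" using info[OF u] by (simp add: information_set_def dims)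
    have "(\<Sum>j\<in>I u. ce (insert v T) j (Q j)) = cond (insert v T) (\<lambda>w. \<lambda>j\<in>I u. ans j (Q j) w)"
      unfolding ce_def by (rule cond_information_set[OF info[OF u], symmetric])
    also have "\<dots> \<le> cond (insert v T) A"
      by (rule cond_mono) (use sub in \<open>auto simp: A_eq restrict_eq_iff\<close>)
    finally show ?thesis .
  qed
  have "real \<kappa> * (\<Sum>j<n. ce (insert v T) j (Q j)) = (\<Sum>j<n. \<Sum>u<\<nu>. if j \<in> I u then ce (insert v T) j (Q j) else 0)"
    unfolding sum_distrib_left
  proof (rule sum.cong[OF refl])
    fix j assume "j \<in> {..<n}"
    then have "card {u \<in> {..<\<nu>}. j \<in> I u} = \<kappa>" using cover[of j] by simp
    then show "real \<kappa> * ce (insert v T) j (Q j) = (\<Sum>u<\<nu>. if j \<in> I u then ce (insert v T) j (Q j) else 0)"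
      by (simp add: sum.inter_filter[symmetric])
  qed
  also have "\<dots> = (\<Sum>u<\<nu>. \<Sum>j<n. if j \<in> I u then ce (insert v T) j (Q j) else 0)" by (rule sum.swap)
  also have "\<dots> = (\<Sum>u<\<nu>. \<Sum>j\<in>I u. ce (insert v T) j (Q j))"
  proof (rule sum.cong[OF refl])
    fix u assume "u \<in> {..<\<nu>}"
    then have "I u \<subseteq> {..<n}" using info[of u] by (simp add: information_set_def dims)
    then have "{j \<in> {..<n}. j \<in> I u} = I u" by blast
    then show "(\<Sum>j<n. if j \<in> I u then ce (insert v T) j (Q j) else 0) = (\<Sum>j\<in>I u. ce (insert v T) j (Q j))"
      by (simp add: sum.inter_filter[symmetric])
  qed
  also have "\<dots> \<le> (\<Sum>u<\<nu>. cond (insert v T) A)" by (rule sum_mono) (simp add: low)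
  finally have "real \<kappa> * (\<Sum>j<n. ce (insert v T) j (Q j)) \<le> real \<nu> * cond (insert v T) A" by simp
  then have "real \<kappa> / real \<nu> * (\<Sum>j<n. ce (insert v T) j (Q j)) \<le> cond (insert v T) A"
    using \<nu>_pos by (simp add: field_simps)
  then show ?thesis using step up by simp
qed

lemma ce_bounds: "\<bar>ce T j s\<bar> \<le> log (real CARD('q)) (real (card \<Omega>))"
proof -
  let ?H = "\<lambda>Y. fent (real CARD('q)) \<Omega> Y"
  have "0 \<le> ?H (cand T)" "?H (cand T) \<le> log (real CARD('q)) (real (card \<Omega>))"
    by (rule fent_nonneg[OF finite_messages q_gt_1], rule fent_le[OF finite_messages q_gt_1 messages_nonempty])
  moreover have "0 \<le> ?H (\<lambda>w. (ans j s w, cand T w))"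
    "?H (\<lambda>w. (ans j s w, cand T w)) \<le> log (real CARD('q)) (real (card \<Omega>))"
    by (rule fent_nonneg[OF finite_messages q_gt_1], rule fent_le[OF finite_messages q_gt_1 messages_nonempty])
  ultimately show ?thesis unfolding ce_def cond_def by linarith
qed

lemma ce_nonneg: "0 \<le> ce T j s"
  unfolding ce_def cond_def using fent_mono[OF finite_messages q_gt_1, where Y = "\<lambda>w. (ans j s w, cand T w)" and Y' = "cand T"]
  by simp

definition avg :: "nat set \<Rightarrow> nat \<Rightarrow> real" where
  "avg T v = (\<Sum>j<n. measure_pmf.expectation (query_dist P v) (\<lambda>Q. ce T j (Q j)))"

lemma integrable_ce: "integrable (measure_pmf (query_dist P v)) (\<lambda>Q. ce T j (Q j))"
  by (rule measure_pmf.integrable_const_bound[where B = "log (real CARD('q)) (real (card \<Omega>))"])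
    (simp_all add: ce_bounds)

lemma avg_eq: "avg T v = measure_pmf.expectation (query_dist P v) (\<lambda>Q. \<Sum>j<n. ce T j (Q j))"
  unfolding avg_def by (rule Bochner_Integration.integral_sum[symmetric]) (rule integrable_ce)

text \<open>\<open>ce T j\<close> depends on the query to database \<open>j\<close> alone, and
  privacy fixes the law of this single query; the joint law of the queries may change with the
  desired index.\<close>

lemma avg_private:
  assumes "v < \<mu>" "v' < \<mu>"
  shows "avg T v = avg T v'"
proof (cases "v = v'")
  case False
  have "measure_pmf.expectation (query_dist P v) (\<lambda>Q. ce T j (Q j))
      = measure_pmf.expectation (query_dist P v') (\<lambda>Q. ce T j (Q j))" if j: "j < n" for j
  proof -
    let ?g = "\<lambda>(w, Q). (Q j, plc_answer G V P j (w, Q), candidate_matrix G V (block P) w)"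
    have "map_pmf ?g (plc_pmf G V P v) = map_pmf ?g (plc_pmf G V P v')"
      using protocol assms False j unfolding plc_protocol_for_def plc_private_def dims by blast
    then have "map_pmf fst (map_pmf ?g (plc_pmf G V P v)) = map_pmf fst (map_pmf ?g (plc_pmf G V P v'))"
      by simp
    moreover have "map_pmf fst (map_pmf ?g (plc_pmf G V P u)) = map_pmf (\<lambda>Q. Q j) (query_dist P u)" for u
    proof -
      have "map_pmf fst (map_pmf ?g (plc_pmf G V P u)) = map_pmf (\<lambda>\<omega>. snd \<omega> j) (plc_pmf G V P u)"
        by (simp add: pmf.map_comp comp_def case_prod_unfold)
      also have "\<dots> = map_pmf (\<lambda>Q. Q j) (map_pmf snd (plc_pmf G V P u))"
        by (simp add: pmf.map_comp comp_def)
      finally show ?thesis by (simp add: plc_pmf_eq map_snd_pair_pmf)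
    qed
    ultimately have eq: "map_pmf (\<lambda>Q. Q j) (query_dist P v) = map_pmf (\<lambda>Q. Q j) (query_dist P v')" by simp
    have E: "measure_pmf.expectation (query_dist P u) (\<lambda>Q. ce T j (Q j))
        = measure_pmf.expectation (map_pmf (\<lambda>Q. Q j) (query_dist P u)) (ce T j)" for u
      by simp
    show ?thesis unfolding E[of v] E[of v'] eq ..
  qed
  then show ?thesis unfolding avg_def by (intro sum.cong[OF refl]) (simp only: lessThan_iff)
qed simp

lemma avg_step:
  assumes T: "finite T" "v \<notin> T" "indep_rows (\<lambda>v m. V $$ (v, m)) f (insert v T)" and v: "v < \<mu>"
  shows "real (block P * k) + real \<kappa> / real \<nu> * avg (insert v T) v \<le> avg T v"
proof -
  have int: "integrable (measure_pmf (query_dist P v)) (\<lambda>Q. \<Sum>j<n. ce S j (Q j))" for S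
    by (rule Bochner_Integration.integrable_sum) (rule integrable_ce)
  have "measure_pmf.expectation (query_dist P v)
      (\<lambda>Q. real (block P * k) + real \<kappa> / real \<nu> * (\<Sum>j<n. ce (insert v T) j (Q j)))
    \<le> measure_pmf.expectation (query_dist P v) (\<lambda>Q. \<Sum>j<n. ce T j (Q j))"
    by (rule integral_mono_AE)
      (use int cond_step[OF T v] in \<open>auto simp: AE_measure_pmf_iff\<close>)
  moreover have "measure_pmf.expectation (query_dist P v)
      (\<lambda>Q. real (block P * k) + real \<kappa> / real \<nu> * (\<Sum>j<n. ce (insert v T) j (Q j)))
    = real (block P * k) + real \<kappa> / real \<nu> * avg (insert v T) v"
    using int unfolding avg_eq by (subst Bochner_Integration.integral_add) auto
  ultimately show ?thesis unfolding avg_eq[of T] by simp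
qed

text \<open>Induction on the rows of \<open>R\<close> not yet conditioned on. Privacy replaces
  \<open>v\<close> by a new row \<open>v'\<close>, a step adds \<open>L\<close> and scales the
  remainder by \<kappa> / \<nu>, and privacy returns to \<open>v\<close>; this builds the geometric
  sum.\<close>

lemma avg_lower_bound:
  assumes R: "finite R" "R \<subseteq> {..<\<mu>}" "indep_rows (\<lambda>v m. V $$ (v, m)) f R"
    and v: "v < \<mu>" and T: "T \<subseteq> R" "card (R - T) = d"
  shows "real (block P * k) * (\<Sum>i<d. (real \<kappa> / real \<nu>) ^ i) \<le> avg T v"
  using T
proof (induction d arbitrary: T)
  case 0
  have "0 \<le> avg T v" unfolding avg_def
    by (intro sum_nonneg integral_nonneg_AE) (simp add: ce_nonneg)
  then show ?case by simp
next
  case (Suc d)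
  then have "R - T \<noteq> {}" by auto
  then obtain v' where v': "v' \<in> R" "v' \<notin> T" by auto
  have fT: "finite T" using Suc.prems(1) R(1) finite_subset by blast
  have sub: "insert v' T \<subseteq> R" using v' Suc.prems by auto
  have "R - insert v' T = (R - T) - {v'}" by auto
  then have "card (R - insert v' T) = d" using Suc.prems(2) v' R(1) by (simp add: card_Diff_singleton)
  from Suc.IH[OF sub this]
  have IH: "real (block P * k) * (\<Sum>i<d. (real \<kappa> / real \<nu>) ^ i) \<le> avg (insert v' T) v" .
  have v'\<mu>: "v' < \<mu>" using v'(1) R(2) by auto
  have "real (block P * k) * (\<Sum>i<Suc d. (real \<kappa> / real \<nu>) ^ i)
      = real (block P * k) + real \<kappa> / real \<nu> * (real (block P * k) * (\<Sum>i<d. (real \<kappa> / real \<nu>) ^ i))"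
    by (subst sum.lessThan_Suc_shift) (simp add: sum_distrib_left algebra_simps)
  also have "\<dots> \<le> real (block P * k) + real \<kappa> / real \<nu> * avg (insert v' T) v"
    using IH by (intro add_left_mono mult_left_mono) auto
  also have "\<dots> = real (block P * k) + real \<kappa> / real \<nu> * avg (insert v' T) v'"
    using avg_private[OF v v'\<mu>] by simp
  also have "\<dots> \<le> avg T v'"
    by (rule avg_step[OF fT v'(2) indep_rows_subset[OF R(3) sub] v'\<mu>])
  also have "\<dots> = avg T v" by (rule avg_private[OF v'\<mu> v])
  finally show ?case .
qed

text \<open>The law of an answer is the mixture, over the query, of its laws for fixed queries, and
  an entropy of a mixture is at least the mean entropy. With empty \<open>T\<close> nothing is
  conditioned on.\<close>

lemma download_cost_ge_avg:
  assumes v: "v < \<mu>"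
  shows "avg {} v \<le> download_cost G V P v"
  unfolding avg_def download_cost_def dims
proof (rule sum_mono)
  fix j assume "j \<in> {..<n}"
  then have j: "j < n" by simp
  let ?p = "map_pmf (plc_answer G V P j) (plc_pmf G V P v)"
  interpret information_space "measure_pmf (plc_pmf G V P v)" "real CARD('q)"
    by (rule information_space_pmf[OF q_gt_1])
  have ce: "ce {} j s = fent (real CARD('q)) \<Omega> (\<lambda>w. ans j s w)" for s
  proof -
    have "fent (real CARD('q)) \<Omega> (cand {}) = fent (real CARD('q)) \<Omega> (\<lambda>_. ())"
      by (rule fent_cong) (simp add: cand_eq_iff)
    moreover have "fent (real CARD('q)) \<Omega> (\<lambda>w. (ans j s w, cand {} w)) = fent (real CARD('q)) \<Omega> (\<lambda>w. ans j s w)"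
      by (rule fent_cong) (simp add: cand_eq_iff)
    ultimately show ?thesis unfolding ce_def cond_def by (simp add: fent_const[OF finite_messages])
  qed
  have fin: "finite_entropy (count_space UNIV) (plc_answer G V P j) (pmf ?p)"
    using protocol v j unfolding plc_protocol_for_def finite_download_def dims by blast
  have p: "?p = bind_pmf (query_dist P v) (\<lambda>Q. map_pmf (\<lambda>w. ans j (Q j) w) (pmf_of_set \<Omega>))"
  proof -
    have "?p = bind_pmf (pmf_of_set \<Omega>) (\<lambda>w. bind_pmf (query_dist P v) (\<lambda>Q. return_pmf (ans j (Q j) w)))"
      by (simp add: plc_pmf_eq pair_pmf_def map_bind_pmf bind_return_pmf plc_answer_eq)
    also have "\<dots> = bind_pmf (query_dist P v) (\<lambda>Q. bind_pmf (pmf_of_set \<Omega>) (\<lambda>w. return_pmf (ans j (Q j) w)))"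
      by (rule bind_commute_pmf)
    finally show ?thesis by (simp add: map_pmf_def)
  qed
  have "measure_pmf.expectation (query_dist P v) (\<lambda>Q. ce {} j (Q j))
      \<le> (\<integral>x. - pmf ?p x * log (real CARD('q)) (pmf ?p x) \<partial>count_space UNIV)"
    unfolding ce
    by (rule expectation_fent_le[OF q_gt_1 finite_messages messages_nonempty p finite_entropy_integrable[OF fin]])
  also have "\<dots> = prob_space.entropy (measure_pmf (plc_pmf G V P v)) (real CARD('q)) (count_space UNIV) (plc_answer G V P j)"
    by (rule entropy_pmf[OF q_gt_1, symmetric])
  finally show "measure_pmf.expectation (query_dist P v) (\<lambda>Q. ce {} j (Q j))
      \<le> prob_space.entropy (measure_pmf (plc_pmf G V P v)) (real CARD('q)) (count_space UNIV) (plc_answer G V P j)" .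
qed

lemma download_cost_lower_bound:
  assumes v: "v < \<mu>"
  shows "real (block P * k) * (\<Sum>i<vec_space.rank \<mu> V. (real \<kappa> / real \<nu>) ^ i) \<le> download_cost G V P v"
proof -
  obtain R where R: "R \<subseteq> {..<\<mu>}" "card R = vec_space.rank \<mu> V" "indep_rows (\<lambda>v m. V $$ (v, m)) f R"
    by (rule rank_rows[OF V])
  have "finite R" using R(1) finite_subset by blast
  from avg_lower_bound[OF this R(1,3) v, of "{}"] R(2)
  have "real (block P * k) * (\<Sum>i<vec_space.rank \<mu> V. (real \<kappa> / real \<nu>) ^ i) \<le> avg {} v" by simp
  also have "\<dots> \<le> download_cost G V P v" by (rule download_cost_ge_avg[OF v])
  finally show ?thesis .
qed

end

section \<open>The capacity-achieving protocol\<close>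

lemma wedge_answer_diff:
  "wedge_answer r \<beta> N (\<lambda>t i. x t i - y t i) l = wedge_answer r \<beta> N x l - wedge_answer r \<beta> N y l"
proof -
  obtain T u w where l: "l = (T, u, w)" by (cases l)
  show ?thesis
    by (simp add: l wedge_answer_def wedge_def left_diff_distrib right_diff_distrib sum_subtractf)
qed

lemma wedge_answer_cong:
  assumes "\<And>t i. t < r \<Longrightarrow> i < \<beta> \<Longrightarrow> x t i = y t i"
  shows "wedge_answer r \<beta> N x l = wedge_answer r \<beta> N y l"
proof -
  obtain T u w where l: "l = (T, u, w)" by (cases l)
  have "(\<lambda>S. \<Sum>i<\<beta>. x t i * N i (S, u, w)) = (\<lambda>S. \<Sum>i<\<beta>. y t i * N i (S, u, w))" if "t < r" for t
    by (rule ext, rule sum.cong[OF refl]) (simp add: assms[OF that])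
  then show ?thesis unfolding l wedge_answer_def prod.case by (intro sum.cong[OF refl]) simp
qed

text \<open>\<open>R\<close> holds the basis functions, \<open>c v\<close> the coordinates of
  function \<open>v\<close> in them, and \<open>h v\<close>, \<open>h' v\<close> the change of basis
  that makes function \<open>v\<close> the one with index 0. The block length is the number of row
  labels.\<close>

locale koszul_scheme =
  information_cover n k \<kappa> \<delta> "\<lambda>a j. G $$ (a, j)" I +
  coded_functions G V k n f \<mu> "(\<kappa> + \<delta>) ^ r" "real CARD('q)"
  for G V :: "'q::{field,finite} mat" and n k \<kappa> \<delta> f \<mu> r :: nat and I :: "nat \<Rightarrow> nat set" +
  fixes R :: "nat \<Rightarrow> nat \<Rightarrow> 'q" and c :: "nat \<Rightarrow> nat \<Rightarrow> 'q" and h h' :: "nat \<Rightarrow> nat \<Rightarrow> nat \<Rightarrow> 'q"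
  assumes r_pos: "0 < r" and n_pos: "0 < n"
    and V_eq: "\<And>v m. v < \<mu> \<Longrightarrow> m < f \<Longrightarrow> V $$ (v, m) = (\<Sum>t<r. c v t * R t m)"
    and h'_support: "\<And>v. v < \<mu> \<Longrightarrow> \<forall>s<r. \<forall>t. h' v s t \<noteq> 0 \<longrightarrow> t < r"
    and h'_h: "\<And>v. v < \<mu> \<Longrightarrow> \<forall>s<r. \<forall>t. (\<Sum>u<r. h' v s u * h v u t) = bvec s t"
    and h_0: "\<And>v. v < \<mu> \<Longrightarrow> \<forall>t. h v t 0 = c v t"
begin

abbreviation "\<beta> \<equiv> (\<kappa> + \<delta>) ^ r"

definition coeffs :: "(nat \<Rightarrow> nat \<times> label \<Rightarrow> 'q) set" where
  "coeffs = inj_coeffs \<beta> (row_labels r \<kappa> \<delta>)"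

definition queries :: "(nat \<Rightarrow> label \<Rightarrow> 'q) set" where
  "queries = inj_coeffs \<beta> (labels r \<kappa> \<delta>)"

definition answers :: "(label \<Rightarrow> 'q) set" where
  "answers = {A. \<forall>l. (l \<in> answer_labels r \<kappa> \<delta> \<longrightarrow> A l \<in> UNIV) \<and> (l \<notin> answer_labels r \<kappa> \<delta> \<longrightarrow> A l = 0)}"

definition "enc_query = to_nat_on queries"

definition "enc_answer = to_nat_on answers"

definition answer_of :: "(nat \<Rightarrow> label \<Rightarrow> 'q) \<Rightarrow> (nat \<Rightarrow> 'q vec) \<Rightarrow> label \<Rightarrow> 'q" where
  "answer_of N C l = (if l \<in> answer_labels r \<kappa> \<delta>
     then wedge_answer r \<beta> N (\<lambda>t i. \<Sum>m<f. R t m * C m $ i) l else 0)"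

definition scheme :: "'q plc_protocol" where
  "scheme = \<lparr>block = \<beta>,
     query_dist = (\<lambda>v. map_pmf (\<lambda>M j. enc_query (query r \<beta> (h' v) M j)) (pmf_of_set coeffs)),
     answer = (\<lambda>j s C. enc_answer (answer_of (inv_into queries enc_query s) C))\<rparr>"

lemma scheme_sel [simp]:
  "block scheme = \<beta>"
  "query_dist scheme v = map_pmf (\<lambda>M j. enc_query (query r \<beta> (h' v) M j)) (pmf_of_set coeffs)"
  "answer scheme j s C = enc_answer (answer_of (inv_into queries enc_query s) C)"
  by (simp_all add: scheme_def)

lemma finite_coeffs: "finite coeffs"
  unfolding coeffs_def by (rule finite_inj_coeffs[OF finite_row_labels])

lemma coeffs_nonempty: "coeffs \<noteq> {}"
  unfolding coeffs_def by (rule inj_coeffs_nonempty[OF finite_row_labels]) (simp add: card_row_labels[OF r_pos])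

lemma finite_queries: "finite queries"
  unfolding queries_def by (rule finite_inj_coeffs[OF finite_labels])

lemma finite_answers: "finite answers"
  unfolding answers_def by (rule finite_set_of_finite_funs[OF finite_answer_labels]) simp

lemma answers_eq_0: "A \<in> answers \<Longrightarrow> l \<notin> answer_labels r \<kappa> \<delta> \<Longrightarrow> A l = 0"
  unfolding answers_def by blast

lemma card_answers: "card answers = CARD('q) ^ card (answer_labels r \<kappa> \<delta>)"
proof -
  let ?L = "answer_labels r \<kappa> \<delta>"
  have "bij_betw (\<lambda>A. restrict A ?L) answers (?L \<rightarrow>\<^sub>E UNIV)"
  proof (rule bij_betw_byWitness[where f' = "\<lambda>B l. if l \<in> ?L then B l else 0"])
    show "\<forall>A\<in>answers. (\<lambda>l. if l \<in> ?L then restrict A ?L l else 0) = A"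
      by (intro ballI ext) (simp add: answers_eq_0)
    show "\<forall>B\<in>?L \<rightarrow>\<^sub>E (UNIV :: 'q set). restrict (\<lambda>l. if l \<in> ?L then B l else 0) ?L = B"
    proof (intro ballI ext)
      fix B l assume B: "B \<in> ?L \<rightarrow>\<^sub>E (UNIV :: 'q set)"
      show "restrict (\<lambda>l. if l \<in> ?L then B l else 0) ?L l = B l"
        using PiE_arb[OF B, of l] by simp
    qed
    show "(\<lambda>A. restrict A ?L) ` answers \<subseteq> ?L \<rightarrow>\<^sub>E UNIV" by (intro image_subsetI) simp
    show "(\<lambda>B l. if l \<in> ?L then B l else 0) ` (?L \<rightarrow>\<^sub>E UNIV) \<subseteq> answers"
      unfolding answers_def by (intro image_subsetI CollectI allI) simp
  qed
  from bij_betw_same_card[OF this] show ?thesis by (simp add: card_PiE finite_answer_labels)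
qed

lemma inj_enc_query: "inj_on enc_query queries"
  unfolding enc_query_def by (rule inj_on_to_nat_on[OF countable_finite[OF finite_queries]])

lemma inj_enc_answer: "inj_on enc_answer answers"
  unfolding enc_answer_def by (rule inj_on_to_nat_on[OF countable_finite[OF finite_answers]])

lemma answer_of_in: "answer_of N C \<in> answers"
  unfolding answers_def by (intro CollectI allI) (simp add: answer_of_def)

lemma bij_betw_query:
  assumes "v < \<mu>" "j < n"
  shows "bij_betw (\<lambda>M. query r \<beta> (h' v) M j) coeffs queries"
proof -
  have "bij_betw (ext_coeffs (h' v) r \<circ> relabel \<beta> (labels r \<kappa> \<delta>) (row_of (\<sigma> j) (\<tau> j))) coeffs queries"
    unfolding coeffs_def queries_def
    by (rule bij_betw_trans[OF bij_betw_relabel[OF bij_betw_row[OF assms(2) r_pos]]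
        bij_betw_ext_coeffs[OF h'_support[OF assms(1)] h'_h[OF assms(1)]]])
  moreover have "ext_coeffs (h' v) r \<circ> relabel \<beta> (labels r \<kappa> \<delta>) (row_of (\<sigma> j) (\<tau> j))
      = (\<lambda>M. query r \<beta> (h' v) M j)"
    by (simp add: fun_eq_iff query_def)
  ultimately show ?thesis by simp
qed

text \<open>The bijection carries the uniform law on \<open>coeffs\<close> to the uniform law on
  \<open>queries\<close>, in which neither \<open>v\<close> nor \<open>j\<close> occurs any
  more.\<close>

lemma query_marginal:
  assumes "v < \<mu>" "j < n"
  shows "map_pmf (\<lambda>Q. Q j) (query_dist scheme v) = map_pmf enc_query (pmf_of_set queries)"
proof -
  have "map_pmf (\<lambda>Q. Q j) (query_dist scheme v)
      = map_pmf enc_query (map_pmf (\<lambda>M. query r \<beta> (h' v) M j) (pmf_of_set coeffs))"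
    by (simp add: pmf.map_comp comp_def)
  also have "map_pmf (\<lambda>M. query r \<beta> (h' v) M j) (pmf_of_set coeffs) = pmf_of_set queries"
    by (rule map_pmf_of_set_bij_betw[OF bij_betw_query[OF assms] coeffs_nonempty finite_coeffs])
  finally show ?thesis .
qed

lemma dims: "dim_row G = k" "dim_col G = n" "dim_row V = \<mu>" "dim_col V = f"
  using G V by auto

text \<open>Messages and queries are independent, so the joint law of query, answer and candidate
  values depends on the desired index only through the law of the single query.\<close>

lemma scheme_private: "plc_private G V scheme"
  unfolding plc_private_def dims
proof (intro allI impI)
  fix v v' j assume v: "v < \<mu>" "v' < \<mu>" and j: "j < n"
  let ?F = "\<lambda>(w, s). (s, answer scheme j s (database_content G f j w), candidate_matrix G V \<beta> w)"
  have law: "map_pmf (\<lambda>(w, Q). (Q j, plc_answer G V scheme j (w, Q), candidate_matrix G V (block scheme) w)) (plc_pmf G V scheme u)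
      = map_pmf ?F (pair_pmf (message_pmf f \<beta> k) (map_pmf (\<lambda>Q. Q j) (query_dist scheme u)))" for u
    unfolding plc_pmf_def dims pair_map_pmf2 pmf.map_comp
    by (rule arg_cong2[where f = map_pmf]) (auto simp: plc_answer_def dims fun_eq_iff)
  show "map_pmf (\<lambda>(w, Q). (Q j, plc_answer G V scheme j (w, Q), candidate_matrix G V (block scheme) w)) (plc_pmf G V scheme v)
      = map_pmf (\<lambda>(w, Q). (Q j, plc_answer G V scheme j (w, Q), candidate_matrix G V (block scheme) w)) (plc_pmf G V scheme v')"
    unfolding law query_marginal[OF v(1) j] query_marginal[OF v(2) j] ..
qed

definition basis_term :: "(nat \<Rightarrow> 'q mat) \<Rightarrow> nat \<Rightarrow> nat \<Rightarrow> nat \<Rightarrow> 'q" where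
  "basis_term w t i a = (\<Sum>m<f. R t m * w m $$ (i, a))"

lemma coded_basis_term:
  assumes w: "w \<in> messages f \<beta> k" and j: "j < n" and i: "i < \<beta>"
  shows "coded (basis_term w) j t i = (\<Sum>m<f. R t m * database_content G f j w m $ i)"
proof -
  have "(\<Sum>m<f. R t m * database_content G f j w m $ i) = (\<Sum>m<f. \<Sum>a<k. R t m * w m $$ (i, a) * G $$ (a, j))"
    by (rule sum.cong[OF refl])
      (simp add: database_content_index[where w = w, OF G message_carrier[OF w] _ j i] sum_distrib_left mult.assoc)
  also have "\<dots> = coded (basis_term w) j t i"
    unfolding coded_def basis_term_def by (subst sum.swap) (simp add: sum_distrib_right)
  finally show ?thesis by simp
qed

lemma candidate_in_basis:
  assumes "v < \<mu>"
  shows "(\<Sum>m<f. V $$ (v, m) * w m $$ p) = (\<Sum>t<r. c v t * (\<Sum>m<f. R t m * w m $$ p))"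
proof -
  have "(\<Sum>m<f. V $$ (v, m) * w m $$ p) = (\<Sum>m<f. \<Sum>t<r. c v t * (R t m * w m $$ p))"
    by (rule sum.cong[OF refl]) (simp add: V_eq[OF assms] sum_distrib_right mult.assoc)
  also have "\<dots> = (\<Sum>t<r. c v t * (\<Sum>m<f. R t m * w m $$ p))"
    by (subst sum.swap) (simp add: sum_distrib_left)
  finally show ?thesis .
qed

text \<open>Answers are linear in the contents, so the difference of two message tuples with equal
  answers has zero answers, and \<open>desired_function_determined\<close> applies to it.\<close>

lemma scheme_decodes:
  assumes v: "v < \<mu>" and M: "M \<in> coeffs" and w: "w \<in> messages f \<beta> k" "w' \<in> messages f \<beta> k"
    and ans: "\<And>j. j < n \<Longrightarrow> answer_of (query r \<beta> (h' v) M j) (database_content G f j w)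
      = answer_of (query r \<beta> (h' v) M j) (database_content G f j w')"
  shows "cand {v} w = cand {v} w'"
proof -
  let ?\<xi> = "\<lambda>t i a. basis_term w t i a - basis_term w' t i a"
  have zero: "wedge_answer r \<beta> (query r \<beta> (h' v) M j) (coded ?\<xi> j) l = 0"
    if j: "j < n" and l: "l \<in> answer_labels r \<kappa> \<delta>" for j l
  proof -
    let ?x = "\<lambda>w t i. \<Sum>m<f. R t m * database_content G f j w m $ i"
    have "wedge_answer r \<beta> (query r \<beta> (h' v) M j) (coded ?\<xi> j) l
        = wedge_answer r \<beta> (query r \<beta> (h' v) M j) (\<lambda>t i. ?x w t i - ?x w' t i) l"
    proof (rule wedge_answer_cong)
      fix t i assume i: "i < \<beta>"
      have "coded ?\<xi> j t i = coded (basis_term w) j t i - coded (basis_term w') j t i"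
        by (simp add: coded_def left_diff_distrib sum_subtractf)
      then show "coded ?\<xi> j t i = ?x w t i - ?x w' t i"
        by (simp only: coded_basis_term[OF w(1) j i] coded_basis_term[OF w(2) j i])
    qed
    also have "\<dots> = 0"
      using fun_cong[OF ans[OF j], of l] l by (simp add: wedge_answer_diff answer_of_def)
    finally show ?thesis .
  qed
  show ?thesis unfolding cand_eq_iff
  proof (intro ballI allI impI)
    fix v' i a assume "v' \<in> {v}" and i: "i < \<beta>" and a: "a < k"
    then have v': "v' = v" by simp
    have "(\<Sum>t<r. h v t 0 * ?\<xi> t i a) = 0"
      by (rule desired_function_determined[OF h'_support[OF v] h'_h[OF v] M[unfolded coeffs_def] _ i a]) (rule zero)
    then show "(\<Sum>m<f. V $$ (v', m) * w m $$ (i, a)) = (\<Sum>m<f. V $$ (v', m) * w' m $$ (i, a))"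
      unfolding v' candidate_in_basis[OF v] basis_term_def[symmetric]
      using h_0[OF v] by (simp add: right_diff_distrib sum_subtractf)
  qed
qed

lemma scheme_recoverable: "plc_recoverable G V scheme"
  unfolding plc_recoverable_def dims scheme_sel(1)
proof (intro allI impI)
  fix v assume v: "v < \<mu>"
  let ?X = "\<lambda>(w, Q :: nat \<Rightarrow> nat). row (candidate_matrix G V \<beta> w) v"
  let ?Y = "\<lambda>(w, Q). (map (\<lambda>j. plc_answer G V scheme j (w, Q)) [0..<n], map Q [0..<n])"
  have X: "?X \<omega> \<in> carrier_vec (\<beta> * k)" for \<omega>
    using G by (auto simp: candidate_matrix_def message_matrix_def split: prod.split intro!: carrier_vecI)
  have "\<forall>\<omega>\<in>set_pmf (plc_pmf G V scheme v). \<forall>\<omega>'\<in>set_pmf (plc_pmf G V scheme v). ?Y \<omega> = ?Y \<omega>' \<longrightarrow> ?X \<omega> = ?X \<omega>'"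
  proof (intro ballI impI)
    fix \<omega> \<omega>' assume \<omega>: "\<omega> \<in> set_pmf (plc_pmf G V scheme v)" "\<omega>' \<in> set_pmf (plc_pmf G V scheme v)" and eq: "?Y \<omega> = ?Y \<omega>'"
    have supp: "set_pmf (plc_pmf G V scheme v) = messages f \<beta> k \<times> (\<lambda>M j. enc_query (query r \<beta> (h' v) M j)) ` coeffs"
      unfolding plc_pmf_def message_pmf_def dims set_pair_pmf scheme_sel
      by (simp add: set_pmf_of_set[OF messages_nonempty finite_messages] set_pmf_of_set[OF coeffs_nonempty finite_coeffs])
    obtain w M where wM: "\<omega> = (w, \<lambda>j. enc_query (query r \<beta> (h' v) M j))" "w \<in> messages f \<beta> k" "M \<in> coeffs"
      using \<omega>(1) unfolding supp by blast
    obtain w' M' where wM': "\<omega>' = (w', \<lambda>j. enc_query (query r \<beta> (h' v) M' j))" "w' \<in> messages f \<beta> k" "M' \<in> coeffs"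
      using \<omega>(2) unfolding supp by blast
    have q_in: "query r \<beta> (h' v) N j \<in> queries" if "N \<in> coeffs" "j < n" for N j
      using bij_betwE[OF bij_betw_query[OF v that(2)]] that(1) by blast
    have "\<forall>j<n. enc_query (query r \<beta> (h' v) M j) = enc_query (query r \<beta> (h' v) M' j)"
      using eq by (simp add: wM(1) wM'(1))
    \<comment> \<open>A single query already determines \<open>M\<close>, so equal queries mean that
      both message tuples were mixed by the same matrix.\<close>
    then have "query r \<beta> (h' v) M 0 = query r \<beta> (h' v) M' 0"
      using n_pos inj_onD[OF inj_enc_query _ q_in[OF wM(3) n_pos] q_in[OF wM'(3) n_pos]] by blast
    then have MM: "M = M'"
      using inj_onD[OF bij_betw_imp_inj_on[OF bij_betw_query[OF v n_pos]] _ wM(3) wM'(3)] by blast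
    have "cand {v} w = cand {v} w'"
    proof (rule scheme_decodes[OF v wM(3,2) wM'(2)])
      fix j assume j: "j < n"
      have dec: "inv_into queries enc_query (enc_query (query r \<beta> (h' v) M j)) = query r \<beta> (h' v) M j"
        by (rule inv_into_f_f[OF inj_enc_query q_in[OF wM(3) j]])
      have "plc_answer G V scheme j \<omega> = plc_answer G V scheme j \<omega>'"
        using eq j by (simp add: wM(1) wM'(1))
      then have "enc_answer (answer_of (query r \<beta> (h' v) M j) (database_content G f j w))
          = enc_answer (answer_of (query r \<beta> (h' v) M j) (database_content G f j w'))"
        by (simp add: wM(1) wM'(1) MM[symmetric] plc_answer_def dims dec)
      then show "answer_of (query r \<beta> (h' v) M j) (database_content G f j w)
          = answer_of (query r \<beta> (h' v) M j) (database_content G f j w')"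
        by (rule inj_onD[OF inj_enc_answer _ answer_of_in answer_of_in])
    qed
    then show "?X \<omega> = ?X \<omega>'" unfolding wM(1) wM'(1) prod.case row_cand_eq_iff[OF v] .
  qed
  then show "prob_space.conditional_entropy (measure_pmf (plc_pmf G V scheme v)) (real CARD('q))
      (count_space (carrier_vec (\<beta> * k))) (count_space UNIV) ?X ?Y = 0"
    by (subst conditional_entropy_eq_0_iff_determined[OF q_gt_1 finite_carrier_vec X])
qed

lemma plc_answer_in: "plc_answer G V scheme j \<omega> \<in> enc_answer ` answers"
  by (cases \<omega>) (simp add: plc_answer_def answer_of_in)

lemma scheme_protocol: "plc_protocol_for G V scheme"
proof -
  have "finite_download G V scheme"
    unfolding finite_download_def
    by (intro allI impI finite_entropy_finite_range[OF q_gt_1 finite_imageI[OF finite_answers] plc_answer_in])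
  then show ?thesis
    using scheme_private scheme_recoverable \<beta>_pos by (simp add: plc_protocol_for_def)
qed

lemma scheme_download: "download_cost G V scheme v \<le> real n * real (card (answer_labels r \<kappa> \<delta>))"
proof -
  have "prob_space.entropy (measure_pmf (plc_pmf G V scheme v)) (real CARD('q)) (count_space UNIV) (plc_answer G V scheme j)
      \<le> real (card (answer_labels r \<kappa> \<delta>))" for j
  proof -
    have "prob_space.entropy (measure_pmf (plc_pmf G V scheme v)) (real CARD('q)) (count_space UNIV) (plc_answer G V scheme j)
        \<le> log (real CARD('q)) (real (card (enc_answer ` answers)))"
      by (rule entropy_le_card_range[OF q_gt_1 finite_imageI[OF finite_answers] plc_answer_in])
    also have "real (card (enc_answer ` answers)) = real CARD('q) ^ card (answer_labels r \<kappa> \<delta>)"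
      by (simp add: card_image[OF inj_enc_answer] card_answers)
    also have "log (real CARD('q)) \<dots> = real (card (answer_labels r \<kappa> \<delta>))"
      using q_gt_1 by (simp add: log_nat_power)
    finally show ?thesis .
  qed
  then have "download_cost G V scheme v \<le> (\<Sum>j<n. real (card (answer_labels r \<kappa> \<delta>)))"
    unfolding download_cost_def dims by (intro sum_mono)
  then show ?thesis by simp
qed

end

theorem theorem4:
  fixes G V :: "'q::{field,finite} mat" and n k f \<mu> r :: nat
  assumes "1 \<le> k" and "k \<le> n" and "1 \<le> \<mu>"
    and "G \<in> carrier_mat k n" and "vec_space.rank k G = k"
    and "MDS_PIR_capacity_achieving G"
    and "V \<in> carrier_mat \<mu> f" and "\<forall>v<\<mu>. row V v \<noteq> 0\<^sub>v f"
    and "vec_space.rank \<mu> V = r"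
  shows "is_plc_capacity G V
    (if k = n then inverse (\<Sum>v<r. (real k / real n) ^ v)
     else (1 - real k / real n) * inverse (1 - (real k / real n) ^ r))"
proof -
  note k = assms(1) and kn = assms(2) and \<mu> = assms(3) and G = assms(4) and mds = assms(6)
    and V = assms(7) and rows = assms(8) and rank = assms(9)
  obtain \<kappa> \<nu> I where \<nu>: "0 < \<nu>" and info: "\<And>u. u < \<nu> \<Longrightarrow> information_set G (I u)"
    and cover: "\<And>j. j < n \<Longrightarrow> card {u. u < \<nu> \<and> j \<in> I u} = \<kappa>" and prod: "\<kappa> * n = \<nu> * k"
  proof (rule MDS_PIR_information_sets[OF G k kn mds])
    fix \<kappa> \<nu> I
    assume "0 < \<nu>" "\<And>u. u < \<nu> \<Longrightarrow> information_set G (I u)"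
      "\<And>j. j < n \<Longrightarrow> card {u. u < \<nu> \<and> j \<in> I u} = \<kappa>" "\<kappa> * n = \<nu> * k"
    then show thesis by (rule that)
  qed
  have n: "0 < n" using k kn by simp
  have "\<kappa> * n \<le> \<nu> * n" using prod kn by simp
  then have \<kappa>\<nu>: "\<kappa> \<le> \<nu>" using n by simp
  \<comment> \<open>The number of information sets that avoid a given database; the subtraction is
    exact because \<open>\<kappa> \<le> \<nu>\<close>.\<close>
  define \<delta> where "\<delta> = \<nu> - \<kappa>"
  have \<nu>_eq: "\<kappa> + \<delta> = \<nu>" using \<kappa>\<nu> by (simp add: \<delta>_def)
  have rate: "real \<kappa> / real \<nu> = real k / real n"
    using prod \<nu> n by (simp add: field_simps) (metis of_nat_mult mult.commute)
  define S where "S = (\<Sum>i<r. (real k / real n) ^ i)"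
  have dims: "dim_row G = k" "dim_col G = n" "dim_row V = \<mu>" "dim_col V = f" using G V by auto
  obtain T where T: "T \<subseteq> {..<\<mu>}" "card T = r"
    "\<And>v. v < \<mu> \<Longrightarrow> \<exists>u. \<forall>m<f. V $$ (v, m) = (\<Sum>t\<in>T. u t * V $$ (t, m))"
  proof (rule rank_rows[OF V])
    fix T
    assume "T \<subseteq> {..<\<mu>}" "card T = vec_space.rank \<mu> V"
      "\<And>v. v < \<mu> \<Longrightarrow> \<exists>u. \<forall>m<f. V $$ (v, m) = (\<Sum>t\<in>T. u t * V $$ (t, m))"
    then show thesis unfolding rank by (rule that)
  qed
  have finT: "finite T" using T(1) finite_subset by blast
  obtain e where e: "bij_betw e {..<r} T"
    using finite_same_card_bij[of "{..<r}" T] finT T(2) by auto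
  define R where "R = (\<lambda>t m. V $$ (e t, m))"
  have "\<exists>c. \<forall>m<f. V $$ (v, m) = (\<Sum>t<r. c t * R t m)" if "v < \<mu>" for v
  proof -
    obtain u where "\<forall>m<f. V $$ (v, m) = (\<Sum>t\<in>T. u t * V $$ (t, m))"
      using T(3)[OF \<open>v < \<mu>\<close>] by (elim exE)
    then have "\<forall>m<f. V $$ (v, m) = (\<Sum>t<r. u (e t) * R t m)"
      unfolding R_def sum.reindex_bij_betw[OF e, of "\<lambda>t. u t * V $$ (t, _)"] .
    then show ?thesis by (intro exI[of _ "\<lambda>t. u (e t)"])
  qed
  then have "\<forall>v. \<exists>c. v < \<mu> \<longrightarrow> (\<forall>m<f. V $$ (v, m) = (\<Sum>t<r. c t * R t m))" by simp
  from choice[OF this] obtain c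
    where "\<forall>v. v < \<mu> \<longrightarrow> (\<forall>m<f. V $$ (v, m) = (\<Sum>t<r. c v t * R t m))"
    by (elim exE)
  then have c: "V $$ (v, m) = (\<Sum>t<r. c v t * R t m)" if "v < \<mu>" "m < f" for v m
    using that by simp
  \<comment> \<open>A nonzero row of \<open>V\<close> has nonzero coordinates, which supplies the
    pivot for \<open>completion_to_basis\<close>; since there is at least one row, it also gives
    \<open>0 < r\<close>.\<close>
  have c0: "\<exists>t<r. c v t \<noteq> 0" if v: "v < \<mu>" for v
  proof (rule ccontr)
    assume "\<not> ?thesis"
    then have "V $$ (v, m) = 0" if "m < f" for m using c[OF v that] by simp
    then have "row V v = 0\<^sub>v f" using V v by (intro eq_vecI) auto
    then show False using rows v by simp
  qed
  then have r: "0 < r" using \<mu> by (metis gr_implies_not0 gr_zeroI less_eq_Suc_le One_nat_def)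
  have "\<forall>v. \<exists>H :: (nat \<Rightarrow> nat \<Rightarrow> 'q) \<times> (nat \<Rightarrow> nat \<Rightarrow> 'q). v < \<mu> \<longrightarrow> (\<forall>s<r. \<forall>t. snd H s t \<noteq> 0 \<longrightarrow> t < r) \<and>
      (\<forall>s<r. \<forall>t. (\<Sum>u<r. snd H s u * fst H u t) = bvec s t) \<and> (\<forall>t. fst H t 0 = c v t)"
  proof
    fix v
    show "\<exists>H :: (nat \<Rightarrow> nat \<Rightarrow> 'q) \<times> (nat \<Rightarrow> nat \<Rightarrow> 'q). v < \<mu> \<longrightarrow> (\<forall>s<r. \<forall>t. snd H s t \<noteq> 0 \<longrightarrow> t < r) \<and>
      (\<forall>s<r. \<forall>t. (\<Sum>u<r. snd H s u * fst H u t) = bvec s t) \<and> (\<forall>t. fst H t 0 = c v t)"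
    proof (cases "v < \<mu>")
      case True
      obtain h h' :: "nat \<Rightarrow> nat \<Rightarrow> 'q" where "\<forall>s<r. \<forall>t. h' s t \<noteq> 0 \<longrightarrow> t < r"
        "\<forall>s<r. \<forall>t. (\<Sum>u<r. h' s u * h u t) = bvec s t" "\<forall>t. h t 0 = c v t"
        by (rule completion_to_basis[OF c0[OF True]])
      then show ?thesis by (intro exI[of _ "(h, h')"]) simp
    qed simp
  qed
  from choice[OF this] obtain H :: "nat \<Rightarrow> (nat \<Rightarrow> nat \<Rightarrow> 'q) \<times> (nat \<Rightarrow> nat \<Rightarrow> 'q)" where
    H: "\<forall>v. v < \<mu> \<longrightarrow> (\<forall>s<r. \<forall>t. snd (H v) s t \<noteq> 0 \<longrightarrow> t < r) \<and>
      (\<forall>s<r. \<forall>t. (\<Sum>u<r. snd (H v) s u * fst (H v) u t) = bvec s t) \<and> (\<forall>t. fst (H v) t 0 = c v t)"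
    by (elim exE)
  have H1: "\<forall>s<r. \<forall>t. snd (H v) s t \<noteq> 0 \<longrightarrow> t < r" if "v < \<mu>" for v using H that by simp
  have H2: "\<forall>s<r. \<forall>t. (\<Sum>u<r. snd (H v) s u * fst (H v) u t) = bvec s t" if "v < \<mu>" for v
    using H that by simp
  have H3: "\<forall>t. fst (H v) t 0 = c v t" if "v < \<mu>" for v using H that by simp
  interpret A: koszul_scheme G V n k \<kappa> \<delta> f \<mu> r I R c "\<lambda>v. fst (H v)" "\<lambda>v. snd (H v)"
  proof (unfold_locales, unfold \<nu>_eq)
    fix u assume u: "u < \<nu>"
    show "I u \<subseteq> {..<n}" using info[OF u] by (simp add: information_set_def dims)
  next
    fix u a and x :: "nat \<Rightarrow> 'q"
    assume u: "u < \<nu>" and x: "\<And>j. j \<in> I u \<Longrightarrow> (\<Sum>a<k. x a * G $$ (a, j)) = 0" and a: "a < k"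
    show "x a = 0" by (rule information_set_inj[OF G info[OF u] x a])
  next
    show "0 < \<nu> ^ r" using \<nu> by simp
  qed (rule refl G V k r n cover c H1 H2 H3; assumption)+
  have lower: "real (block P * k) * S \<le> download_cost G V P v" "H_min G V (block P) = 1"
    if P: "plc_protocol_for G V P" and v: "v < \<mu>" for P v
  proof -
    have \<beta>: "0 < block P" using P by (simp add: plc_protocol_for_def)
    interpret B: plc_scheme G V k n f \<mu> P I \<kappa> \<nu>
      by unfold_locales (use G V k \<beta> P \<nu> info cover in simp_all)
    show "real (block P * k) * S \<le> download_cost G V P v"
      using B.download_cost_lower_bound[OF v] unfolding S_def rank rate .
    show "H_min G V (block P) = 1" by (rule B.H_min_eq_1[OF \<mu> rows])
  qed
  have S_pos: "0 < S"
  proof -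
    have "0 < (real k / real n) ^ 0" by simp
    also have "\<dots> \<le> S" unfolding S_def by (rule member_le_sum) (use r in auto)
    finally show ?thesis .
  qed
  \<comment> \<open>The relation \<open>\<kappa> * n = \<nu> * k\<close> turns the count of answer
    symbols into the converse bound, with block length \<open>\<nu> ^ r\<close> absorbing the
    denominators.\<close>
  have upper: "download_cost G V A.scheme v \<le> real (block A.scheme * k) * S" for v
  proof -
    have pow: "real \<nu> * real \<nu> ^ (r - 1 - i) = real \<nu> ^ r / real \<nu> ^ i" if "i < r" for i
    proof -
      have "r = Suc (r - 1 - i) + i" using that by simp
      then have "real \<nu> ^ r = real \<nu> ^ Suc (r - 1 - i) * real \<nu> ^ i" by (metis power_add)
      then show ?thesis using \<nu> by simp
    qed
    have "real n * real (card (answer_labels r \<kappa> \<delta>)) = real (\<kappa> * n) * (\<Sum>i<r. real \<nu> ^ (r - 1 - i) * real \<kappa> ^ i)"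
      by (simp add: card_answer_labels \<nu>_eq)
    also have "\<dots> = real k * (\<Sum>i<r. real \<nu> * real \<nu> ^ (r - 1 - i) * real \<kappa> ^ i)"
      unfolding prod by (simp add: sum_distrib_left mult_ac)
    also have "(\<Sum>i<r. real \<nu> * real \<nu> ^ (r - 1 - i) * real \<kappa> ^ i) = (\<Sum>i<r. real \<nu> ^ r * (real \<kappa> / real \<nu>) ^ i)"
    proof (rule sum.cong[OF refl])
      fix i assume "i \<in> {..<r}"
      then show "real \<nu> * real \<nu> ^ (r - 1 - i) * real \<kappa> ^ i = real \<nu> ^ r * (real \<kappa> / real \<nu>) ^ i"
        using pow[of i] by (simp add: power_divide)
    qed
    also have "real k * \<dots> = real (block A.scheme * k) * S"
      by (simp add: S_def rate \<nu>_eq sum_distrib_left[symmetric] mult_ac)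
    finally show ?thesis using A.scheme_download[of v] by simp
  qed
  have "is_plc_capacity G V (inverse S)"
    unfolding is_plc_capacity_def
  proof (intro conjI allI impI)
    show "achievable_rate G V (inverse S)"
      unfolding achievable_rate_def
    proof (intro exI[of _ A.scheme] conjI allI impI)
      show "plc_protocol_for G V A.scheme" by (rule A.scheme_protocol)
      fix v assume "v < dim_row V"
      then have v: "v < \<mu>" using dims by simp
      \<comment> \<open>The number of symbols sent coincides with the lower bound, so the cost is
        known exactly, for every \<open>v\<close>.\<close>
      have "download_cost G V A.scheme v = real (block A.scheme * k) * S"
        using upper lower(1)[OF A.scheme_protocol v] by (rule antisym)
      moreover have "real (block A.scheme * k) \<noteq> 0" using k \<nu> by (simp add: \<nu>_eq)
      ultimately show "inverse S = real (block A.scheme * dim_row G) * H_min G V (block A.scheme) / download_cost G V A.scheme v"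
        unfolding dims lower(2)[OF A.scheme_protocol v] by (simp add: inverse_eq_divide)
    qed
  next
    fix R' assume "achievable_rate G V R'"
    then obtain P where P: "plc_protocol_for G V P"
      and R': "\<forall>v<\<mu>. R' = real (block P * k) * H_min G V (block P) / download_cost G V P v"
      unfolding achievable_rate_def dims by (elim exE conjE)
    have v: "0 < \<mu>" using \<mu> by simp
    let ?L = "real (block P * k)"
    have L: "0 < ?L" using P k by (simp add: plc_protocol_for_def)
    have "R' = ?L / download_cost G V P 0" using R'[rule_format, OF v] lower(2)[OF P v] by simp
    also have "\<dots> \<le> ?L / (?L * S)"
    \<comment> \<open>Division by the download cost requires it to be positive, which the lower
      bound also provides.\<close>
    proof (rule divide_left_mono[OF lower(1)[OF P v]])
      have "0 < ?L * S" using L S_pos by (rule mult_pos_pos)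
      then show "0 < download_cost G V P 0 * (?L * S)"
        using lower(1)[OF P v] by (rule_tac mult_pos_pos) linarith+
    qed (use L in simp)
    also have "\<dots> = inverse S"
    proof -
      have "x / (x * S) = inverse S" if "0 < x" for x using that by (simp add: inverse_eq_divide)
      then show ?thesis using L by blast
    qed
    finally show "R' \<le> inverse S" .
  qed
  moreover have "inverse S = (if k = n then inverse (\<Sum>v<r. (real k / real n) ^ v)
     else (1 - real k / real n) * inverse (1 - (real k / real n) ^ r))"
  proof (cases "k = n")
    case False
    then have "real k / real n \<noteq> 1" using n by simp
    then show ?thesis using False by (simp add: S_def sum_gp_strict inverse_eq_divide)
  qed (simp add: S_def)
  ultimately show ?thesis by simp
qed

end
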